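(* Let $n\ge1$ be an integer. The maximal proper graded submodule $\mathcal{SI}_n\subset\mathcal M_n(\widehat{\mathcal{SD}})$ contains a unique (up to scalar) nonzero element $D_+$ of minimal conformal weight, this weight is $n+\tfrac12$, $D_+$ is a singular vector, and $D_+$ generates $\mathcal{SI}_n$ as a vertex algebra ideal.
   Context: Let $D=t\frac{d}{dt}$. The Lie superalgebra $\mathcal{SD}$ of regular differential operators on the super circle is spanned by the elements $t^rF(D)$, $r\in\mathbb Z$, where $F(D)=\begin{pmatrix} f_0(D)&f_+(D)\\ f_-(D)&f_1(D)\end{pmatrix}$ with $f_a\in\mathbb C[x]$; diagonal entries are even and off-diagonal entries are odd. Its central extension $\widehat{\mathcal{SD}}=\mathcal{SD}\oplus\mathbb C C$ ($C$ central) has bracket $[t^rF(D),t^sG(D)]=t^{r+s}\big(F(D+s)G(D)-(-1)^{|F||G|}F(D)G(D+r)\big)+\Psi(t^rF(D),t^sG(D))\,C$, where $\Psi(t^rF(D),t^sG(D))=\sum_{j=-r}^{-1}\mathrm{Str}(F(j)G(j+r))$ if $r=-s\ge 0$ (extended by super-skew-symmetry) and $\Psi=0$ if $r+s\ne0$; here $\mathrm{Str}\begin{pmatrix}\alpha^0&\alpha^+\\ \alpha^-&\alpha^1\end{pmatrix}=\alpha^0-\alpha^1$. Let $M_0=E_{11}$, $M_1=E_{22}$, $M_+=E_{12}$, $M_-=E_{21}$ (matrix units), and for $a\in\{0,1,+,-\}$, $k\in\mathbb Z_{\ge0}$, $n\in\mathbb Z$ put $J^{a,k}_n=-t^{k+n}\partial_t^k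 M_a$. Let $\widehat{\mathcal{SP}}$ be the span of $C$ and of all $J^{a,k}_n$ with $k+n\ge0$; for $c\in\mathbb C$ let $\mathbb C_c$ be the one-dimensional $\widehat{\mathcal{SP}}$-module on which $C$ acts by $c$ and every $J^{a,k}_n$ acts by $0$. The vacuum module of central charge $c$ is $\mathcal M_c(\widehat{\mathcal{SD}})=U(\widehat{\mathcal{SD}})\otimes_{U(\widehat{\mathcal{SP}})}\mathbb C_c$; it is a vertex superalgebra freely generated by the fields $J^{a,k}(z)=\sum_{n\in\mathbb Z}J^{a,k}_nz^{-n-k-1}$, $k\ge0$, where $J^{0,k},J^{1,k}$ are even of conformal weight $k+1$, $J^{+,k}$ is odd of weight $k+\tfrac12$ and $J^{-,k}$ is odd of weight $k+\tfrac32$. Write $a\circ_m b$ for the $m$-th product of fields. A weight-homogeneous $\omega\in\mathcal M_c(\widehat{\mathcal{SD}})$ is a singular vector if $J^{0,k}\circ_m\omega=J^{1,k}\circ_m\omega=J^{-,k}\circ_m\omega=0$ for all $m>k\ge0$ and $J^{+,k}\circ_r\omega=0$ for all $r\ge k\ge0$. $\mathcal{SI}_c$ denotes the vertex algebra ideal generated by all singular vectors not proportional to the vacuum $1$; it is the maximal proper graded $\widehat{\mathcal{SD}}$-submodule of $\mathcal M_c(\widehat{\mathcal{SD}})$. *)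

theory Defs
  imports Complex_Main
begin

text \<open>Matrix units: E0 = E11, E1 = E22, Ep = E12, Em = E21.\<close>
datatype ent = E0 | E1 | Ep | Em

text \<open>Basis of the centrally extended algebra: Cb is the central element C,
  J a k n is the element J^{a,k}_n = - t^(k+n) d_t^k M_a = - t^n [D]_k M_a,
  where [D]_k = D(D-1)...(D-k+1).\<close>
datatype gb = Cb | J ent nat int

fun emul :: "ent \<Rightarrow> ent \<Rightarrow> ent option" where
  "emul E0 E0 = Some E0"
| "emul E0 Ep = Some Ep"
| "emul Ep E1 = Some Ep"
| "emul Ep Em = Some E0"
| "emul E1 E1 = Some E1"
| "emul E1 Em = Some Em"
| "emul Em E0 = Some Em"
| "emul Em Ep = Some E1"
| "emul _ _ = None"

definition odd_ent :: "ent \<Rightarrow> bool" where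
  "odd_ent a \<longleftrightarrow> a = Ep \<or> a = Em"

fun godd :: "gb \<Rightarrow> bool" where
  "godd Cb = False"
| "godd (J a k n) = odd_ent a"

definition ssgn :: "gb \<Rightarrow> gb \<Rightarrow> complex" where
  "ssgn x y = (if godd x \<and> godd y then -1 else 1)"

fun str_ent :: "ent option \<Rightarrow> complex" where
  "str_ent (Some E0) = 1"
| "str_ent (Some E1) = -1"
| "str_ent _ = 0"

definition ind :: "ent option \<Rightarrow> ent \<Rightarrow> complex" where
  "ind e c = (if e = Some c then 1 else 0)"

definition ff :: "complex \<Rightarrow> nat \<Rightarrow> complex" where
  "ff x k = (\<Prod>i<k. (x - of_nat i))"

text \<open>Coefficient of [D]_p in the expansion of a polynomial P in the falling factorial
  basis (Newton forward differences).\<close>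
definition fcoef :: "(complex \<Rightarrow> complex) \<Rightarrow> nat \<Rightarrow> complex" where
  "fcoef P p = (\<Sum>i\<le>p. (-1)^(p-i) * of_nat (p choose i) * P (of_nat i)) / fact p"

text \<open>The cocycle Psi on basis elements (with super-skew-symmetric extension).\<close>
fun psi :: "gb \<Rightarrow> gb \<Rightarrow> complex" where
  "psi (J a k n) (J b l m) =
     (if n + m \<noteq> 0 then 0
      else if n \<ge> 0 then
        (\<Sum>j\<in>{-n..-1}. ff (of_int j) k * ff (of_int (j + n)) l * str_ent (emul a b))
      else - ssgn (J a k n) (J b l m) *
        (\<Sum>j\<in>{-m..-1}. ff (of_int j) l * ff (of_int (j + m)) k * str_ent (emul b a)))"
| "psi _ _ = 0"

text \<open>The bracket of basis elements, as coefficient function in the basis: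
  [t^n F(D), t^m G(D)] = t^(n+m) (F(D+m)G(D) - (-1)^(|F||G|) F(D)G(D+n)) + Psi C,
  with F = -[D]_k M_a, G = -[D]_l M_b.\<close>
fun br :: "gb \<Rightarrow> gb \<Rightarrow> gb \<Rightarrow> complex" where
  "br (J a k n) (J b l m) z =
     (case z of
        Cb \<Rightarrow> psi (J a k n) (J b l m)
      | J c p q \<Rightarrow>
          (if q = n + m then
             - fcoef (\<lambda>x. ind (emul a b) c * ff (x + of_int m) k * ff x l
                        - ssgn (J a k n) (J b l m) * ind (emul b a) c * ff x k * ff (x + of_int n) l) p
           else 0))"
| "br _ _ _ = 0"

text \<open>Elements of the tensor algebra T over the basis: coefficient functions on words
  (finitely supported).  The vacuum module M_c = U(SD^)\<otimes>_{U(SP^)} C_c is T / Lrel c,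
  Lrel c being the span of u(xy - (-1)^{|x||y|}yx - [x,y])v and u(p - chi(p)), p \<in> SP^.\<close>
type_synonym tens = "gb list \<Rightarrow> complex"

definition Tfin :: "tens set" where
  "Tfin = {f. finite {w. f w \<noteq> 0}}"

definition wd :: "gb list \<Rightarrow> tens" where
  "wd w = (\<lambda>w'. if w' = w then 1 else 0)"

definition comm_rel :: "gb list \<Rightarrow> gb \<Rightarrow> gb \<Rightarrow> gb list \<Rightarrow> tens" where
  "comm_rel u x y v = (\<lambda>w. wd (u @ [x, y] @ v) w - ssgn x y * wd (u @ [y, x] @ v) w
     - (if length w = length u + 1 + length v \<and> take (length u) w = u
           \<and> drop (Suc (length u)) w = v then br x y (w ! length u) else 0))"

definition in_SP :: "gb \<Rightarrow> bool" where
  "in_SP x = (case x of Cb \<Rightarrow> True | J a k n \<Rightarrow> int k + n \<ge> 0)"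

definition chi :: "complex \<Rightarrow> gb \<Rightarrow> complex" where
  "chi c x = (case x of Cb \<Rightarrow> c | J a k n \<Rightarrow> 0)"

definition ind_rel :: "complex \<Rightarrow> gb list \<Rightarrow> gb \<Rightarrow> tens" where
  "ind_rel c u p = (\<lambda>w. wd (u @ [p]) w - chi c p * wd u w)"

inductive_set lspan :: "tens set \<Rightarrow> tens set" for S where
  zero: "(\<lambda>w. 0) \<in> lspan S"
| add: "f \<in> S \<Longrightarrow> g \<in> lspan S \<Longrightarrow> (\<lambda>w. a * f w + g w) \<in> lspan S"

definition Lrel :: "complex \<Rightarrow> tens set" where
  "Lrel c = lspan ({comm_rel u x y v | u x y v. True} \<union> {ind_rel c u p | u p. in_SP p})"

definition act :: "gb \<Rightarrow> tens \<Rightarrow> tens" where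
  "act x f = (\<lambda>w. case w of [] \<Rightarrow> 0 | y # w' \<Rightarrow> (if y = x then f w' else 0))"

text \<open>Submodules of M_c, represented by their preimages in T (subspaces containing Lrel c).\<close>
definition submod :: "complex \<Rightarrow> tens set \<Rightarrow> bool" where
  "submod c W \<longleftrightarrow> W \<subseteq> Tfin \<and> Lrel c \<subseteq> W
     \<and> (\<forall>f\<in>W. \<forall>g\<in>W. (\<lambda>w. f w + g w) \<in> W)
     \<and> (\<forall>f\<in>W. \<forall>a. (\<lambda>w. a * f w) \<in> W)
     \<and> (\<forall>f\<in>W. \<forall>x. act x f \<in> W)"

text \<open>Twice the conformal weight: J^{a,k}_n raises the weight by -n (a = 0,1),
  -n-1/2 (a = +), -n+1/2 (a = -).\<close>
fun gwt :: "gb \<Rightarrow> int" where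
  "gwt Cb = 0"
| "gwt (J a k n) = - 2 * n + (if a = Ep then -1 else if a = Em then 1 else 0)"

definition wwt :: "gb list \<Rightarrow> int" where
  "wwt w = sum_list (map gwt w)"

definition homog :: "int \<Rightarrow> tens \<Rightarrow> bool" where
  "homog d f \<longleftrightarrow> (\<forall>u. f u \<noteq> 0 \<longrightarrow> wwt u = d)"

definition comp :: "int \<Rightarrow> tens \<Rightarrow> tens" where
  "comp d f = (\<lambda>u. if wwt u = d then f u else 0)"

definition graded :: "tens set \<Rightarrow> bool" where
  "graded W \<longleftrightarrow> (\<forall>f\<in>W. \<forall>d. comp d f \<in> W)"

definition SI :: "complex \<Rightarrow> tens set" where
  "SI c = \<Union>{W. submod c W \<and> graded W \<and> W \<noteq> Tfin}"

text \<open>Submodule (= vertex algebra ideal) generated by v.\<close>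
definition gen_sub :: "complex \<Rightarrow> tens \<Rightarrow> tens set" where
  "gen_sub c v = \<Inter>{W. submod c W \<and> v \<in> W}"

text \<open>Singular vectors: J^{a,k} o_m w = J^{a,k}_{m-k} w = 0 in M_c.\<close>
definition singular :: "complex \<Rightarrow> tens \<Rightarrow> bool" where
  "singular c v \<longleftrightarrow> (\<exists>d. homog d v) \<and>
     (\<forall>a\<in>{E0, E1, Em}. \<forall>k m::nat. m > k \<longrightarrow> act (J a k (int m - int k)) v \<in> Lrel c) \<and>
     (\<forall>k r::nat. r \<ge> k \<longrightarrow> act (J Ep k (int r - int k)) v \<in> Lrel c)"

end

theory Submission
  imports Defs "HOL-Computational_Algebra.Polynomial" "HOL-Combinatorics.Multiset_Permutations"
    "HOL-Library.List_Lexorder" "HOL-Library.Function_Algebras" "HOL-Library.Nat_Bijection"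
begin

text \<open>On a vector of the vacuum module an element \<open>t\<^sup>n F(D)\<close> with \<open>F\<close> interpolating an indicator function
  acts as a matrix unit \<open>E h k\<close> of \<open>gl(\<infinity>|\<infinity>)\<close>, so that submodules are the same for both algebras.
  For central charge \<open>n\<close> the vector \<open>D = (E 2 0)\<^sup>n (E 2 1) vac\<close> is killed by the \<open>E h k\<close> with \<open>h < k\<close> and is
  an eigenvector of the \<open>E h h\<close>; hence it generates a submodule in which \<open>D\<close> has minimal weight
  and spans the vectors of this weight, and \<open>D\<close> lies in the radical.

  Conversely let \<open>I\<close> be a submodule containing \<open>D\<close>, hence also \<open>E 1 0 D = (E 2 0)\<^sup>n\<^sup>+\<^sup>1 vac\<close>, and let \<open>v\<close> lie in
  the radical.  One may take \<open>v\<close> to be a weight vector, and polarisation by matrix units makes all its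
  row and column indices distinct bosonic resp. fermionic ones.  It is then a combination of
  multilinear words indexed by permutations.  Polarising \<open>(E 2 0)\<^sup>n\<^sup>+\<^sup>1 vac\<close> puts the sums of all
  rearrangements of \<open>n + 1\<close> positions into \<open>I\<close>, so modulo \<open>I\<close> only words without decreasing
  subsequences of length \<open>n + 1\<close> remain.  On these the contravariant form is, up to sign,
  the trace form of the permutations on the tensor power of an \<open>n\<close>-dimensional space.  A permutation
  without long decreasing subsequences has an invariant colouring by \<open>n\<close> colours that no smaller
  permutation shares, so the form is nondegenerate there and \<open>v\<close> lies in \<open>I\<close>.

  That \<open>(E 2 0)\<^sup>n\<^sup>+\<^sup>1 vac\<close> does not vanish is seen on a Fock space, which is a module
  of central charge \<open>n\<close> built from \<open>n + 2\<close> families of oscillators, one of them with opposite statistics.\<close>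

section \<open>Vacuum modules over the central extension of \<open>gl(\<infinity>|\<infinity>)\<close>\<close>

text \<open>The identity \<open>E 0 2 (Dv r) = r (c - r) Dv (r - 1)\<close>, up to notation,
  explains the hypothesis on the charge: for \<open>c = n\<close> the chain of vectors
  \<open>Dv r\<close> breaks at \<open>r = n\<close>. The labelling is chosen so that
  \<open>E h k\<close> has doubled conformal weight \<open>h - k\<close>; the order of the integers
  is then the order of weights, and \<open>k < h\<close> describes the raising half. Even rows and
  odd columns are chosen since then contraction with the central term and substitution of a column
  carry the same sign, and the form is a trace form up to one global sign. Positivity of that trace
  form replaces any representation theory of symmetric groups. With only \<open>n\<close> copies of
  charge 1 the vector \<open>(E 2 0)^(n+1) vac\<close> would be zero, because there are just
  \<open>n\<close> fermionic modes of label 2; one more such copy and a copy of charge -1 keep the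
  total charge and add bosonic modes whose powers never vanish. The quotient defining the vacuum
  module is handled as the range of a projection on functions of words; this is why the module
  axioms carry the map \<open>pr\<close>.\<close>

definition sg :: "int \<Rightarrow> int \<Rightarrow> int \<Rightarrow> int \<Rightarrow> complex" where
  "sg h k l m = (if odd (h + k) \<and> odd (l + m) then -1 else 1)"

text \<open>The standard cocycle of infinite matrices with a supertrace sign: it is nonzero only on
  pairs \<open>E h k\<close>, \<open>E k h\<close> with exactly one index at most 1. Labels at most
  1 are the basis vectors with nonnegative exponent of \<open>t\<close>.\<close>

definition coc :: "int \<Rightarrow> int \<Rightarrow> int \<Rightarrow> int \<Rightarrow> complex" where
  "coc h k l m = (if h = m \<and> k = l
     then (if even h then 1 else -1) * ((if h \<le> 1 then 1 else 0) - (if k \<le> 1 then 1 else 0)) else 0)"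

lemma sg_nz [simp]: "sg h k l m \<noteq> 0"
  by (simp add: sg_def)

definition create :: "int \<times> int \<Rightarrow> bool" where
  "create x \<longleftrightarrow> 2 \<le> fst x \<and> snd x \<le> 1"

definition wt :: "(int \<times> int) list \<Rightarrow> int \<Rightarrow> int" where
  "wt ws h = int (count_list (map fst ws) h) - int (count_list (map snd ws) h)"

text \<open>A module over the central extension of \<open>gl(\<infinity>|\<infinity>)\<close>, generators indexed by integers whose parity is
  the parity of the basis vector.  The module may sit in a larger ambient space, to which the operators
  are extended along the projection \<open>pr\<close>.\<close>
locale glmod = vector_space scale
  for scale :: "complex \<Rightarrow> 'v::ab_group_add \<Rightarrow> 'v" (infixr "*s" 75) +
  fixes pr :: "'v \<Rightarrow> 'v" and E :: "int \<Rightarrow> int \<Rightarrow> 'v \<Rightarrow> 'v" and vac :: 'v and c :: complex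
  assumes pr_add: "pr (u + v) = pr u + pr v"
    and pr_scale: "pr (a *s v) = a *s pr v"
    and pr_idem: "pr (pr v) = pr v"
    and pr_E: "pr (E h k v) = E h k v"
    and E_pr: "E h k (pr v) = E h k v"
    and pr_vac: "pr vac = vac"
    and E_add: "E h k (u + v) = E h k u + E h k v"
    and E_scale: "E h k (a *s v) = a *s E h k v"
    and E_comm: "E h k (E l m v) = sg h k l m *s E l m (E h k v)
        + (if k = l then E h m v else 0) - (if h = m then sg h k l m *s E l k v else 0)
        + (coc h k l m * c) *s pr v"
    and E_vac: "\<not> create (h, k) \<Longrightarrow> E h k vac = 0"
begin

lemma pr_zero: "pr 0 = 0"
  using pr_scale[of 0 0] by simp

lemma pr_minus: "pr (- v) = - pr v"
  using pr_scale[of "-1" v] by simp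

lemma pr_sum: "pr (\<Sum>x\<in>S. f x) = (\<Sum>x\<in>S. pr (f x))"
  by (induction S rule: infinite_finite_induct) (auto simp: pr_add pr_zero)

lemma E_zero [simp]: "E h k 0 = 0"
  using E_scale[of h k 0 0] by simp

lemma E_minus: "E h k (- v) = - E h k v"
  using E_scale[of h k "-1" v] by simp

lemma E_diff: "E h k (u - v) = E h k u - E h k v"
  using E_add[of h k u "- v"] by (simp add: E_minus)

lemma E_sum: "E h k (\<Sum>x\<in>S. f x) = (\<Sum>x\<in>S. E h k (f x))"
  by (induction S rule: infinite_finite_induct) (auto simp: E_add)

section \<open>Words in matrix units and stable subspaces\<close>

definition ew :: "(int \<times> int) list \<Rightarrow> 'v \<Rightarrow> 'v" where
  "ew ws v = foldr (\<lambda>(h, k). E h k) ws v"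

lemma ew_Nil [simp]: "ew [] v = v"
  by (simp add: ew_def)

lemma ew_Cons [simp]: "ew ((h, k) # ws) v = E h k (ew ws v)"
  by (simp add: ew_def)

lemma ew_append [simp]: "ew (us @ ws) v = ew us (ew ws v)"
  by (simp add: ew_def)

lemma pr_ew: "pr d = d \<Longrightarrow> pr (ew ws d) = ew ws d"
  by (induction ws) (auto simp: pr_E)

lemma ew_add: "ew ws (u + v) = ew ws u + ew ws v"
  by (induction ws) (auto simp: E_add)

lemma ew_scale: "ew ws (a *s v) = a *s ew ws v"
  by (induction ws) (auto simp: E_scale)

lemma ew_zero [simp]: "ew ws 0 = 0"
  by (induction ws) auto

lemma ew_sum: "ew ws (\<Sum>x\<in>S. f x) = (\<Sum>x\<in>S. ew ws (f x))"
  by (induction S rule: infinite_finite_induct) (auto simp: ew_add)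

definition stable :: "'v set \<Rightarrow> bool" where
  "stable W \<longleftrightarrow> subspace W \<and> (\<forall>v\<in>W. \<forall>h k. E h k v \<in> W)"

lemma stableD: "stable W \<Longrightarrow> v \<in> W \<Longrightarrow> E h k v \<in> W"
  by (simp add: stable_def)

lemma stable_ew: "stable W \<Longrightarrow> v \<in> W \<Longrightarrow> ew ws v \<in> W"
  by (induction ws) (auto simp: stable_def)

lemma stable_subspace: "stable W \<Longrightarrow> subspace W"
  by (simp add: stable_def)

text \<open>The letters are restricted by a predicate so that one notion covers the monomials in
  creators, which span the vacuum module, and the words in raising letters applied to the singular
  vector.\<close>

definition wspan :: "(int \<times> int \<Rightarrow> bool) \<Rightarrow> 'v \<Rightarrow> 'v set" where
  "wspan R d = span {ew ws d | ws. list_all R ws}"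

lemma wspan_base: "list_all R ws \<Longrightarrow> ew ws d \<in> wspan R d"
  by (auto simp: wspan_def intro!: span_base)

lemma wspan_subspace: "subspace (wspan R d)"
  by (simp add: wspan_def)

lemma E_in_subspace:
  assumes "v \<in> span S" "subspace W" "\<And>x. x \<in> S \<Longrightarrow> E h k x \<in> W"
  shows "E h k v \<in> W"
  using assms(1)
proof (induction rule: span_induct_alt)
  case base
  show ?case using assms(2) by (simp add: subspace_0)
next
  case (step a x y)
  then show ?case using assms(2,3)
    by (simp add: E_add E_scale subspace_add subspace_scale)
qed

lemma wspan_E: "R (h, k) \<Longrightarrow> v \<in> wspan R d \<Longrightarrow> E h k v \<in> wspan R d"
  unfolding wspan_def[of R d]
  apply (erule E_in_subspace)
   apply simp
  apply clarify
  subgoal for _ ws by (rule span_base, rule CollectI, rule exI[of _ "(h, k) # ws"]) simp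
  done

text \<open>If the letters outside \<open>R\<close> act on \<open>d\<close> by scalars, they can be moved to the right
  past any word over \<open>R\<close>, by induction on the length of the word.\<close>
lemma wspan_stable:
  assumes d: "\<And>h k. \<not> R (h, k) \<Longrightarrow> \<exists>s. E h k d = s *s d" and "pr d = d"
  shows "stable (wspan R d)"
proof -
  have "E h k (ew ws d) \<in> wspan R d" if "list_all R ws" for ws h k
    using that
  proof (induction ws arbitrary: h k)
    case Nil
    show ?case
    proof (cases "R (h, k)")
      case True
      then show ?thesis using wspan_base[of R "[(h, k)]" d] by simp
    next
      case False
      then obtain s where "E h k d = s *s d" using d by blast
      then show ?thesis using wspan_base[of R "[]" d] wspan_subspace by (simp add: subspace_scale)
    qed
  next
    case (Cons x ws)
    obtain a b where x: "x = (a, b)" by force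
    from Cons x have R: "R (a, b)" "list_all R ws" by auto
    have "E a b (E h k (ew ws d)) \<in> wspan R d"
      using wspan_E Cons.IH R by blast
    then show ?case unfolding x ew_Cons E_comm[of h k a b] pr_ew[OF assms(2)]
      using wspan_subspace Cons.IH[OF R(2)] wspan_base[OF R(2)]
      by (intro subspace_add subspace_diff subspace_scale) (auto intro: subspace_scale subspace_0)
  qed
  then show ?thesis
    unfolding stable_def wspan_def
    by (auto elim!: E_in_subspace)
qed

definition V0 :: "'v set" where
  "V0 = wspan create vac"

lemma V0_stable: "stable V0"
  unfolding V0_def by (rule wspan_stable) (metis E_vac scale_zero_left, rule pr_vac)

lemma V0_subspace: "subspace V0"
  by (simp add: V0_def wspan_subspace)

lemma pr_V0: "v \<in> V0 \<Longrightarrow> pr v = v"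
  unfolding V0_def wspan_def
  by (induction rule: span_induct_alt) (auto simp: pr_add pr_scale pr_ew pr_vac pr_zero)

lemma ew_in_V0: "list_all create ws \<Longrightarrow> ew ws vac \<in> V0"
  by (simp add: V0_def wspan_base)

text \<open>A nonzero commutator with a creator needs row \<open>p\<close> or column
  \<open>i\<close>. The former is absent and columns are at most 1, so the operator passes through
  to the vacuum and kills it.\<close>

lemma E_row_absent:
  assumes "2 \<le> i" "2 \<le> p" "list_all create ws" "p \<notin> fst ` set ws"
  shows "E i p (ew ws vac) = 0"
  using assms(3,4)
proof (induction ws)
  case Nil
  show ?case using assms by (simp add: E_vac create_def)
next
  case (Cons x ws)
  obtain a b where x: "x = (a, b)" by force
  have "b \<noteq> i" "p \<noteq> a" using Cons assms by (auto simp: x create_def)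
  then show ?case using Cons
    by (simp add: x E_comm[of i p] coc_def)
qed

lemma E_col_absent:
  assumes "s \<le> 1" "r \<le> 1" "list_all create ws" "s \<notin> snd ` set ws"
  shows "E s r (ew ws vac) = 0"
  using assms(3,4)
proof (induction ws)
  case Nil
  show ?case using assms by (simp add: E_vac create_def)
next
  case (Cons x ws)
  obtain a b where x: "x = (a, b)" by force
  have "b \<noteq> s" "r \<noteq> a" using Cons assms by (auto simp: x create_def)
  then show ?case using Cons
    by (simp add: x E_comm[of s r] coc_def)
qed

text \<open>Passing a creator with column \<open>s\<close> and row \<open>a\<close> leaves
  \<open>E a p\<close>, which \<open>E_row_absent\<close> disposes of; a central term would need the
  absent row \<open>p\<close>.\<close>

lemma E_annih_absent:
  assumes "s \<le> 1" "2 \<le> p" "list_all create ws" "p \<notin> fst ` set ws"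
  shows "E s p (ew ws vac) = 0"
  using assms(3,4)
proof (induction ws)
  case Nil
  show ?case using assms by (simp add: E_vac create_def)
next
  case (Cons x ws)
  obtain a b where x: "x = (a, b)" by force
  have "create (a, b)" and ws: "list_all create ws" and "p \<noteq> a" using Cons.prems by (auto simp: x)
  then have ab: "2 \<le> a" "b \<le> 1" "list_all create ws" "p \<noteq> a" by (auto simp: create_def)
  have "E a p (ew ws vac) = 0" using E_row_absent Cons.prems assms ab by simp
  then show ?case using Cons ab
    by (simp add: x E_comm[of s p] coc_def)
qed

lemma create_commute:
  assumes "create (h, k)" "create (l, m)"
  shows "E h k (E l m v) = sg h k l m *s E l m (E h k v)"
  using assms by (simp add: E_comm[of h k] coc_def create_def)

lemma ew_torus:
  assumes "list_all create ws"
  shows "E h h (ew ws vac) = of_int (wt ws h) *s ew ws vac"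
  using assms
proof (induction ws)
  case Nil
  show ?case by (simp add: E_vac create_def wt_def)
next
  case (Cons x ws)
  obtain a b where x: "x = (a, b)" by force
  have "a \<noteq> b" using Cons by (auto simp: x create_def)
  moreover have "sg h h a b = 1" by (simp add: sg_def)
  moreover have "E a b (E h h (ew ws vac)) = of_int (wt ws h) *s E a b (ew ws vac)"
    using Cons by (simp add: E_scale)
  ultimately show ?case using Cons.prems
    by (auto simp: x E_comm[of h h] coc_def wt_def algebra_simps)
qed

section \<open>Weight spaces of the diagonal matrix units\<close>

definition WS :: "(int \<Rightarrow> int) \<Rightarrow> 'v set" where
  "WS \<mu> = {v \<in> V0. \<forall>h. E h h v = of_int (\<mu> h) *s v}"

text \<open>Separation of eigenvalues, by induction on the number of weights: subtracting an
  eigenvalue removes one component and rescales another by a nonzero factor.\<close>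

lemma weight_components:
  assumes "finite F" "stable W"
    and "\<And>\<mu> h. \<mu> \<in> F \<Longrightarrow> E h h (x \<mu>) = of_int (\<mu> h) *s x \<mu>"
    and "(\<Sum>\<mu>\<in>F. x \<mu>) \<in> W" "\<mu> \<in> F"
  shows "x \<mu> \<in> W"
  using assms(1,3-)
proof (induction F arbitrary: x \<mu> rule: finite_induct)
  case empty
  then show ?case by simp
next
  case (insert \<nu> F)
  note W = stable_subspace[OF assms(2)]
  have F: "x \<mu>' \<in> W" if "\<mu>' \<in> F" for \<mu>'
  proof -
    have "\<mu>' \<noteq> \<nu>" using that insert.hyps by auto
    then obtain h where h: "\<mu>' h \<noteq> \<nu> h" by auto
    \<comment> \<open>\<open>E h h - \<nu> h\<close> kills the component of \<open>\<nu>\<close>.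
      Other weights that agree with \<open>\<nu>\<close> at \<open>h\<close> are lost as well, but
      the chosen \<open>\<mu>'\<close> survives.\<close>
    define y where "y = (\<lambda>\<mu>. of_int (\<mu> h - \<nu> h) *s x \<mu>)"
    have eq: "E h h (\<Sum>\<mu>\<in>insert \<nu> F. x \<mu>) - of_int (\<nu> h) *s (\<Sum>\<mu>\<in>insert \<nu> F. x \<mu>) = (\<Sum>\<mu>\<in>F. y \<mu>)"
      using insert by (simp add: y_def E_add E_sum scale_right_distrib scale_sum_right
          scale_left_diff_distrib sum_subtractf)
    have "(\<Sum>\<mu>\<in>F. y \<mu>) \<in> W"
      unfolding eq[symmetric] using insert.prems(2) assms(2) W
      by (intro subspace_diff subspace_scale stableD) auto
    moreover have "E h' h' (y \<mu>) = of_int (\<mu> h') *s y \<mu>" if "\<mu> \<in> F" for \<mu> h'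
      using insert.prems(1)[of \<mu> h'] that by (simp add: y_def E_scale scale_left_commute)
    ultimately have "y \<mu>' \<in> W"
      using insert.IH[of y \<mu>'] that by blast
    then have "inverse (of_int (\<mu>' h - \<nu> h)) *s y \<mu>' \<in> W" using W by (simp add: subspace_scale)
    moreover have "inverse (of_int (\<mu>' h - \<nu> h)) *s y \<mu>' = x \<mu>'"
      using h by (simp add: y_def field_simps flip: of_int_diff)
    ultimately show ?thesis by simp
  qed
  show ?case
  proof (cases "\<mu> = \<nu>")
    case True
    have "(\<Sum>\<mu>\<in>insert \<nu> F. x \<mu>) - (\<Sum>\<mu>\<in>F. x \<mu>) \<in> W"
      using F by (intro subspace_diff[OF W insert.prems(2)] subspace_sum[OF W])
    then show ?thesis using True insert.hyps by simp
  next
    case False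
    then show ?thesis using insert.prems F by simp
  qed
qed

definition wtspan :: "(int \<Rightarrow> int) \<Rightarrow> 'v set" where
  "wtspan \<mu> = span {ew ws vac | ws. list_all create ws \<and> wt ws = \<mu>}"

lemma wtspan_WS: "wtspan \<mu> \<subseteq> WS \<mu>"
proof
  fix v assume "v \<in> wtspan \<mu>"
  then show "v \<in> WS \<mu>"
    unfolding wtspan_def
  proof (induction rule: span_induct_alt)
    case base
    then show ?case using V0_subspace by (simp add: WS_def subspace_0)
  next
    case (step a x y)
    then show ?case using V0_subspace
      by (auto simp: WS_def E_add E_scale ew_torus scale_right_distrib subspace_add subspace_scale ew_in_V0
          scale_left_commute)
  qed
qed

lemma V0_decomp:
  assumes "v \<in> V0"
  obtains F x where "finite F" "v = (\<Sum>\<mu>\<in>F. x \<mu>)" "\<And>\<mu>. x \<mu> \<in> wtspan \<mu>"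
proof -
  obtain t r where t: "finite t" "t \<subseteq> {ew ws vac | ws. list_all create ws}" and v: "v = (\<Sum>a\<in>t. r a *s a)"
    using assms unfolding V0_def wspan_def span_explicit by auto
  have "\<forall>a\<in>t. \<exists>ws. a = ew ws vac \<and> list_all create ws" using t by auto
  then obtain g where g: "\<And>a. a \<in> t \<Longrightarrow> a = ew (g a) vac \<and> list_all create (g a)" by metis
  define x where "x = (\<lambda>\<mu>. \<Sum>a\<in>{a \<in> t. wt (g a) = \<mu>}. r a *s a)"
  have "x \<mu> \<in> wtspan \<mu>" for \<mu>
    unfolding x_def wtspan_def
    by (intro span_sum span_scale span_base) (use g in auto)
  moreover have "v = (\<Sum>\<mu>\<in>(\<lambda>a. wt (g a)) ` t. x \<mu>)"
    unfolding v x_def by (rule sum.image_gen) fact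
  ultimately show ?thesis using that[of "(\<lambda>a. wt (g a)) ` t" x] t by auto
qed

text \<open>A vector of weight \<open>\<mu>\<close> minus its expansion into monomial components is
  zero; \<open>weight_components\<close> for the subspace \<open>{0}\<close> then identifies it with
  the \<open>\<mu>\<close>-component.\<close>

lemma WS_wtspan: "WS \<mu> = wtspan \<mu>"
proof
  show "WS \<mu> \<subseteq> wtspan \<mu>"
  proof
    fix v assume v: "v \<in> WS \<mu>"
    then obtain F x where F: "finite F" "v = (\<Sum>\<mu>\<in>F. x \<mu>)" "\<And>\<mu>. x \<mu> \<in> wtspan \<mu>"
      using V0_decomp unfolding WS_def by blast
    \<comment> \<open>Extension by 0 covers the case that \<open>\<mu>\<close> does not occur in
      \<open>F\<close>.\<close>
    define x' where "x' = (\<lambda>\<nu>. if \<nu> \<in> F then x \<nu> else 0)"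
    have x': "x' \<nu> \<in> wtspan \<nu>" for \<nu> using F(3) by (auto simp: x'_def wtspan_def span_zero)
    have "(\<Sum>\<nu>\<in>insert \<mu> F. x' \<nu>) = v"
      using F by (simp add: x'_def insert_absorb sum.insert_if)
    then have "(\<Sum>\<nu>\<in>insert \<mu> F. (x'(\<mu> := x' \<mu> - v)) \<nu>) = 0"
      using F(1) by (auto simp: sum.insert_remove algebra_simps intro!: sum.cong)
    then have sum0: "(\<Sum>\<nu>\<in>insert \<mu> F. (x'(\<mu> := x' \<mu> - v)) \<nu>) \<in> {0}" by simp
    have cl: "stable {0}" by (simp add: stable_def)
    have eig: "E h h ((x'(\<mu> := x' \<mu> - v)) \<nu>) = of_int (\<nu> h) *s (x'(\<mu> := x' \<mu> - v)) \<nu>" for \<nu> h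
    proof -
      have "E h h (x' \<nu>) = of_int (\<nu> h) *s x' \<nu>" "E h h v = of_int (\<mu> h) *s v"
        using x'[of \<nu>] wtspan_WS[of \<nu>] v by (auto simp: WS_def)
      then show ?thesis by (auto simp: E_diff scale_right_diff_distrib)
    qed
    have "(x'(\<mu> := x' \<mu> - v)) \<mu> \<in> {0}"
      by (rule weight_components[OF _ cl eig sum0]) (use F(1) in auto)
    then show "v \<in> wtspan \<mu>" using x'[of \<mu>] by simp
  qed
qed (rule wtspan_WS)

end

context glmod
begin

lemma V0_E: "v \<in> V0 \<Longrightarrow> E h k v \<in> V0"
  using V0_stable by (rule stableD)

text \<open>Columns of creators are at most 1, so weight 0 at an index \<open>p \<ge> 2\<close>
  means that row \<open>p\<close> is missing from every monomial of this weight.\<close>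

lemma WS_row_absent:
  assumes "v \<in> WS \<mu>" "\<mu> p = 0" "2 \<le> i" "2 \<le> p"
  shows "E i p v = 0"
proof -
  have "E i p (ew ws vac) = 0" if "list_all create ws" "wt ws = \<mu>" for ws
  proof (rule E_row_absent)
    have "p \<notin> snd ` set ws" using that(1) assms by (auto simp: list_all_iff create_def)
    then have "count_list (map snd ws) p = 0" by (simp add: count_list_0_iff)
    then have "count_list (map fst ws) p = 0" using that assms(2) by (auto simp: wt_def)
    then show "p \<notin> fst ` set ws" by (simp add: count_list_0_iff)
  qed (use assms that in auto)
  then have "E i p v \<in> {0}"
    using assms(1) unfolding WS_wtspan wtspan_def by (elim E_in_subspace) auto
  then show ?thesis by simp
qed

lemma WS_col_absent:
  assumes "v \<in> WS \<mu>" "\<mu> q = 0" "q \<le> 1" "j \<le> 1"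
  shows "E q j v = 0"
proof -
  have "E q j (ew ws vac) = 0" if "list_all create ws" "wt ws = \<mu>" for ws
  proof (rule E_col_absent)
    have "q \<notin> fst ` set ws" using that(1) assms by (auto simp: list_all_iff create_def)
    then have "count_list (map fst ws) q = 0" by (simp add: count_list_0_iff)
    then have "count_list (map snd ws) q = 0" using that assms(2) by (auto simp: wt_def)
    then show "q \<notin> snd ` set ws" by (simp add: count_list_0_iff)
  qed (use assms that in auto)
  then have "E q j v \<in> {0}"
    using assms(1) unfolding WS_wtspan wtspan_def by (elim E_in_subspace) auto
  then show ?thesis by simp
qed

lemma WS_E:
  assumes "v \<in> WS \<mu>" "h \<noteq> k"
  shows "E h k v \<in> WS (\<mu>(h := \<mu> h + 1, k := \<mu> k - 1))"
proof -
  have "E g g (E h k v) = of_int ((\<mu>(h := \<mu> h + 1, k := \<mu> k - 1)) g) *s E h k v" for g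
    using assms
    by (auto simp: WS_def E_comm[of g g] E_scale sg_def coc_def algebra_simps)
  then show ?thesis using assms V0_E by (auto simp: WS_def)
qed

lemma polarize_row:
  assumes "v \<in> WS \<mu>" "\<mu> p = 0" "2 \<le> i" "2 \<le> p" "i \<noteq> p"
  shows "E i p (E p i v) = of_int (\<mu> i) *s v"
  using assms WS_row_absent[of v \<mu> p i]
  by (simp add: E_comm[of i p p i] coc_def WS_def)

lemma polarize_col:
  assumes "v \<in> WS \<mu>" "\<mu> q = 0" "j \<le> 1" "q \<le> 1" "j \<noteq> q"
  shows "E q j (E j q v) = (- sg q j j q * of_int (\<mu> j)) *s v"
  using assms WS_col_absent[of v \<mu> q j]
  by (simp add: E_comm[of q j j q] coc_def WS_def)

lemma ew_move:
  assumes "create x" "list_all create ws"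
  shows "\<exists>e. e \<noteq> 0 \<and> ew (ws @ x # us) v = e *s ew (x # ws @ us) v"
  using assms(2)
proof (induction ws)
  case Nil
  show ?case by (auto intro: exI[of _ 1])
next
  case (Cons y ws)
  obtain a b where y: "y = (a, b)" by force
  obtain p q where x: "x = (p, q)" by force
  obtain e where e: "e \<noteq> 0" "ew (ws @ x # us) v = e *s ew (x # ws @ us) v"
    using Cons by auto
  have "ew ((y # ws) @ x # us) v = (e * sg a b p q) *s ew (x # (y # ws) @ us) v"
    using create_commute[of a b p q] Cons.prems assms(1) e(2) by (simp add: x y E_scale)
  then show ?case using e(1) by (metis mult_eq_0_iff sg_nz)
qed

text \<open>Creators supercommute, so reordering costs a sign; what the later reductions use of it
  is that it is invertible.\<close>

lemma ew_mset:
  assumes "mset ws = mset us" "list_all create ws"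
  shows "\<exists>e. e \<noteq> 0 \<and> ew ws v = e *s ew us v"
  using assms
proof (induction ws arbitrary: us)
  case Nil
  then show ?case by (auto intro: exI[of _ 1])
next
  case (Cons x ws)
  obtain p q where x: "x = (p, q)" by force
  have "x \<in> set us" using Cons.prems(1) by (metis list.set_intros(1) set_mset_mset)
  then obtain as bs where us: "us = as @ x # bs" by (meson split_list)
  have "list_all create us" using Cons.prems by (metis list_all_iff set_mset_mset)
  then obtain e where e: "e \<noteq> 0" "ew us v = e *s ew (x # as @ bs) v"
    using ew_move[of x as bs v] by (auto simp: us)
  obtain e' where e': "e' \<noteq> 0" "ew ws v = e' *s ew (as @ bs) v"
    using Cons.IH[of "as @ bs"] Cons.prems by (auto simp: us)
  have "ew (x # ws) v = (e' * inverse e) *s ew us v"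
    using e e' by (simp add: x E_scale)
  then show ?case using e(1) e'(1) by (metis mult_eq_0_iff nonzero_imp_inverse_nonzero)
qed

section \<open>The singular vector\<close>

text \<open>The generator of the maximal submodule, and the vector it is obtained from by the odd
  operator \<open>E 0 1\<close>.\<close>
definition Dv :: "nat \<Rightarrow> 'v" where
  "Dv n = (E 2 0 ^^ n) (E 2 1 vac)"

definition Zv :: "nat \<Rightarrow> 'v" where
  "Zv n = (E 2 0 ^^ n) vac"

lemma funpow_ew: "(E h k ^^ r) v = ew (replicate r (h, k)) v"
  by (induction r) auto

text \<open>Leibniz rule for a power when the commutator \<open>F\<close> itself commutes with the
  operator that is raised to the power.\<close>

lemma E_through:
  assumes "\<And>v. E h k (E l m v) = E l m (E h k v) + F v"
    and "\<And>v. F (E l m v) = E l m (F v)"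
  shows "E h k ((E l m ^^ r) v) = (E l m ^^ r) (E h k v) + of_nat r *s (E l m ^^ (r - 1)) (F v)"
proof (induction r)
  case 0
  show ?case by simp
next
  case (Suc r)
  have F: "F ((E l m ^^ r) v) = (E l m ^^ r) (F v)"
    by (induction r) (auto simp: assms(2))
  have "of_nat r *s E l m ((E l m ^^ (r - 1)) w) = of_nat r *s (E l m ^^ r) w" for w
    by (cases r) auto
  then show ?case
    by (simp add: assms(1) Suc F E_add E_scale scale_left_distrib)
qed

lemma E_20_0: "(E 2 0 ^^ r) 0 = 0"
  by (induction r) auto

text \<open>\<open>E 1 0\<close> commutes with \<open>E 2 0\<close> and turns the letter
  \<open>E 2 1\<close> into \<open>E 2 0\<close>. So any submodule containing \<open>Dv n\<close>
  contains the even power vector used for straightening.\<close>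

lemma E10_Dv: "E 1 0 (Dv n) = Zv (Suc n)"
proof -
  have "E 1 0 (E 2 0 v) = E 2 0 (E 1 0 v) + 0" for v
    by (simp add: E_comm[of 1 0 2 0] sg_def coc_def)
  then have "E 1 0 ((E 2 0 ^^ n) v) = (E 2 0 ^^ n) (E 1 0 v)" for v
    by (simp add: E_through[where F = "\<lambda>_. 0"] E_20_0)
  moreover have "E 1 0 (E 2 1 vac) = E 2 0 vac"
    by (simp add: E_comm[of 1 0 2 1] sg_def coc_def E_vac create_def)
  ultimately show ?thesis
    by (simp add: Dv_def Zv_def funpow_swap1)
qed

lemma Dv_WS: "Dv n \<in> WS (wt (replicate n (2, 0) @ [(2, 1)]))"
proof -
  have "list_all create (replicate n (2, 0) @ [(2, 1)])"
    by (auto simp: list_all_iff create_def)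
  then have "ew (replicate n (2, 0) @ [(2, 1)]) vac \<in> wtspan (wt (replicate n (2, 0) @ [(2, 1)]))"
    unfolding wtspan_def by (blast intro: span_base)
  then show ?thesis by (simp add: WS_wtspan Dv_def funpow_ew)
qed

lemma pr_Dv: "pr (Dv n) = Dv n"
  unfolding Dv_def funpow_ew by (rule pr_ew) (rule pr_E)

text \<open>An sl2 computation: \<open>[E 0 2, E 2 0]\<close> is \<open>E 0 0 - E 2 2 + c\<close>,
  which acts on \<open>Dv r\<close> by \<open>c - 2 r - 1\<close>; summing over the smaller powers
  gives \<open>r (c - r)\<close>.\<close>

lemma E02_Dv: "E 0 2 (Dv r) = (of_nat r * (c - of_nat r)) *s Dv (r - 1)"
proof (induction r)
  case 0
  show ?case
    by (simp add: Dv_def E_comm[of 0 2 2 1] sg_def coc_def E_vac create_def)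
next
  case (Suc r)
  have Suc_Dv: "Dv (Suc r) = E 2 0 (Dv r)" for r by (simp add: Dv_def)
  have "wt (replicate r (2, 0) @ [(2, 1)]) 0 = - int r" "wt (replicate r (2, 0) @ [(2, 1)]) 2 = int r + 1"
    by (induction r) (auto simp: wt_def)
  then have t: "E 0 0 (Dv r) = (- of_nat r) *s Dv r" "E 2 2 (Dv r) = (of_nat r + 1) *s Dv r"
    using Dv_WS[of r] by (auto simp: WS_def)
  have "of_nat r *s E 2 0 (Dv (r - 1)) = of_nat r *s Dv r"
    by (cases r) (auto simp: Suc_Dv)
  then have "(of_nat r * (c - of_nat r)) *s E 2 0 (Dv (r - 1)) = (of_nat r * (c - of_nat r)) *s Dv r"
    by (metis mult.commute scale_scale)
  then have "E 2 0 (E 0 2 (Dv r)) = (of_nat r * (c - of_nat r)) *s Dv r"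
    by (simp only: Suc E_scale)
  moreover have "E 0 2 (Dv (Suc r)) = E 2 0 (E 0 2 (Dv r)) + E 0 0 (Dv r) - E 2 2 (Dv r) + c *s Dv r"
    by (simp add: Suc_Dv E_comm[of 0 2 2 0] sg_def coc_def pr_Dv)
  ultimately have "E 0 2 (Dv (Suc r)) = (of_nat r * (c - of_nat r)) *s Dv r + (- of_nat r) *s Dv r
      - (of_nat r + 1) *s Dv r + c *s Dv r"
    by (simp only: t)
  also have "\<dots> = (of_nat r * (c - of_nat r) + - of_nat r - (of_nat r + 1) + c) *s Dv r"
    by (simp only: scale_left_distrib scale_left_diff_distrib)
  also have "of_nat r * (c - of_nat r) + - of_nat r - (of_nat r + 1) + c = of_nat (Suc r) * (c - of_nat (Suc r))"
    by (simp add: algebra_simps)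
  finally show ?case by simp
qed

text \<open>The value of \<open>c\<close> enters for \<open>E 0 2\<close>, by \<open>E02_Dv\<close>,
  and for \<open>E 1 2\<close>, where two contributions cancel. For \<open>E 0 1\<close> the
  commutator produces a second \<open>E 2 1\<close>, and the square of this odd operator is zero. In
  the other cases the operator and its commutators reach the vacuum and kill it.\<close>

lemma E_Dv_zero:
  assumes "h < k" "c = of_nat n"
  shows "E h k (Dv n) = 0"
proof -
  have comm: "E h k (E 2 0 v) = E 2 0 (E h k v)
      + ((if k = 2 then E h 0 v else 0) - (if h = 0 then E 2 k v else 0))" if "\<not> (h = 0 \<and> k = 2)" for v
    using that by (auto simp: E_comm[of h k 2 0] sg_def coc_def)
  have E20: "E h 0 (E 2 0 v) = E 2 0 (E h 0 v)" if "h \<noteq> 0" for h v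
    using that by (simp add: E_comm[of h 0 2 0] sg_def coc_def)
  have E2k: "E 2 k (E 2 0 v) = E 2 0 (E 2 k v)" if "k \<noteq> 2" for k v
    using that by (simp add: E_comm[of 2 k 2 0] sg_def coc_def)
  consider "h = 0" "k = 2" | "k = 2" "h \<noteq> 0" "h \<noteq> 1" | "k = 2" "h = 1" | "h = 0" "k = 1"
    | "h = 0" "k > 2" | "h \<noteq> 0" "k \<noteq> 2"
    using assms(1) by linarith
  then show ?thesis
  proof cases
    case 1
    then show ?thesis by (simp add: E02_Dv assms)
  next
    case 2
    have "E h 0 (E 2 1 vac) = 0" "E h 2 (E 2 1 vac) = 0"
      using 2 assms by (simp_all add: E_comm[of h 0 2 1] E_comm[of h 2 2 1] coc_def E_vac create_def)
    then show ?thesis unfolding Dv_def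
      by (subst E_through[where F = "E h 0"]) (use 2 comm E20 in \<open>auto simp: E_20_0\<close>)
  next
    case 3
    have *: "E 1 0 (E 2 1 vac) = E 2 0 vac" "E 1 2 (E 2 1 vac) = - c *s vac"
      by (simp_all add: E_comm[of 1 0 2 1] E_comm[of 1 2 2 1] sg_def coc_def E_vac create_def pr_vac)
    \<comment> \<open>The scalar \<open>-c\<close> is the contraction with \<open>E 2 1\<close>. The
      factor \<open>n\<close> counts the letters \<open>E 2 0\<close> that may become
      \<open>E 1 0\<close>, which then turns \<open>E 2 1\<close> into \<open>E 2 0\<close>.\<close>
    have "E 1 2 (Dv n) = (E 2 0 ^^ n) (- c *s vac) + of_nat n *s (E 2 0 ^^ (n - 1)) (E 2 0 vac)"
      unfolding Dv_def by (subst E_through[where F = "E 1 0"]) (use 3 comm E20 * in auto)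
    also have "of_nat n *s (E 2 0 ^^ (n - 1)) (E 2 0 vac) = of_nat n *s (E 2 0 ^^ n) vac"
      by (cases n) (simp_all add: funpow_swap1)
    also have "(E 2 0 ^^ n) (- c *s vac) = - c *s (E 2 0 ^^ n) vac"
      by (simp only: funpow_ew ew_scale)
    finally show ?thesis using 3 assms(2) by simp
  next
    case 4
    have "E 2 1 (E 2 1 vac) = - E 2 1 (E 2 1 vac)"
      using E_comm[of 2 1 2 1 vac] by (simp add: sg_def coc_def)
    then have "(1 + 1) *s E 2 1 (E 2 1 vac) = 0"
      by (simp only: scale_left_distrib scale_one eq_neg_iff_add_eq_0)
    then have *: "E 2 1 (E 2 1 vac) = 0" "E 0 1 (E 2 1 vac) = 0"
      by (simp_all add: E_comm[of 0 1 2 1] sg_def coc_def E_vac create_def)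
    show ?thesis unfolding Dv_def
      by (subst E_through[where F = "\<lambda>v. - E 2 1 v"])
        (use 4 comm E2k * in \<open>auto simp: E_20_0 E_minus\<close>)
  next
    case 5
    have *: "E 0 k (E 2 1 vac) = 0" "E 2 k (E 2 1 vac) = 0"
      using 5 by (simp_all add: E_comm[of 0 k 2 1] E_comm[of 2 k 2 1] coc_def E_vac create_def)
    show ?thesis unfolding Dv_def
      by (subst E_through[where F = "\<lambda>v. - E 2 k v"])
        (use 5 comm E2k * in \<open>auto simp: E_20_0 E_minus\<close>)
  next
    case 6
    have *: "E h k (E 2 1 vac) = 0"
      using 6 assms by (auto simp: E_comm[of h k 2 1] coc_def E_vac create_def)
    show ?thesis unfolding Dv_def
      by (subst E_through[where F = "\<lambda>v. 0"])
        (use 6 comm * in \<open>auto simp: E_20_0\<close>)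
  qed
qed

text \<open>The letters with \<open>h \<le> k\<close> act on \<open>Dv n\<close> by scalars, so the
  raising letters alone already generate a submodule. This is what bounds the conformal weights in
  it from below.\<close>

lemma Dv_stable:
  assumes "c = of_nat n"
  shows "stable (wspan (\<lambda>(h, k). k < h) (Dv n))"
proof (rule wspan_stable)
  fix h k :: int assume "\<not> (case (h, k) of (h, k) \<Rightarrow> k < h)"
  then consider "h < k" | "h = k" by force
  then show "\<exists>s. E h k (Dv n) = s *s Dv n"
  proof cases
    case 1
    then show ?thesis using E_Dv_zero assms by (metis scale_zero_left)
  next
    case 2
    then show ?thesis using Dv_WS[of n] by (auto simp: WS_def)
  qed
qed (rule pr_Dv)

end

section \<open>Straightening\<close>

lemma list_less_at:
  fixes xs ys :: "int list"
  assumes "length xs = length ys" "k < length xs" "\<And>i. i < k \<Longrightarrow> xs ! i = ys ! i" "xs ! k < ys ! k"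
  shows "xs < ys"
proof -
  have "take k xs = take k ys" using assms by (auto intro!: nth_equalityI)
  then show ?thesis
    using id_take_nth_drop[of k xs] id_take_nth_drop[of k ys] assms
    unfolding list_less_def lexord_def by (metis (mono_tags, lifting) UnI2 case_prodI mem_Collect_eq)
qed

lemma first_difference:
  assumes "length xs = length ys" "xs \<noteq> ys"
  obtains k where "k < length xs" "\<And>i. i < k \<Longrightarrow> xs ! i = ys ! i" "xs ! k \<noteq> ys ! k"
proof -
  define k where "k = (LEAST k. k < length xs \<and> xs ! k \<noteq> ys ! k)"
  have "\<exists>k. k < length xs \<and> xs ! k \<noteq> ys ! k" using assms by (meson nth_equalityI)
  then have "k < length xs \<and> xs ! k \<noteq> ys ! k" unfolding k_def by (rule LeastI_ex)
  moreover have "xs ! i = ys ! i" if "i < k" for i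
    using not_less_Least[of i "\<lambda>k. k < length xs \<and> xs ! k \<noteq> ys ! k"] that calculation
    unfolding k_def by auto
  ultimately show ?thesis using that by blast
qed

text \<open>At the first difference the new entry comes from a later position of \<open>K\<close>,
  and on \<open>K\<close> later entries are smaller.\<close>

lemma rearranged_decreasing_less:
  fixes rs rs' :: "int list"
  assumes "rs \<in> permutations_of_set Q" "rs' \<in> permutations_of_set Q" "rs' \<noteq> rs"
    and out: "\<And>i. i < length rs \<Longrightarrow> i \<notin> K \<Longrightarrow> rs' ! i = rs ! i"
    and dec: "\<And>i j. i \<in> K \<Longrightarrow> j \<in> K \<Longrightarrow> i < j \<Longrightarrow> rs ! j < rs ! i"
  shows "rs' < rs"
proof -
  have d: "distinct rs" "distinct rs'" "set rs = Q" "set rs' = Q"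
    using assms by (auto simp: permutations_of_set_def)
  then have len: "length rs' = length rs" by (metis distinct_card)
  from len assms(3) obtain k where k: "k < length rs'" "\<And>i. i < k \<Longrightarrow> rs' ! i = rs ! i" "rs' ! k \<noteq> rs ! k"
    using first_difference[of rs' rs] by blast
  have "rs' ! k \<in> set rs'" using k by simp
  then have "rs' ! k \<in> set rs" using d by simp
  then obtain l where l: "l < length rs" "rs ! l = rs' ! k" by (metis in_set_conv_nth)
  have "l \<noteq> k" using k l by metis
  then have "l \<in> K" using out[of l] l k d len by (metis nth_eq_iff_index_eq)
  moreover have "k \<in> K" using out k len by metis
  moreover have "\<not> l < k" using k l d len by (metis nth_eq_iff_index_eq)
  ultimately have "rs ! l < rs ! k" using dec[of k l] \<open>l \<noteq> k\<close> by simp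
  then show ?thesis using list_less_at[of rs' rs k] k l len by simp
qed

section \<open>Invariant colourings and their Gram form\<close>

lemma sum_PiE_insert:
  assumes "x \<notin> S"
  shows "(\<Sum>h\<in>insert x S \<rightarrow>\<^sub>E T. F h) = (\<Sum>g\<in>S \<rightarrow>\<^sub>E T. \<Sum>y\<in>T. F (g(x := y)))"
proof -
  have "(\<Sum>h\<in>insert x S \<rightarrow>\<^sub>E T. F h) = (\<Sum>(y, g)\<in>T \<times> (S \<rightarrow>\<^sub>E T). F (g(x := y)))"
    unfolding PiE_insert_eq using inj_combinator[OF assms, of "\<lambda>_. T"]
    by (subst sum.reindex) (auto intro!: sum.cong)
  also have "\<dots> = (\<Sum>y\<in>T. \<Sum>g\<in>S \<rightarrow>\<^sub>E T. F (g(x := y)))"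
    by (rule sum.cartesian_product[symmetric])
  finally show ?thesis by (subst sum.swap)
qed

text \<open>The number of colourings with \<open>n\<close> colours that are invariant under the permutation
  \<open>ss \<mapsto> rs\<close>, i.e. its trace on the \<open>m\<close>-th tensor power of an \<open>n\<close>-dimensional space.\<close>
definition invcol :: "nat \<Rightarrow> int list \<Rightarrow> int list \<Rightarrow> int set \<Rightarrow> complex" where
  "invcol n ss rs Q = (\<Sum>h\<in>Q \<rightarrow>\<^sub>E {..<n}. if map h ss = map h rs then 1 else 0)"

text \<open>A fixed point is free to take any of the \<open>n\<close> colours; this will match the
  factor produced by the central charge.\<close>

lemma invcol_fixed:
  assumes "s \<notin> Q" "set ss \<subseteq> Q" "set rs \<subseteq> Q"
  shows "invcol n (s # ss) (s # rs) (insert s Q) = of_nat n * invcol n ss rs Q"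
proof -
  have "map (g(s := y)) ss = map g ss" "map (g(s := y)) rs = map g rs" for g :: "int \<Rightarrow> nat" and y
    using assms by (auto simp: fun_upd_def)
  then have "map (g(s := y)) (s # ss) = map (g(s := y)) (s # rs) \<longleftrightarrow> map g ss = map g rs"
    for g :: "int \<Rightarrow> nat" and y
    by (simp only: list.map list.inject) simp
  then show ?thesis
    unfolding invcol_def sum_PiE_insert[OF assms(1)]
    by (simp only: sum_constant sum_distrib_left) simp
qed

text \<open>The colour of \<open>s\<close> is forced to be that of \<open>r\<close>, so
  \<open>s\<close> can be cut out of its cycle. The substitution is the one that
  \<open>E s r\<close> performs on a word.\<close>

lemma invcol_moved:
  assumes "s \<notin> Q" "r \<in> Q" "set ss \<subseteq> Q" "set rs \<subseteq> insert s Q"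
  shows "invcol n (s # ss) (r # rs) (insert s Q) = invcol n ss (map (\<lambda>x. if x = s then r else x) rs) Q"
proof -
  have rs: "r \<noteq> s" using assms by auto
  have 1: "map (g(s := y)) ss = map g ss" for g :: "int \<Rightarrow> nat" and y
    using assms by (auto simp: fun_upd_def)
  have 2: "map (g(s := g r)) rs = map g (map (\<lambda>x. if x = s then r else x) rs)" for g :: "int \<Rightarrow> nat"
    by (auto simp: fun_upd_def)
  have "(\<Sum>y<n. if map (g(s := y)) (s # ss) = map (g(s := y)) (r # rs) then 1 else 0 :: complex)
      = (if map g ss = map g (map (\<lambda>x. if x = s then r else x) rs) then 1 else 0)"
    if "g \<in> Q \<rightarrow>\<^sub>E {..<n}" for g
  proof -
    have "g r < n" using that assms(2) by auto
    have "(\<Sum>y<n. if map (g(s := y)) (s # ss) = map (g(s := y)) (r # rs) then 1 else 0 :: complex)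
      = (\<Sum>y<n. if y = g r then (if map g ss = map (g(s := g r)) rs then 1 else 0) else 0)"
    proof (intro sum.cong refl)
      fix y
      have "map (g(s := y)) (s # ss) = map (g(s := y)) (r # rs)
          \<longleftrightarrow> y = g r \<and> map g ss = map (g(s := y)) rs"
        using rs by (simp only: list.map list.inject 1) simp
      then show "(if map (g(s := y)) (s # ss) = map (g(s := y)) (r # rs) then 1 else 0 :: complex)
          = (if y = g r then (if map g ss = map (g(s := g r)) rs then 1 else 0) else 0)"
        by (auto simp del: map_eq_conv)
    qed
    then show ?thesis using \<open>g r < n\<close> by (simp only: 2) simp
  qed
  then show ?thesis
    unfolding invcol_def sum_PiE_insert[OF assms(1)] by (intro sum.cong refl)
qed

text \<open>Grouping by the values of \<open>f\<close> yields squared moduli; nondegeneracy of the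
  form will rest on this positivity.\<close>

lemma gram_sum:
  fixes b :: "'a \<Rightarrow> complex"
  assumes "finite G"
  shows "(\<Sum>x\<in>G. \<Sum>y\<in>G. if f x = f y then cnj (b x) * b y else 0)
    = of_real (\<Sum>w\<in>f ` G. (cmod (\<Sum>x\<in>{x \<in> G. f x = w}. b x))\<^sup>2)"
proof -
  have "(\<Sum>x\<in>G. \<Sum>y\<in>G. if f x = f y then cnj (b x) * b y else 0)
      = (\<Sum>x\<in>G. cnj (b x) * (\<Sum>y\<in>{y \<in> G. f y = f x}. b y))"
    using assms by (auto simp: sum_distrib_left sum.inter_filter intro!: sum.cong)
  also have "\<dots> = (\<Sum>w\<in>f ` G. \<Sum>x\<in>{x \<in> G. f x = w}. cnj (b x) * (\<Sum>y\<in>{y \<in> G. f y = f x}. b y))"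
    using assms by (rule sum.image_gen)
  also have "\<dots> = (\<Sum>w\<in>f ` G. cnj (\<Sum>x\<in>{x \<in> G. f x = w}. b x) * (\<Sum>x\<in>{x \<in> G. f x = w}. b x))"
    by (intro sum.cong refl) (simp add: sum_distrib_right)
  also have "\<dots> = of_real (\<Sum>w\<in>f ` G. (cmod (\<Sum>x\<in>{x \<in> G. f x = w}. b x))\<^sup>2)"
    by (simp add: complex_norm_square mult.commute del: cnj_sum of_real_power)
  finally show ?thesis .
qed

definition good :: "nat \<Rightarrow> int list \<Rightarrow> bool" where
  "good n rs \<longleftrightarrow> \<not> (\<exists>K \<subseteq> {..<length rs}. card K = Suc n \<and> (\<forall>i\<in>K. \<forall>j\<in>K. i < j \<longrightarrow> rs ! j < rs ! i))"

text \<open>Colour each position by the length of the longest decreasing subsequence ending there.\<close>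
lemma good_colouring:
  assumes "good n rs" "distinct rs"
  obtains h where "h \<in> set rs \<rightarrow>\<^sub>E {..<n}"
    and "\<And>i j. j < length rs \<Longrightarrow> i < j \<Longrightarrow> h (rs ! i) = h (rs ! j) \<Longrightarrow> rs ! i < rs ! j"
proof -
  define Ks where "Ks = (\<lambda>j. {K. K \<subseteq> {..j} \<and> j \<in> K \<and> (\<forall>i\<in>K. \<forall>j\<in>K. i < j \<longrightarrow> rs ! j < rs ! i)})"
  define g where "g = (\<lambda>j. Max (card ` Ks j))"
  have fin: "finite (Ks j)" for j
    by (rule finite_subset[of _ "Pow {..j}"]) (auto simp: Ks_def)
  have ne: "{j} \<in> Ks j" for j by (auto simp: Ks_def)
  have g_attained: "\<exists>K\<in>Ks j. g j = card K" for j
    using Max_in[of "card ` Ks j"] fin ne unfolding g_def by fastforce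
  have g_ge: "card K \<le> g j" if "K \<in> Ks j" for K j
    unfolding g_def using that fin by simp
  have g_pos: "1 \<le> g j" for j using g_ge[OF ne, of j] by simp
  have g_le: "g j \<le> n" if "j < length rs" for j
  proof (rule ccontr)
    assume "\<not> g j \<le> n"
    obtain K where K: "K \<in> Ks j" "g j = card K" using g_attained by blast
    then obtain K' where "K' \<subseteq> K" "card K' = Suc n"
      using obtain_subset_with_card_n[of "Suc n" K] \<open>\<not> g j \<le> n\<close> by (metis not_less_eq_eq)
    moreover have "K \<subseteq> {..<length rs}" using K that by (auto simp: Ks_def)
    moreover have "\<forall>i\<in>K'. \<forall>j\<in>K'. i < j \<longrightarrow> rs ! j < rs ! i"
      using K \<open>K' \<subseteq> K\<close> by (auto simp: Ks_def)
    ultimately show False using assms(1) unfolding good_def by (metis subset_trans)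
  qed
  \<comment> \<open>A decreasing subsequence ending at \<open>i\<close> is prolonged by
    \<open>j\<close>, so equal colours force an ascent.\<close>
  have g_less: "g i < g j" if "i < j" "rs ! j < rs ! i" for i j
  proof -
    obtain K where K: "K \<in> Ks i" "g i = card K" using g_attained by blast
    have "finite K" "j \<notin> K" using K that by (auto simp: Ks_def intro: finite_subset)
    moreover have "rs ! b < rs ! a" if ab: "a \<in> insert j K" "b \<in> insert j K" "a < b" for a b
    proof -
      have le: "x \<le> i" if "x \<in> K" for x using K that by (auto simp: Ks_def)
      have dec: "rs ! y < rs ! x" if "x \<in> K" "y \<in> K" "x < y" for x y
        using K that by (auto simp: Ks_def)
      have "a \<noteq> j" using ab le[of b] \<open>i < j\<close> by auto
      then have "a \<in> K" using ab by simp
      have "i \<in> K" using K by (simp add: Ks_def)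
      show ?thesis
      proof (cases "b = j")
        case True
        then show ?thesis using le[OF \<open>a \<in> K\<close>] dec[OF \<open>a \<in> K\<close> \<open>i \<in> K\<close>] \<open>rs ! j < rs ! i\<close>
          by (cases "a = i") auto
      next
        case False
        then show ?thesis using ab \<open>a \<in> K\<close> dec by simp
      qed
    qed
    moreover have "insert j K \<subseteq> {..j}"
      using K that by (auto simp: Ks_def)
    ultimately have "insert j K \<in> Ks j" "finite K" "j \<notin> K"
      by (auto simp: Ks_def)
    then show ?thesis using g_ge[of "insert j K" j] K by simp
  qed
  \<comment> \<open>The lengths run from 1 to \<open>n\<close>, hence the shift by 1.\<close>
  define h where "h = (\<lambda>q\<in>set rs. g (THE i. i < length rs \<and> rs ! i = q) - 1)"
  have the: "(THE k. k < length rs \<and> rs ! k = rs ! i) = i" if "i < length rs" for i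
    using that assms(2) by (intro the_equality) (auto simp: nth_eq_iff_index_eq)
  have h: "h (rs ! i) = g i - 1" if "i < length rs" for i
    using that the by (simp add: h_def)
  have "h \<in> set rs \<rightarrow>\<^sub>E {..<n}"
  proof
    fix q assume "q \<in> set rs"
    then obtain i where "i < length rs" "q = rs ! i" by (metis in_set_conv_nth)
    then show "h q \<in> {..<n}" using h g_pos[of i] g_le[of i] by simp
  qed (simp add: h_def)
  moreover have "rs ! i < rs ! j" if "j < length rs" "i < j" "h (rs ! i) = h (rs ! j)" for i j
  proof (rule ccontr)
    assume "\<not> rs ! i < rs ! j"
    moreover have "rs ! i \<noteq> rs ! j" using that assms(2) by (simp add: nth_eq_iff_index_eq)
    ultimately have "g i < g j" using g_less that by simp
    then show False using that h[of i] h[of j] g_pos[of i] g_pos[of j] by simp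
  qed
  ultimately show ?thesis using that by blast
qed

text \<open>Pairing the vanishing Gram sums with the conjugate of \<open>b\<close> gives a sum of
  squares over all colourings, so for each colouring the sum of \<open>b\<close> over every fibre is
  zero. It remains to find a fibre in which just one coefficient can be nonzero.\<close>

lemma good_independent:
  fixes b :: "int list \<Rightarrow> complex"
  assumes G: "G \<subseteq> permutations_of_set Q" "\<And>rs. rs \<in> G \<Longrightarrow> good n rs" and Q: "finite Q"
    and gram: "\<And>ss. ss \<in> G \<Longrightarrow> (\<Sum>rs\<in>G. b rs * invcol n ss rs Q) = 0"
    and "rs \<in> G"
  shows "b rs = 0"
proof (rule ccontr)
  assume "b rs \<noteq> 0"
  have finG: "finite G" using G Q by (meson finite_permutations_of_set finite_subset)
  have fin: "finite (Q \<rightarrow>\<^sub>E {..<n})" using Q by (simp add: finite_PiE)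
  define N where "N = (\<lambda>h::int \<Rightarrow> nat. \<Sum>w\<in>map h ` G. (cmod (\<Sum>x\<in>{x \<in> G. map h x = w}. b x))\<^sup>2)"
  have "of_real (\<Sum>h\<in>Q \<rightarrow>\<^sub>E {..<n}. N h) = (\<Sum>ss\<in>G. cnj (b ss) * (\<Sum>rs\<in>G. b rs * invcol n ss rs Q))"
  proof -
    have "of_real (\<Sum>h\<in>Q \<rightarrow>\<^sub>E {..<n}. N h)
      = (\<Sum>h\<in>Q \<rightarrow>\<^sub>E {..<n}. \<Sum>x\<in>G. \<Sum>y\<in>G. if map h x = map h y then cnj (b x) * b y else 0)"
      unfolding N_def of_real_sum[of _ "Q \<rightarrow>\<^sub>E {..<n}"] gram_sum[OF finG] ..
    also have "\<dots> = (\<Sum>x\<in>G. \<Sum>y\<in>G. \<Sum>h\<in>Q \<rightarrow>\<^sub>E {..<n}. if map h x = map h y then cnj (b x) * b y else 0)"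
      by (subst sum.swap, rule sum.cong[OF refl], rule sum.swap)
    also have "\<dots> = (\<Sum>x\<in>G. cnj (b x) * (\<Sum>y\<in>G. b y * invcol n x y Q))"
      unfolding invcol_def sum_distrib_left
      by (intro sum.cong refl) auto
    finally show ?thesis .
  qed
  also have "\<dots> = 0" using gram by simp
  finally have "(\<Sum>h\<in>Q \<rightarrow>\<^sub>E {..<n}. N h) = 0" using of_real_eq_0_iff by blast
  then have N0: "N h = 0" if "h \<in> Q \<rightarrow>\<^sub>E {..<n}" for h
    using sum_nonneg_eq_0_iff[of "Q \<rightarrow>\<^sub>E {..<n}" N] fin that by (auto simp: N_def sum_nonneg)
  have B0: "(\<Sum>x\<in>{x \<in> G. map h x = map h y}. b x) = 0" if "h \<in> Q \<rightarrow>\<^sub>E {..<n}" "y \<in> G" for h y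
  proof -
    have "\<forall>w\<in>map h ` G. (cmod (\<Sum>x\<in>{x \<in> G. map h x = w}. b x))\<^sup>2 = 0"
      using N0[OF that(1)] finG unfolding N_def by (subst (asm) sum_nonneg_eq_0_iff) auto
    then show ?thesis using that(2) by auto
  qed
  \<comment> \<open>The lexicographic maximum is the right choice: in the fibre of its own
    colouring, constructed below, every other list is larger and hence has coefficient 0.\<close>
  define t where "t = Max {x \<in> G. b x \<noteq> 0}"
  have t: "t \<in> {x \<in> G. b x \<noteq> 0}"
    unfolding t_def using finG \<open>b rs \<noteq> 0\<close> \<open>rs \<in> G\<close> by (intro Max_in) auto
  have t_max: "\<And>x. x \<in> G \<Longrightarrow> b x \<noteq> 0 \<Longrightarrow> x \<le> t"
    unfolding t_def using finG by simp
  have dt: "distinct t" "set t = Q" using t G by (auto simp: permutations_of_set_def)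
  obtain h where h: "h \<in> Q \<rightarrow>\<^sub>E {..<n}"
    and inc: "\<And>i j. j < length t \<Longrightarrow> i < j \<Longrightarrow> h (t ! i) = h (t ! j) \<Longrightarrow> t ! i < t ! j"
    using good_colouring[of n t] t G dt by auto
  have "b x = 0" if "x \<in> G" "map h x = map h t" "x \<noteq> t" for x
  proof -
    have dx: "distinct x" "set x = Q" using that G by (auto simp: permutations_of_set_def)
    have len: "length x = length t" using that(2) map_eq_imp_length_eq by blast
    obtain k where k: "k < length x" "\<And>i. i < k \<Longrightarrow> x ! i = t ! i" "x ! k \<noteq> t ! k"
      using first_difference[OF len \<open>x \<noteq> t\<close>] by blast
    have "x ! k \<in> set x" using k by simp
    then have "x ! k \<in> set t" using dx dt by simp
    then obtain l where l: "l < length t" "t ! l = x ! k" by (metis in_set_conv_nth)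
    \<comment> \<open>At the first difference \<open>x\<close> carries an entry that
      \<open>t\<close> has later and in the same colour, and \<open>t\<close> increases along each
      colour.\<close>
    have "\<not> l < k" using k l dx len by (metis nth_eq_iff_index_eq)
    then have "k < l" using k l by (metis linorder_neqE_nat)
    moreover have "h (t ! k) = h (x ! k)" using that(2) k len by (metis nth_map)
    ultimately have "t ! k < x ! k" using inc[of l k] l by simp
    then have "t < x" using list_less_at[of t x k] k len by simp
    then show ?thesis using t_max[of x] that leD by blast
  qed
  then have "(\<Sum>x\<in>{x \<in> G. map h x = map h t}. b x) = b t"
    using finG t by (subst sum.mono_neutral_right[of _ "{t}"]) auto
  then show False using B0[OF h] t by simp
qed

section \<open>Multilinear words and their contractions\<close>

context glmod
begin

text \<open>\<open>E s r\<close> acts as a derivation on columns and \<open>s\<close> occurs once,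
  so one substitution remains. The minus sign is that of the second term of the commutator; for odd
  \<open>s\<close> and \<open>r\<close> no parity sign joins it.\<close>

lemma E_replace_col:
  assumes "s \<le> 1" "r \<le> 1" "odd s" "odd r" "list_all create ws" "distinct (map snd ws)" "s \<in> snd ` set ws"
  shows "E s r (ew ws vac) = - ew (map (\<lambda>(a, b). (a, if b = s then r else b)) ws) vac"
  using assms(5-)
proof (induction ws)
  case Nil
  then show ?case by simp
next
  case (Cons x ws)
  obtain a b where x: "x = (a, b)" by force
  have ab: "create (a, b)" "list_all create ws" using Cons.prems by (auto simp: x)
  have "r \<noteq> a" "a \<noteq> s" using ab assms by (auto simp: create_def)
  moreover have "sg s r a b = 1" using assms by (simp add: sg_def)
  ultimately have E: "E s r (ew (x # ws) vac)
      = E a b (E s r (ew ws vac)) - (if s = b then E a r (ew ws vac) else 0)"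
    using assms by (auto simp: x E_comm[of s r] coc_def)
  show ?case
  proof (cases "b = s")
    case True
    then have s: "s \<notin> snd ` set ws" using Cons.prems by (auto simp: x)
    then have "map (\<lambda>(a, b). (a, if b = s then r else b)) ws = ws"
      by (intro map_idI) force
    then show ?thesis using E E_col_absent[OF assms(1,2) ab(2) s] True by (simp add: x)
  next
    case False
    then have "s \<in> snd ` set ws" "distinct (map snd ws)" using Cons.prems by (auto simp: x)
    then show ?thesis using E Cons.IH ab False by (simp add: x E_minus)
  qed
qed

text \<open>The bound 4 keeps the even row 2 free: it is the row of the power vector and the
  placeholder in \<open>placements\<close>.\<close>

definition rows :: "int list \<Rightarrow> bool" where
  "rows ps \<longleftrightarrow> distinct ps \<and> (\<forall>p\<in>set ps. even p \<and> 4 \<le> p)"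

definition cols :: "int list \<Rightarrow> bool" where
  "cols qs \<longleftrightarrow> distinct qs \<and> (\<forall>q\<in>set qs. odd q \<and> q \<le> 1)"

lemma set_zip_bothD: "(a, b) \<in> set (zip xs ys) \<Longrightarrow> a \<in> set xs \<and> b \<in> set ys"
  by (auto dest: set_zip_leftD set_zip_rightD)

lemma create_zip: "rows ps \<Longrightarrow> cols qs \<Longrightarrow> list_all create (zip ps qs)"
  by (fastforce simp: rows_def cols_def list_all_iff create_def dest: set_zip_bothD)

text \<open>Reversed so that the head of the list acts first, in step with the induction along a
  word.\<close>

definition ann :: "(int \<times> int) list \<Rightarrow> 'v \<Rightarrow> 'v" where
  "ann zs = ew (rev (map prod.swap zs))"

lemma ann_Nil [simp]: "ann [] v = v"
  and ann_Cons [simp]: "ann ((p, s) # zs) v = ann zs (E s p v)"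
  by (simp_all add: ann_def)

lemma ann_scale: "ann zs (a *s v) = a *s ann zs v"
  by (simp add: ann_def ew_scale)

text \<open>Each annihilator meets the unique creator with its row. Equal columns give
  \<open>-c\<close>, the free colours of a fixed point; different columns give minus the word with
  \<open>s\<close> replaced by \<open>r\<close>, as in \<open>invcol_moved\<close>. Since rows are
  even and columns odd, both cases contribute exactly one factor -1.\<close>

lemma annihilate_word:
  assumes "c = of_nat n" "length ss = length ps" "length rs = length ps"
    "rows ps" "cols ss" "cols rs" "set ss = set rs"
  shows "ann (zip ps ss) (ew (zip ps rs) vac) = ((-1) ^ length ps * invcol n ss rs (set rs)) *s vac"
  using assms(2-)
proof (induction ps arbitrary: ss rs)
  case Nil
  then show ?case by (simp add: invcol_def)
next
  case (Cons p ps)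
  obtain s ss' where ss: "ss = s # ss'" using Cons.prems by (cases ss) auto
  obtain r rs' where rs: "rs = r # rs'" using Cons.prems by (cases rs) auto
  have ps: "rows ps" "p \<notin> set ps" "even p" "4 \<le> p" using Cons.prems by (auto simp: rows_def)
  have ss': "cols ss'" "s \<notin> set ss'" "odd s" "s \<le> 1" using Cons.prems by (auto simp: cols_def ss)
  have rs': "cols rs'" "r \<notin> set rs'" "odd r" "r \<le> 1" using Cons.prems by (auto simp: cols_def rs)
  have len: "length ss' = length ps" "length rs' = length ps" using Cons.prems by (auto simp: ss rs)
  have set_eq: "insert s (set ss') = insert r (set rs')" using Cons.prems by (simp add: ss rs)
  define w where "w = ew (zip ps rs') vac"
  have cr: "list_all create (zip ps rs')" using create_zip ps rs' by blast
  have fst_zip: "fst ` set (zip ps rs') = set ps" "snd ` set (zip ps rs') = set rs'"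
    using len by (simp_all flip: set_map)
  have Epp: "E p p w = 0" "E r p w = 0" "E s p w = 0"
    unfolding w_def using E_row_absent[of p p "zip ps rs'"] E_annih_absent[of _ p "zip ps rs'"]
      ps ss' rs' cr fst_zip by auto
  have coc: "coc s p p r = (if s = r then -1 else 0)"
    using ss' ps by (auto simp: coc_def)
  have "pr w = w" unfolding w_def by (rule pr_ew) (rule pr_vac)
  \<comment> \<open>Row \<open>p\<close> occurs in no other letter, so the term with the two
    operators exchanged and the term \<open>E p p w\<close> vanish.\<close>
  then have E: "E s p (E p r w) = E s r w + (if s = r then - c *s w else 0)"
    using ss' rs' ps Epp by (auto simp: E_comm[of s p p r] sg_def coc)
  show ?case
  proof (cases "s = r")
    case True
    have "s \<notin> set rs'" using rs' True by simp
    then have "E s r w = 0"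
      unfolding w_def using E_col_absent[of s r "zip ps rs'"] ss' rs' cr fst_zip by auto
    moreover have "set ss' = set rs'" using set_eq ss' rs' True by auto
    moreover have "ann (zip ps ss') w = ((-1) ^ length ps * invcol n ss' rs' (set rs')) *s vac"
      unfolding w_def using Cons.IH[of ss' rs'] len ps ss' rs' \<open>set ss' = set rs'\<close> by blast
    moreover have "ann (zip ps ss') (- c *s w) = - c *s ann (zip ps ss') w"
      by (rule ann_scale)
    moreover have "E s p (E p r w) = - c *s w" using E \<open>E s r w = 0\<close> True by simp
    ultimately have "ann (zip (p # ps) ss) (ew (zip (p # ps) rs) vac)
        = - c *s ((-1) ^ length ps * invcol n ss' rs' (set rs')) *s vac"
      unfolding ss rs zip_Cons_Cons ann_Cons ew_Cons w_def[symmetric] by simp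
    moreover have "invcol n ss rs (set rs) = of_nat n * invcol n ss' rs' (set rs')"
      using True invcol_fixed[of s "set rs'" ss' rs' n] ss' \<open>set ss' = set rs'\<close> by (simp add: ss rs)
    ultimately show ?thesis using assms(1) by (simp add: algebra_simps)
  next
    case False
    define t where "t = map (\<lambda>x. if x = s then r else x) rs'"
    have s: "s \<in> set rs'" and r: "r \<in> set ss'" using set_eq False by auto
    have "set t = set ss'"
      unfolding t_def using s r rs' ss' set_eq False by (auto simp: image_iff)
    have "distinct t"
      unfolding t_def distinct_map using rs' by (auto simp: cols_def inj_on_def)
    then have "cols t" using \<open>set t = set ss'\<close> ss' by (auto simp: cols_def)
    have z: "map (\<lambda>(a, b). (a, if b = s then r else b)) (zip ps rs') = zip ps t"
      unfolding t_def by (simp add: zip_map2)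
    have "distinct (map snd (zip ps rs'))" using len rs' by (simp add: cols_def)
    then have "E s r w = - ew (zip ps t) vac"
      unfolding w_def z[symmetric]
      by (intro E_replace_col) (use ss' rs' cr s fst_zip in auto)
    then have "E s p (E p r w) = (-1) *s ew (zip ps t) vac" using E False by simp
    then have "ann (zip (p # ps) ss) (ew (zip (p # ps) rs) vac) = (-1) *s ann (zip ps ss') (ew (zip ps t) vac)"
      by (simp add: ss rs ann_scale del: scale_minus_left flip: w_def)
    also have "ann (zip ps ss') (ew (zip ps t) vac) = ((-1) ^ length ps * invcol n ss' t (set t)) *s vac"
      using Cons.IH[of ss' t] len ps ss' \<open>cols t\<close> \<open>set t = set ss'\<close> by (simp add: t_def)
    also have "invcol n ss' t (set t) = invcol n ss rs (set rs)"
    proof -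
      have "set rs = insert s (set ss')" "set rs' \<subseteq> insert s (set ss')" using set_eq by (auto simp: rs)
      then show ?thesis
        using invcol_moved[of s "set ss'" r ss' rs' n, folded t_def] \<open>set t = set ss'\<close> ss' r
        by (simp add: ss rs)
    qed
    finally show ?thesis by (simp add: rs)
  qed
qed

section \<open>Polarising the power vector\<close>

lemma E_replace_row:
  assumes "even p" "4 \<le> p" "list_all create ws"
  shows "E p 2 (ew ws vac)
    = (\<Sum>i<length ws. if fst (ws ! i) = 2 then ew (ws[i := (p, snd (ws ! i))]) vac else 0)"
  using assms(3)
proof (induction ws)
  case Nil
  show ?case using assms by (simp add: E_vac create_def)
next
  case (Cons x ws)
  obtain a b where x: "x = (a, b)" by force
  have ab: "create (a, b)" "list_all create ws" using Cons.prems by (auto simp: x)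
  have "p \<noteq> b" using ab assms by (auto simp: create_def)
  moreover have "sg p 2 a b = 1" using assms by (simp add: sg_def)
  ultimately have "E p 2 (ew (x # ws) vac)
      = E a b (E p 2 (ew ws vac)) + (if a = 2 then E p b (ew ws vac) else 0)"
    using assms by (auto simp: x E_comm[of p 2] coc_def)
  also have "E p 2 (ew ws vac)
      = (\<Sum>i<length ws. if fst (ws ! i) = 2 then ew (ws[i := (p, snd (ws ! i))]) vac else 0)"
    using Cons.IH ab by blast
  finally show ?case
    unfolding length_Cons sum.lessThan_Suc_shift
    by (auto simp: x E_sum if_distrib[of "E a b"] cong: if_cong)
qed

text \<open>Row lists of partially polarised words: the rows in \<open>L\<close> have been placed,
  the remaining positions still carry the original row 2.\<close>

definition placements :: "int set \<Rightarrow> nat \<Rightarrow> int list set" where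
  "placements L m = {fs. length fs = m \<and> set fs \<subseteq> insert 2 L \<and> (\<forall>p\<in>L. \<exists>!i. i < m \<and> fs ! i = p)}"

lemma finite_placements: "finite L \<Longrightarrow> finite (placements L m)"
  unfolding placements_def
  by (rule finite_subset[of _ "{fs. set fs \<subseteq> insert 2 L \<and> length fs = m}"])
    (auto simp: finite_lists_length_eq)

text \<open>Overwriting a 2 by \<open>p\<close> is inverse to resetting the unique \<open>p\<close>,
  treated in \<open>placements_reset\<close>; together they reindex the double sum in
  \<open>E_placements\<close>.\<close>

lemma placements_update:
  assumes "fs \<in> placements L m" "i < m" "fs ! i = 2" "p \<notin> L" "p \<noteq> 2" "2 \<notin> L"
  shows "fs[i := p] \<in> placements (insert p L) m" "(THE j. j < m \<and> fs[i := p] ! j = p) = i"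
    "fs[i := p, i := 2] = fs"
proof -
  have len: "length fs = m" and sub: "set fs \<subseteq> insert 2 L"
    and ex1: "\<And>q. q \<in> L \<Longrightarrow> \<exists>!j. j < m \<and> fs ! j = q" using assms by (auto simp: placements_def)
  have p: "j < m \<Longrightarrow> fs ! j \<noteq> p" for j using sub assms len by (metis insert_iff nth_mem subsetD)
  have "\<exists>!j. j < m \<and> fs[i := p] ! j = q" if "q \<in> insert p L" for q
  proof (cases "q = p")
    case True
    then show ?thesis using p assms(2) len by (intro ex1I[of _ i]) (auto simp: nth_list_update split: if_splits)
  next
    case False
    then have "j < m \<and> fs[i := p] ! j = q \<longleftrightarrow> j < m \<and> fs ! j = q" for j
      using that assms len by (auto simp: nth_list_update)
    then show ?thesis using ex1[of q] that False by simp
  qed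
  moreover have "set (fs[i := p]) \<subseteq> insert 2 (insert p L)"
    using sub set_update_subset_insert[of fs i p] by auto
  ultimately show "fs[i := p] \<in> placements (insert p L) m" using len by (simp add: placements_def)
  show "(THE j. j < m \<and> fs[i := p] ! j = p) = i"
    using p assms(2) len by (intro the_equality) (auto simp: nth_list_update split: if_splits)
  show "fs[i := p, i := 2] = fs" using assms(3) by (metis list_update_id list_update_overwrite)
qed

lemma placements_reset:
  assumes "gs \<in> placements (insert p L) m" "p \<notin> L" "p \<noteq> 2" "2 \<notin> L"
  defines "j \<equiv> THE j. j < m \<and> gs ! j = p"
  shows "gs[j := 2] \<in> placements L m" "j < m" "gs[j := 2] ! j = 2" "gs[j := 2, j := p] = gs"
proof -
  have len: "length gs = m" and sub: "set gs \<subseteq> insert 2 (insert p L)"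
    and ex1: "\<And>q. q \<in> insert p L \<Longrightarrow> \<exists>!j. j < m \<and> gs ! j = q" using assms by (auto simp: placements_def)
  have j: "j < m" "gs ! j = p"
    using theI'[OF ex1[of p]] unfolding j_def by auto
  have uniq: "i = j" if "i < m" "gs ! i = p" for i using ex1[of p] j that by auto
  show "j < m" "gs[j := 2] ! j = 2" "gs[j := 2, j := p] = gs"
    using j len by (auto simp: list_update_same_conv)
  have "\<exists>!i. i < m \<and> gs[j := 2] ! i = q" if "q \<in> L" for q
  proof -
    have "i < m \<and> gs[j := 2] ! i = q \<longleftrightarrow> i < m \<and> gs ! i = q" for i
      using that assms len j by (auto simp: nth_list_update)
    then show ?thesis using ex1[of q] that by simp
  qed
  moreover have "set (gs[j := 2]) \<subseteq> insert 2 L"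
  proof
    fix x assume "x \<in> set (gs[j := 2])"
    then obtain i where i: "i < m" "x = gs[j := 2] ! i" using len by (metis in_set_conv_nth length_list_update)
    show "x \<in> insert 2 L"
    proof (cases "i = j")
      case False
      then have x: "x = gs ! i" using i by simp
      then have "x \<in> insert 2 (insert p L)" using sub len i(1) nth_mem[of i gs] by blast
      moreover have "x \<noteq> p" using uniq[of i] False i(1) x by blast
      ultimately show ?thesis by blast
    qed (use i len in simp)
  qed
  moreover have "length (gs[j := 2]) = m" using len by simp
  ultimately show "gs[j := 2] \<in> placements L m" unfolding placements_def by blast
qed

lemma placements_perm:
  assumes "finite L" "2 \<notin> L"
  shows "placements L (card L) = permutations_of_set L"
proof (intro equalityI subsetI)
  fix fs assume "fs \<in> placements L (card L)"
  then have len: "length fs = card L" and ex1: "\<And>q. q \<in> L \<Longrightarrow> \<exists>i. i < length fs \<and> fs ! i = q"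
    by (auto simp: placements_def)
  then have "L \<subseteq> set fs" by (metis nth_mem subsetI)
  then have "L = set fs" using len card_length[of fs] by (intro card_seteq) auto
  then show "fs \<in> permutations_of_set L"
    using len by (simp add: permutations_of_set_def card_distinct)
next
  fix fs assume "fs \<in> permutations_of_set L"
  then have fs: "distinct fs" "set fs = L" by (auto simp: permutations_of_set_def)
  moreover have "\<exists>!i. i < length fs \<and> fs ! i = p" if "p \<in> L" for p
  proof -
    have "p \<in> set fs" using fs that by simp
    then obtain i where i: "i < length fs" "fs ! i = p" unfolding in_set_conv_nth by blast
    show ?thesis
    proof (rule ex1I[of _ i])
      fix j assume "j < length fs \<and> fs ! j = p"
      then show "j = i" using nth_eq_iff_index_eq[OF fs(1), of j i] i by simp
    qed (use i in simp)
  qed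
  ultimately show "fs \<in> placements L (card L)"
    using distinct_card[of fs] unfolding placements_def by auto
qed

lemma E_placements:
  assumes "even p" "4 \<le> p" "p \<notin> L" "2 \<notin> L" "finite L" "\<forall>x\<in>L. 2 \<le> x" "length qs = m" "cols qs"
  shows "E p 2 (\<Sum>fs\<in>placements L m. ew (zip fs qs) vac) = (\<Sum>fs\<in>placements (insert p L) m. ew (zip fs qs) vac)"
proof -
  have "E p 2 (ew (zip fs qs) vac) = (\<Sum>i\<in>{i \<in> {..<m}. fs ! i = 2}. ew (zip (fs[i := p]) qs) vac)"
    if "fs \<in> placements L m" for fs
  proof -
    have len: "length fs = m" and "set fs \<subseteq> insert 2 L" using that by (auto simp: placements_def)
    then have "list_all create (zip fs qs)" using assms
      by (fastforce simp: list_all_iff create_def cols_def dest: set_zip_bothD)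
    then have "E p 2 (ew (zip fs qs) vac) = (\<Sum>i<m. if fs ! i = 2 then ew (zip (fs[i := p]) qs) vac else 0)"
      using assms len by (simp add: E_replace_row update_zip cong: if_cong)
    then show ?thesis by (simp only: sum.inter_filter[OF finite_lessThan])
  qed
  then have "E p 2 (\<Sum>fs\<in>placements L m. ew (zip fs qs) vac)
    = (\<Sum>fs\<in>placements L m. \<Sum>i\<in>{i \<in> {..<m}. fs ! i = 2}. ew (zip (fs[i := p]) qs) vac)"
    by (simp add: E_sum)
  also have "\<dots> = (\<Sum>(fs, i)\<in>(SIGMA fs:placements L m. {i \<in> {..<m}. fs ! i = 2}). ew (zip (fs[i := p]) qs) vac)"
    using finite_placements[OF assms(5)] by (intro sum.Sigma) auto
  also have "\<dots> = (\<Sum>fs\<in>placements (insert p L) m. ew (zip fs qs) vac)"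
  proof (rule sum.reindex_bij_witness[where
      j = "\<lambda>(fs, i). fs[i := p]" and i = "\<lambda>gs. let j = THE j. j < m \<and> gs ! j = p in (gs[j := 2], j)"])
    fix a assume a: "a \<in> (SIGMA fs:placements L m. {i \<in> {..<m}. fs ! i = 2})"
    obtain fs i where fs: "a = (fs, i)" by force
    have u: "fs[i := p] \<in> placements (insert p L) m" "(THE j. j < m \<and> fs[i := p] ! j = p) = i"
      "fs[i := p, i := 2] = fs"
      using placements_update[of fs L m i p] a assms by (simp_all add: fs)
    show "(let j = THE j. j < m \<and> (case a of (fs, i) \<Rightarrow> fs[i := p]) ! j = p
        in ((case a of (fs, i) \<Rightarrow> fs[i := p])[j := 2], j)) = a"
      by (simp only: fs prod.case Let_def u)
    show "(case a of (fs, i) \<Rightarrow> fs[i := p]) \<in> placements (insert p L) m"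
      by (simp only: fs prod.case u)
    show "ew (zip (case a of (fs, i) \<Rightarrow> fs[i := p]) qs) vac = (case a of (fs, i) \<Rightarrow> ew (zip (fs[i := p]) qs) vac)"
      by (simp only: fs prod.case)
  next
    fix gs assume gs: "gs \<in> placements (insert p L) m"
    have p: "p \<notin> L" "p \<noteq> 2" "2 \<notin> L" using assms by auto
    note r = placements_reset[OF gs p]
    show "(case let j = THE j. j < m \<and> gs ! j = p in (gs[j := 2], j) of (fs, i) \<Rightarrow> fs[i := p]) = gs"
      by (simp only: Let_def prod.case r)
    show "(let j = THE j. j < m \<and> gs ! j = p in (gs[j := 2], j))
        \<in> (SIGMA fs:placements L m. {i \<in> {..<m}. fs ! i = 2})"
      unfolding Let_def using r by (intro SigmaI CollectI conjI) auto
  qed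
  finally show ?thesis .
qed

text \<open>\<open>E 0 q\<close> replaces one column 0 by \<open>q\<close>, with equal contributions
  from all remaining factors \<open>E 2 0\<close>, and their number can be divided out. With all
  columns distinct, the operators \<open>E p 2\<close> distribute the new rows over the positions in
  every possible way.\<close>

lemma polarized_in_ideal:
  assumes "stable I" "Zv (Suc n) \<in> I" "cols qs" "length qs = Suc n"
    and "finite L" "card L = Suc n" "\<forall>p\<in>L. even p \<and> 4 \<le> p"
  shows "(\<Sum>fs\<in>permutations_of_set L. ew (zip fs qs) vac) \<in> I"
proof -
  note sub = stable_subspace[OF assms(1)]
  have col0: "E 0 q (ew (map (Pair 2) us) vac) = 0" if "odd q" "q \<le> 1" "\<forall>u\<in>set us. odd u \<and> u \<le> 1" for q us
  proof (rule E_col_absent)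
    show "list_all create (map (Pair 2) us)" using that(3) by (simp add: list_all_iff create_def)
    have "snd ` set (map (Pair 2) us) = set us" by (simp add: image_image)
    then show "0 \<notin> snd ` set (map (Pair 2) us)" using that(3) by fastforce
  qed (use that in simp_all)
  \<comment> \<open>\<open>us\<close> holds the columns already made distinct and \<open>r\<close>
    counts the untouched factors, so each step trades one for the other.\<close>
  have *: "(E 2 0 ^^ r) (ew (map (Pair 2) us) vac) \<in> I"
    if "r + length us = Suc n" "\<forall>u\<in>set us. odd u \<and> u \<le> 1" for r us
    using that
  proof (induction us arbitrary: r)
    case Nil
    then show ?case using assms(2) by (simp add: Zv_def)
  next
    case (Cons q us)
    have q: "odd q" "q \<le> 1" using Cons.prems by auto
    have 1: "E 0 q (E 2 0 v) = E 2 0 (E 0 q v) + - E 2 q v" and 2: "- E 2 q (E 2 0 v) = E 2 0 (- E 2 q v)" for v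
      using q by (auto simp: E_comm[of 0 q 2 0] E_comm[of 2 q 2 0] sg_def coc_def E_minus)
    have "E 0 q ((E 2 0 ^^ Suc r) (ew (map (Pair 2) us) vac)) \<in> I"
      using Cons.IH[of "Suc r"] Cons.prems by (intro stableD[OF assms(1)]) auto
    then have "of_nat (Suc r) *s (E 2 0 ^^ r) (- E 2 q (ew (map (Pair 2) us) vac)) \<in> I"
      unfolding E_through[where F = "\<lambda>v. - E 2 q v", OF 1 2]
      using col0[OF q] Cons.prems by (simp add: funpow_ew)
    then have "(- inverse (of_nat (Suc r))) *s of_nat (Suc r) *s (E 2 0 ^^ r) (- E 2 q (ew (map (Pair 2) us) vac)) \<in> I"
      by (rule subspace_scale[OF sub])
    moreover have "(E 2 0 ^^ r) (- v) = - (E 2 0 ^^ r) v" for v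
      by (induction r) (auto simp: E_minus)
    ultimately show ?case by (simp del: of_nat_Suc)
  qed
  have base: "ew (map (Pair 2) qs) vac \<in> I"
    using *[of 0 qs] assms by (auto simp: cols_def)
  have "(\<Sum>fs\<in>placements L' (Suc n). ew (zip fs qs) vac) \<in> I" if "finite L'" "\<forall>p\<in>L'. even p \<and> 4 \<le> p" for L'
    using that
  proof (induction L' rule: finite_induct)
    case empty
    have "fs \<in> placements {} (Suc n) \<longleftrightarrow> fs = replicate (Suc n) 2" for fs
      unfolding placements_def by (auto simp del: replicate_Suc intro!: replicate_eqI)
    then have "placements {} (Suc n) = {replicate (Suc n) 2}" by blast
    moreover have "zip (replicate (Suc n) (2::int)) qs = map (Pair 2) qs"
      using assms(4) by (simp add: zip_replicate1 del: replicate_Suc)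
    ultimately show ?case using base by simp
  next
    case (insert p L')
    have "2 \<notin> L'" "\<forall>x\<in>L'. 2 \<le> x" using insert by auto
    then have "E p 2 (\<Sum>fs\<in>placements L' (Suc n). ew (zip fs qs) vac)
        = (\<Sum>fs\<in>placements (insert p L') (Suc n). ew (zip fs qs) vac)"
      using insert assms by (intro E_placements) auto
    moreover have "E p 2 (\<Sum>fs\<in>placements L' (Suc n). ew (zip fs qs) vac) \<in> I"
      using insert by (intro stableD[OF assms(1)]) auto
    ultimately show ?case by simp
  qed
  then have "(\<Sum>fs\<in>placements L (card L). ew (zip fs qs) vac) \<in> I" using assms by simp
  moreover have "2 \<notin> L" using assms by auto
  ultimately show ?thesis using placements_perm[OF assms(5)] by simp
qed

end

section \<open>Straightening multilinear words\<close>

context glmod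
begin

text \<open>Normal form: with the letters sorted by row, a multilinear word is recorded by its list
  of columns.\<close>

lemma word_eq_sorted:
  assumes "rows ps" "cols qs" "length ps = length qs"
    and "distinct (map fst ws)" "fst ` set ws = set ps" "distinct (map snd ws)" "snd ` set ws = set qs"
    and "list_all create ws"
  obtains e rs where "e \<noteq> 0" "ew ws vac = e *s ew (zip ps rs) vac" "rs \<in> permutations_of_set (set qs)"
    "set (zip ps rs) = set ws"
proof -
  define f where "f = (\<lambda>p. THE q. (p, q) \<in> set ws)"
  have f: "f p = q" if "(p, q) \<in> set ws" for p q
    unfolding f_def using that assms(4) by (intro the_equality) (auto dest: eq_key_imp_eq_value)
  have f_in: "(p, f p) \<in> set ws" if "p \<in> set ps" for p
    using that assms(5) f by (metis (no_types, lifting) imageE prod.collapse)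
  define rs where "rs = map f ps"
  have zip: "zip ps rs = map (\<lambda>p. (p, f p)) ps"
    unfolding rs_def by (simp add: zip_map2 zip_same_conv_map)
  have set_zip: "set (zip ps rs) = set ws"
  proof
    show "set (zip ps rs) \<subseteq> set ws" using f_in by (auto simp: zip)
    show "set ws \<subseteq> set (zip ps rs)"
    proof
      fix x assume "x \<in> set ws"
      show "x \<in> set (zip ps rs)"
      proof (cases x)
        case (Pair p q)
        then have "f p = q" "p \<in> fst ` set ws" using \<open>x \<in> set ws\<close> f by force+
        then show ?thesis using assms(5) Pair unfolding zip by (auto simp: image_iff)
      qed
    qed
  qed
  have len: "length ps = length rs" by (simp add: rs_def)
  have "set rs = set qs"
  proof -
    have "snd ` set (zip ps rs) = set rs" using len by (simp flip: set_map)
    then show ?thesis using set_zip assms(7) by simp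
  qed
  then have "card (set rs) = length rs" using assms(2,3) len by (simp add: cols_def distinct_card)
  then have "rs \<in> permutations_of_set (set qs)"
    using \<open>set rs = set qs\<close> by (simp add: permutations_of_set_def card_distinct)
  moreover have "mset ws = mset (zip ps rs)"
  proof (subst set_eq_iff_mset_eq_distinct[symmetric])
    show "distinct (zip ps rs)" using assms(1) by (simp add: rows_def distinct_zipI1)
    show "distinct ws" using assms(4) by (simp add: distinct_map)
  qed (simp add: set_zip)
  then obtain e where "e \<noteq> 0" "ew ws vac = e *s ew (zip ps rs) vac"
    using ew_mset assms(8) by blast
  ultimately show ?thesis using that set_zip by blast
qed

text \<open>Straightening: a decreasing subsequence of length \<open>n + 1\<close> is lexicographically maximal among its
  rearrangements, and the sum of all rearrangements lies in the ideal.\<close>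
lemma straighten:
  assumes I: "stable I" "Zv (Suc n) \<in> I" and pq: "rows ps" "cols qs" "length ps = length qs"
    and "rs \<in> permutations_of_set (set qs)"
  shows "ew (zip ps rs) vac \<in> span (I \<union> (\<lambda>rs. ew (zip ps rs) vac) ` {rs \<in> permutations_of_set (set qs). good n rs})"
    (is "_ \<in> ?S")
  using assms(6)
proof (induction "card {rs' \<in> permutations_of_set (set qs). rs' < rs}" arbitrary: rs rule: less_induct)
  case less
  have rs: "distinct rs" "set rs = set qs" "cols rs" using less.prems pq(2) by (auto simp: permutations_of_set_def cols_def)
  have len: "length rs = length ps" using rs pq by (metis cols_def distinct_card)
  have IH: "ew (zip ps rs') vac \<in> ?S" if "rs' \<in> permutations_of_set (set qs)" "rs' < rs" for rs'
  proof (rule less.hyps[OF _ that(1)])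
    have "{x \<in> permutations_of_set (set qs). x < rs'} \<subset> {x \<in> permutations_of_set (set qs). x < rs}"
      using that by auto
    then show "card {x \<in> permutations_of_set (set qs). x < rs'} < card {x \<in> permutations_of_set (set qs). x < rs}"
      by (intro psubset_card_mono) auto
  qed
  show ?case
  proof (cases "good n rs")
    case True
    then show ?thesis using less.prems by (intro span_base) auto
  next
    case False
    then obtain K where K: "K \<subseteq> {..<length rs}" "card K = Suc n"
      and dec: "\<And>i j. i \<in> K \<Longrightarrow> j \<in> K \<Longrightarrow> i < j \<Longrightarrow> rs ! j < rs ! i"
      unfolding good_def by blast
    define ks where "ks = sorted_list_of_set K"
    have ks: "set ks = K" "distinct ks" "length ks = Suc n"
      using K finite_subset[OF K(1)] by (auto simp: ks_def)
    define os where "os = filter (\<lambda>i. i \<notin> K) [0..<length rs]"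
    have os: "set os = {..<length rs} - K" "distinct os" by (auto simp: os_def)
    define P where "P = (!) ps"
    define R where "R = (!) rs"
    have injP: "inj_on P {..<length rs}" and injR: "inj_on R {..<length rs}"
      using pq(1) rs len by (auto simp: P_def R_def rows_def inj_on_def nth_eq_iff_index_eq)
    \<comment> \<open>\<open>W\<close> collects the letters outside the decreasing positions and
      \<open>qK\<close> the columns at these positions; pairing \<open>qK\<close> with all orders of
      the rows there gives the rearrangements.\<close>
    define W where "W = map (\<lambda>i. (P i, R i)) os"
    define qK where "qK = map R ks"
    have inK: "i \<in> K \<Longrightarrow> i < length rs" for i using K by auto
    have P_im: "P ` {..<length rs} = set ps" and R_im: "R ` {..<length rs} = set qs"
      using len rs by (auto simp: P_def R_def set_conv_nth)
    have P_disj: "P ` set os \<inter> P ` K = {}" "P ` set os \<union> P ` K = set ps"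
      and R_disj: "R ` set os \<inter> R ` K = {}" "R ` set os \<union> R ` K = set qs"
    proof -
      have 1: "f ` ({..<length rs} - K) \<inter> f ` K = {}" if "inj_on f {..<length rs}" for f :: "nat \<Rightarrow> int"
        using that K(1) by (blast dest: inj_onD)
      have 2: "f ` ({..<length rs} - K) \<union> f ` K = f ` {..<length rs}" for f :: "nat \<Rightarrow> int"
        using K(1) by blast
      show "P ` set os \<inter> P ` K = {}" "P ` set os \<union> P ` K = set ps"
        "R ` set os \<inter> R ` K = {}" "R ` set os \<union> R ` K = set qs"
        unfolding os 2 by (simp_all only: 1 injP injR P_im R_im)
    qed
    have cPK: "card (P ` K) = Suc n" using K injP by (metis card_image inj_on_subset)
    have qK: "distinct qK" "set qK = R ` K" "length qK = Suc n"
      using ks K injR by (auto simp: qK_def distinct_map intro: inj_on_subset)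
    have crW: "list_all create W"
    proof -
      have "P i \<in> set ps \<and> R i \<in> set qs" if "i \<in> set os" for i
        using that os P_im R_im by blast
      then show ?thesis
        using pq by (fastforce simp: W_def list_all_iff create_def rows_def cols_def)
    qed
    have set_zip_rs: "set (zip ps rs) = (\<lambda>i. (P i, R i)) ` {..<length rs}"
      using len by (auto simp: set_zip P_def R_def)
    have zip_PK: "zip (map P ks) qK = map (\<lambda>i. (P i, R i)) ks"
      unfolding qK_def zip_map_map by (simp add: zip_same_conv_map)
    have lower: "ew (W @ zip fs qK) vac \<in> ?S"
      if fs: "fs \<in> permutations_of_set (P ` K)" "fs \<noteq> map P ks" for fs
    proof -
      define ws where "ws = W @ zip fs qK"
      have dfs: "distinct fs" "set fs = P ` K" using fs by (auto simp: permutations_of_set_def)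
      then have lfs: "length fs = length qK" using cPK qK(3) by (metis distinct_card)
      have mfst: "map fst ws = map P os @ fs" and msnd: "map snd ws = map R os @ qK"
        using lfs by (simp_all add: ws_def W_def)
      have "inj_on P (set os)" "inj_on R (set os)"
        using injP injR os by (auto intro: inj_on_subset)
      then have d: "distinct (map fst ws)" "distinct (map snd ws)"
        unfolding mfst msnd using os dfs qK P_disj R_disj by (auto simp: distinct_map)
      have im: "fst ` set ws = set ps" "snd ` set ws = set qs"
        using arg_cong[OF mfst, of set] arg_cong[OF msnd, of set] dfs qK P_disj R_disj by auto
      have "rows fs" "cols qK"
        using dfs qK P_disj R_disj pq by (auto simp: rows_def cols_def)
      then have cr: "list_all create ws"
        unfolding ws_def using crW create_zip by simp
      obtain e rs' where rs': "ew ws vac = e *s ew (zip ps rs') vac" "rs' \<in> permutations_of_set (set qs)"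
        "set (zip ps rs') = set ws"
        using word_eq_sorted[OF pq d(1) im(1) d(2) im(2) cr] by metis
      have len': "length rs' = length ps"
        using rs'(2) pq by (metis cols_def distinct_card permutations_of_setD)
      have at: "rs' ! i = q" if "(P i, q) \<in> set ws" "i < length rs" for i q
      proof -
        have "(P i, q) \<in> set (zip ps rs')" using that(1) rs'(3) by simp
        then obtain j where "j < length rs'" "ps ! j = P i" "rs' ! j = q"
          unfolding in_set_zip by auto
        then show ?thesis
          using that(2) len len' pq(1) by (auto simp: P_def rows_def nth_eq_iff_index_eq)
      qed
      \<comment> \<open>Outside \<open>K\<close> the normal form keeps the entries of
        \<open>rs\<close>, and it is not \<open>rs\<close> itself because the rows \<open>fs\<close>
        are not in their original order.\<close>
      have "rs' < rs"
      proof (rule rearranged_decreasing_less[OF less.prems rs'(2)])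
        show "rs' ! i = rs ! i" if "i < length rs" "i \<notin> K" for i
          using that os by (intro at) (auto simp: ws_def W_def R_def)
        show "rs' \<noteq> rs"
        proof
          assume eq: "rs' = rs"
          have "fs ! t = P (ks ! t)" if "t < length fs" for t
          proof -
            have "(fs ! t, qK ! t) \<in> set ws" using that lfs by (auto simp: ws_def in_set_zip)
            then have "(fs ! t, R (ks ! t)) \<in> (\<lambda>i. (P i, R i)) ` {..<length rs}"
              using rs'(3) eq set_zip_rs that lfs by (simp add: qK_def)
            then obtain i where "i < length rs" "fs ! t = P i" "R (ks ! t) = R i" by auto
            moreover have "ks ! t \<in> K" using that lfs ks nth_mem[of t ks] by (simp add: qK_def)
            then have "ks ! t < length rs" by (rule inK)
            ultimately show ?thesis using injR by (auto simp: inj_on_def)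
          qed
          then have "fs = map P ks" using lfs by (intro nth_equalityI) (auto simp: qK_def)
          then show False using fs(2) by simp
        qed
      qed (use dec in auto)
      then show ?thesis using IH[OF rs'(2)] unfolding ws_def[symmetric] rs'(1) by (intro span_scale)
    qed
    have "mset (W @ zip (map P ks) qK) = mset (zip ps rs)"
    proof (subst set_eq_iff_mset_eq_distinct[symmetric])
      show "distinct (zip ps rs)" using pq(1) by (simp add: rows_def distinct_zipI1)
      have "distinct (os @ ks)" using os ks by auto
      moreover have "inj_on (\<lambda>i. (P i, R i)) (set (os @ ks))"
        using injP os ks K(1) by (auto simp: inj_on_def)
      ultimately have "distinct (map (\<lambda>i. (P i, R i)) (os @ ks))" by (simp only: distinct_map)
      then show "distinct (W @ zip (map P ks) qK)" unfolding zip_PK W_def by simp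
      have "{..<length rs} = set os \<union> set ks" using os ks K(1) by auto
      then show "set (W @ zip (map P ks) qK) = set (zip ps rs)"
        unfolding set_zip_rs zip_PK W_def by (simp add: image_Un)
    qed
    moreover have "list_all create (W @ zip (map P ks) qK)"
    proof -
      have "set (W @ zip (map P ks) qK) = set (zip ps rs)" using calculation by (metis set_mset_mset)
      then show ?thesis using create_zip[OF pq(1) rs(3)] by (simp only: list_all_iff)
    qed
    ultimately obtain e where e: "e \<noteq> 0" "ew (W @ zip (map P ks) qK) vac = e *s ew (zip ps rs) vac"
      using ew_mset by blast
    let ?F = "permutations_of_set (P ` K)"
    have finF: "finite ?F" using K(1) finite_subset by auto
    have "map P ks \<in> ?F"
      using ks K injP by (auto simp: permutations_of_set_def distinct_map intro: inj_on_subset)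
    have "P ` K \<subseteq> set ps" using P_disj by auto
    then have "\<forall>p\<in>P ` K. even p \<and> 4 \<le> p" using pq(1) by (auto simp: rows_def)
    moreover have "cols qK" using qK R_disj pq by (auto simp: cols_def)
    ultimately have "(\<Sum>fs\<in>?F. ew (zip fs qK) vac) \<in> I"
      using polarized_in_ideal[OF I, of qK "P ` K"] qK cPK finite_subset[OF K(1)] by auto
    then have "ew W (\<Sum>fs\<in>?F. ew (zip fs qK) vac) \<in> I"
      using I(1) by (intro stable_ew)
    then have "(\<Sum>fs\<in>?F. ew (W @ zip fs qK) vac) \<in> ?S"
      by (auto simp: ew_sum intro: span_base)
    moreover have "(\<Sum>fs\<in>?F - {map P ks}. ew (W @ zip fs qK) vac) \<in> ?S"
      by (rule span_sum) (use lower in blast)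
    \<comment> \<open>The relation in the ideal is solved for the one term whose rows are in place;
      up to the invertible factor \<open>e\<close> it is the given word.\<close>
    ultimately have "(\<Sum>fs\<in>?F. ew (W @ zip fs qK) vac) - (\<Sum>fs\<in>?F - {map P ks}. ew (W @ zip fs qK) vac) \<in> ?S"
      by (rule span_diff)
    also have "(\<Sum>fs\<in>?F. ew (W @ zip fs qK) vac) - (\<Sum>fs\<in>?F - {map P ks}. ew (W @ zip fs qK) vac)
        = e *s ew (zip ps rs) vac"
      unfolding sum.remove[OF finF \<open>map P ks \<in> ?F\<close>] e(2) by simp
    finally have "inverse e *s e *s ew (zip ps rs) vac \<in> ?S" by (rule span_scale)
    then show ?thesis using e(1) by simp
  qed
qed

lemma span_image_finite:
  assumes "finite G" "x \<in> span (f ` G)"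
  obtains b where "x = (\<Sum>g\<in>G. b g *s f g)"
proof -
  have "\<exists>b. x = (\<Sum>g\<in>G. b g *s f g)"
    using assms(2)
  proof (induction rule: span_induct_alt)
    case base
    show ?case by (rule exI[of _ "\<lambda>_. 0"]) simp
  next
    case (step a y z)
    then obtain g b where g: "g \<in> G" "y = f g" "z = (\<Sum>g\<in>G. b g *s f g)" by auto
    have "a *s y + z = (\<Sum>x\<in>G. (b(g := b g + a)) x *s f x)"
      unfolding g(2,3) using assms(1) g(1)
      by (simp add: sum.remove[of G g] scale_left_distrib add.commute add.left_commute)
    then show ?case by blast
  qed
  then show ?thesis using that by blast
qed

text \<open>Straightening writes \<open>v\<close> as an element of \<open>I\<close> plus a
  combination \<open>g\<close> of good words, and \<open>g\<close> again lies in \<open>Rd\<close>.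
  Annihilators send \<open>g\<close> to multiples of the vacuum, which must be zero because
  \<open>vac \<notin> Rd\<close>; these are the Gram equations of
  \<open>good_independent\<close>.\<close>

lemma multilinear_in_ideal:
  assumes c: "c = of_nat n" and I: "stable I" "Zv (Suc n) \<in> I" "I \<subseteq> Rd" and Rd: "stable Rd" "vac \<notin> Rd"
    and pq: "rows ps" "cols qs" "length ps = length qs"
    and v: "v \<in> Rd" "v \<in> span ((\<lambda>rs. ew (zip ps rs) vac) ` permutations_of_set (set qs))"
  shows "v \<in> I"
proof -
  define G where "G = {rs \<in> permutations_of_set (set qs). good n rs}"
  define Z where "Z = (\<lambda>rs. ew (zip ps rs) vac)"
  have finG: "finite G" by (simp add: G_def)
  have "Z ` permutations_of_set (set qs) \<subseteq> span (I \<union> Z ` G)"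
    using straighten[OF I(1,2) pq] unfolding G_def Z_def by auto
  then have "v \<in> span (I \<union> Z ` G)"
    using v(2) span_minimal[OF _ subspace_span] unfolding Z_def[symmetric] by blast
  then obtain y g where yg: "v = y + g" "y \<in> I" "g \<in> span (Z ` G)"
    using stable_subspace[OF I(1)] unfolding span_Un span_eq_iff[THEN iffD2, OF stable_subspace[OF I(1)]]
    by auto
  obtain b where b: "g = (\<Sum>rs\<in>G. b rs *s Z rs)" using span_image_finite[OF finG yg(3)] .
  have "v - y \<in> Rd" using v(1) yg(2) I(3) stable_subspace[OF Rd(1)] by (intro subspace_diff) auto
  then have gR: "g \<in> Rd" using yg(1) by simp
  have "(\<Sum>rs\<in>G. b rs * invcol n ss rs (set qs)) = 0" if "ss \<in> G" for ss
  proof -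
    have perm: "length rs = length ps" "cols rs" "set rs = set qs" if "rs \<in> G" for rs
    proof -
      have d: "distinct rs" "set rs = set qs" using that by (auto simp: G_def permutations_of_set_def)
      then show "set rs = set qs" "cols rs" using pq(2) by (auto simp: cols_def)
      show "length rs = length ps" using d pq by (metis cols_def distinct_card)
    qed
    have A: "ann (zip ps ss) (Z rs) = ((-1) ^ length ps * invcol n ss rs (set qs)) *s vac" if "rs \<in> G" for rs
      unfolding Z_def using annihilate_word[OF c, of ss ps rs] perm[OF that] perm[OF \<open>ss \<in> G\<close>] pq by simp
    then have "ann (zip ps ss) g = ((-1) ^ length ps * (\<Sum>rs\<in>G. b rs * invcol n ss rs (set qs))) *s vac"
    proof -
      have "ann (zip ps ss) g = (\<Sum>rs\<in>G. b rs *s ann (zip ps ss) (Z rs))"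
        by (simp add: b ann_def ew_sum ew_scale)
      also have "\<dots> = (\<Sum>rs\<in>G. ((-1) ^ length ps * (b rs * invcol n ss rs (set qs))) *s vac)"
        using A by (intro sum.cong) (simp_all add: mult.left_commute)
      finally show ?thesis by (simp add: sum_distrib_left scale_sum_left)
    qed
    moreover have "ann (zip ps ss) g \<in> Rd" unfolding ann_def using gR Rd by (intro stable_ew)
    ultimately have "((-1) ^ length ps * (\<Sum>rs\<in>G. b rs * invcol n ss rs (set qs))) *s vac \<in> Rd" by simp
    then have "(-1) ^ length ps * (\<Sum>rs\<in>G. b rs * invcol n ss rs (set qs)) = 0"
      using Rd(2) subspace_scale[OF stable_subspace[OF Rd(1)]]
      by (metis scale_scale scale_one left_inverse)
    then show ?thesis by simp
  qed
  then have "b rs = 0" if "rs \<in> G" for rs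
    using that by (intro good_independent[of G "set qs" n b]) (auto simp: G_def)
  then have "g = 0" unfolding b by (intro sum.neutral) simp
  then show ?thesis using yg(1,2) by simp
qed

end

section \<open>Reduction of arbitrary weights to multilinear ones\<close>

lemma fresh_even:
  fixes S :: "int set"
  assumes "finite S"
  obtains p where "even p" "4 \<le> p" "p \<notin> S"
proof -
  obtain M where "\<forall>x\<in>S. x \<le> M" using assms by (meson bdd_above_def bdd_above_finite)
  then have "2 * \<bar>M\<bar> + 4 \<notin> S" by fastforce
  then show ?thesis using that[of "2 * \<bar>M\<bar> + 4"] by simp
qed

lemma fresh_odd:
  fixes S :: "int set"
  assumes "finite S"
  obtains q where "odd q" "q \<le> 1" "q \<notin> S"
proof -
  obtain M where "\<forall>x\<in>S. M \<le> x" using assms by (meson bdd_below_def bdd_below_finite)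
  then have "- 2 * \<bar>M\<bar> - 1 \<notin> S" by fastforce
  then show ?thesis using that[of "- 2 * \<bar>M\<bar> - 1"] by simp
qed

lemma distinct_count_list:
  assumes "\<And>h. int (count_list xs h) = of_bool (h \<in> P)"
  shows "distinct xs" "set xs = P"
proof -
  have c: "count_list xs h = of_bool (h \<in> P)" for h
    using assms[of h] by (auto split: if_splits)
  show "set xs = P" using c by (metis (mono_tags) count_list_0_iff of_bool_eq_0_iff subsetI subset_antisym)
  then show "distinct xs" unfolding distinct_count_atmost_1 by (simp add: count_mset c)
qed

context glmod
begin

text \<open>Rows are at least 2 and columns at most 1, so nothing cancels in the weight: it
  determines both index multisets, and each prescribed index occurs exactly once.\<close>

lemma generic_weight_in_ideal:
  assumes c: "c = of_nat n" and I: "stable I" "Zv (Suc n) \<in> I" "I \<subseteq> Rd" and Rd: "stable Rd" "vac \<notin> Rd"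
    and P: "finite P" "\<forall>p\<in>P. even p \<and> 4 \<le> p" and Q: "finite Q" "\<forall>q\<in>Q. odd q \<and> q \<le> 1" and PQ: "card P = card Q"
  shows "WS (\<lambda>h. of_bool (h \<in> P) - of_bool (h \<in> Q)) \<inter> Rd \<subseteq> I"
proof
  fix v assume v: "v \<in> WS (\<lambda>h. of_bool (h \<in> P) - of_bool (h \<in> Q)) \<inter> Rd"
  define ps where "ps = sorted_list_of_set P"
  define qs where "qs = sorted_list_of_set Q"
  have ps: "rows ps" "set ps = P" and qs: "cols qs" "set qs = Q" and len: "length ps = length qs"
    using P Q PQ by (auto simp: ps_def qs_def rows_def cols_def)
  have "ew ws vac \<in> span ((\<lambda>rs. ew (zip ps rs) vac) ` permutations_of_set (set qs))"
    if ws: "list_all create ws" "wt ws = (\<lambda>h. of_bool (h \<in> P) - of_bool (h \<in> Q))" for ws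
  proof -
    have w: "int (count_list (map fst ws) h) - int (count_list (map snd ws) h)
        = of_bool (h \<in> P) - of_bool (h \<in> Q)" for h
      using fun_cong[OF ws(2), of h] by (simp add: wt_def)
    have f0: "count_list (map fst ws) h = 0" if "h \<le> 1" for h
      unfolding count_list_0_iff using ws(1) that by (fastforce simp: list_all_iff create_def)
    have s0: "count_list (map snd ws) h = 0" if "2 \<le> h" for h
      unfolding count_list_0_iff using ws(1) that by (fastforce simp: list_all_iff create_def)
    have PQ0: "h \<le> 1 \<Longrightarrow> h \<notin> P" "2 \<le> h \<Longrightarrow> h \<notin> Q" for h using P Q by fastforce+
    have "int (count_list (map fst ws) h) = of_bool (h \<in> P)"
      "int (count_list (map snd ws) h) = of_bool (h \<in> Q)" for h
      using w[of h] f0[of h] s0[of h] PQ0[of h] by (cases "h \<le> 1"; force)+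
    note d = distinct_count_list[OF this(1)] distinct_count_list[OF this(2)]
    show ?thesis
    proof (rule word_eq_sorted[OF ps(1) qs(1) len])
      show "distinct (map fst ws)" "distinct (map snd ws)" by (fact d)+
      show "fst ` set ws = set ps" "snd ` set ws = set qs" using d ps qs by (simp_all only: set_map)
      fix e rs assume "ew ws vac = e *s ew (zip ps rs) vac" "rs \<in> permutations_of_set (set qs)"
      then show ?thesis by (simp add: span_scale span_base)
    qed fact
  qed
  then have "{ew ws vac | ws. list_all create ws \<and> wt ws = (\<lambda>h. of_bool (h \<in> P) - of_bool (h \<in> Q))}
      \<subseteq> span ((\<lambda>rs. ew (zip ps rs) vac) ` permutations_of_set (set qs))"
    by auto
  then have "WS (\<lambda>h. of_bool (h \<in> P) - of_bool (h \<in> Q))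
      \<subseteq> span ((\<lambda>rs. ew (zip ps rs) vac) ` permutations_of_set (set qs))"
    unfolding WS_wtspan wtspan_def by (rule span_minimal) (rule subspace_span)
  then show "v \<in> I"
    using multilinear_in_ideal[OF c I Rd ps(1) qs(1) len, of v] v by auto
qed

text \<open>\<open>as\<close> lists the rows still to be replaced, \<open>B\<close> the fresh rows
  already in use, and \<open>\<nu>\<close> is the column part of the weight. Both \<open>I\<close>
  and \<open>Rd\<close> are stable, so membership in \<open>I\<close> is carried back along
  \<open>polarize_row\<close>.\<close>

lemma polarize_rows:
  assumes I: "stable I" and Rd: "stable Rd" and \<nu>: "\<And>h. 2 \<le> h \<Longrightarrow> \<nu> h = 0"
    and gen: "\<And>B. finite B \<Longrightarrow> card B = m \<Longrightarrow> \<forall>p\<in>B. even p \<and> 4 \<le> p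
      \<Longrightarrow> WS (\<lambda>h. of_bool (h \<in> B) + \<nu> h) \<inter> Rd \<subseteq> I"
    and as: "\<forall>i\<in>set as. 2 \<le> i" and B: "finite B" "\<forall>p\<in>B. even p \<and> 4 \<le> p" "length as + card B = m"
  shows "WS (\<lambda>h. int (count_list as h) + of_bool (h \<in> B) + \<nu> h) \<inter> Rd \<subseteq> I"
  using as B
proof (induction as arbitrary: B)
  case Nil
  then show ?case using gen by simp
next
  case (Cons i as)
  define \<mu> where "\<mu> = (\<lambda>h. int (count_list (i # as) h) + of_bool (h \<in> B) + \<nu> h)"
  obtain p where p: "even p" "4 \<le> p" "p \<notin> B \<union> set (i # as)"
    using fresh_even[of "B \<union> set (i # as)"] Cons.prems by auto
  have c0: "count_list as p = 0" using p by (simp add: count_list_0_iff)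
  have \<mu>p: "\<mu> p = 0" using p \<nu>[of p] c0 by (simp add: \<mu>_def)
  have \<mu>i: "0 < \<mu> i" using Cons.prems \<nu>[of i] by (simp add: \<mu>_def)
  show ?case unfolding \<mu>_def[symmetric]
  proof
    fix v assume v: "v \<in> WS \<mu> \<inter> Rd"
    have "E p i v \<in> WS (\<mu>(p := \<mu> p + 1, i := \<mu> i - 1))" using v p by (intro WS_E) auto
    also have "\<mu>(p := \<mu> p + 1, i := \<mu> i - 1) = (\<lambda>h. int (count_list as h) + of_bool (h \<in> insert p B) + \<nu> h)"
      using p \<nu>[of p] c0 by (auto simp: \<mu>_def)
    finally have "E p i v \<in> I"
      using Cons.IH[of "insert p B"] Cons.prems p stableD[OF Rd, of v p i] v by auto
    then have "E i p (E p i v) \<in> I" by (rule stableD[OF I])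
    moreover have "E i p (E p i v) = of_int (\<mu> i) *s v"
      using v p Cons.prems \<mu>p by (intro polarize_row) auto
    ultimately have "inverse (of_int (\<mu> i)) *s of_int (\<mu> i) *s v \<in> I"
      using stable_subspace[OF I] by (simp only: subspace_scale)
    then show "v \<in> I" using \<mu>i by simp
  qed
qed

lemma polarize_cols:
  assumes I: "stable I" and Rd: "stable Rd" and \<rho>: "\<And>h. h \<le> 1 \<Longrightarrow> \<rho> h = 0"
    and gen: "\<And>B. finite B \<Longrightarrow> card B = m \<Longrightarrow> \<forall>q\<in>B. odd q \<and> q \<le> 1
      \<Longrightarrow> WS (\<lambda>h. \<rho> h - of_bool (h \<in> B)) \<inter> Rd \<subseteq> I"
    and bs: "\<forall>j\<in>set bs. j \<le> 1" and B: "finite B" "\<forall>q\<in>B. odd q \<and> q \<le> 1" "length bs + card B = m"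
  shows "WS (\<lambda>h. \<rho> h - int (count_list bs h) - of_bool (h \<in> B)) \<inter> Rd \<subseteq> I"
  using bs B
proof (induction bs arbitrary: B)
  case Nil
  then show ?case using gen by simp
next
  case (Cons j bs)
  define \<mu> where "\<mu> = (\<lambda>h. \<rho> h - int (count_list (j # bs) h) - of_bool (h \<in> B))"
  obtain q where q: "odd q" "q \<le> 1" "q \<notin> B \<union> set (j # bs)"
    using fresh_odd[of "B \<union> set (j # bs)"] Cons.prems by auto
  have c0: "count_list bs q = 0" using q by (simp add: count_list_0_iff)
  have \<mu>q: "\<mu> q = 0" using q \<rho>[of q] c0 by (simp add: \<mu>_def)
  have \<mu>j: "\<mu> j < 0" using Cons.prems \<rho>[of j] by (simp add: \<mu>_def)
  show ?case unfolding \<mu>_def[symmetric]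
  proof
    fix v assume v: "v \<in> WS \<mu> \<inter> Rd"
    have "E j q v \<in> WS (\<mu>(j := \<mu> j + 1, q := \<mu> q - 1))" using v q by (intro WS_E) auto
    also have "\<mu>(j := \<mu> j + 1, q := \<mu> q - 1) = (\<lambda>h. \<rho> h - int (count_list bs h) - of_bool (h \<in> insert q B))"
      using q \<rho>[of q] c0 by (auto simp: \<mu>_def)
    finally have "E j q v \<in> I"
      using Cons.IH[of "insert q B"] Cons.prems q stableD[OF Rd, of v j q] v by auto
    then have "E q j (E j q v) \<in> I" by (rule stableD[OF I])
    moreover have "E q j (E j q v) = (- sg q j j q * of_int (\<mu> j)) *s v"
      using v q Cons.prems \<mu>q by (intro polarize_col) auto
    ultimately have "inverse (- sg q j j q * of_int (\<mu> j)) *s (- sg q j j q * of_int (\<mu> j)) *s v \<in> I"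
      using stable_subspace[OF I] by (simp only: subspace_scale)
    then show "v \<in> I" using \<mu>j by (simp add: field_simps)
  qed
qed

text \<open>The vector is split into weight components, which stay in \<open>Rd\<close>.
  Multiplicities in each weight are removed by the two polarisation lemmas, the column step being
  nested in the generic case of the row step.\<close>

theorem proper_stable_subset_ideal:
  assumes c: "c = of_nat n" and I: "stable I" "Zv (Suc n) \<in> I" "I \<subseteq> Rd" and Rd: "stable Rd" "vac \<notin> Rd"
    and v: "v \<in> V0" "v \<in> Rd"
  shows "v \<in> I"
proof -
  obtain F x where F: "finite F" "v = (\<Sum>\<mu>\<in>F. x \<mu>)" "\<And>\<mu>. x \<mu> \<in> wtspan \<mu>"
    using V0_decomp[OF v(1)] by blast
  have eig: "E h h (x \<mu>) = of_int (\<mu> h) *s x \<mu>" for \<mu> h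
    using F(3)[of \<mu>] wtspan_WS[of \<mu>] by (auto simp: WS_def)
  have "x \<mu> \<in> I" if "\<mu> \<in> F" for \<mu>
  proof (cases "\<exists>ws. list_all create ws \<and> wt ws = \<mu>")
    case False
    then have empty: "{ew ws vac | ws. list_all create ws \<and> wt ws = \<mu>} = {}" by blast
    have "wtspan \<mu> = {0}" unfolding wtspan_def empty by simp
    then show ?thesis using F(3)[of \<mu>] subspace_0[OF stable_subspace[OF I(1)]] by simp
  next
    case True
    then obtain ws where ws: "list_all create ws" "wt ws = \<mu>" by blast
    \<comment> \<open>The empty set stands for the fresh rows: nothing has been replaced
      yet.\<close>
    have "WS (\<lambda>h. int (count_list (map fst ws) h) + of_bool (h \<in> {}) + - int (count_list (map snd ws) h)) \<inter> Rd \<subseteq> I"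
    proof (rule polarize_rows[OF I(1) Rd(1), where m = "length ws"])
      show "- int (count_list (map snd ws) h) = 0" if "2 \<le> h" for h
        using ws(1) that by (fastforce simp: list_all_iff create_def count_list_0_iff)
      fix B :: "int set" assume B: "finite B" "card B = length ws" "\<forall>p\<in>B. even p \<and> 4 \<le> p"
      have "WS (\<lambda>h. of_bool (h \<in> B) - int (count_list (map snd ws) h) - of_bool (h \<in> {})) \<inter> Rd \<subseteq> I"
      proof (rule polarize_cols[OF I(1) Rd(1), where m = "length ws"])
        show "of_bool (h \<in> B) = (0 :: int)" if "h \<le> 1" for h using B that by fastforce
        show "WS (\<lambda>h. of_bool (h \<in> B) - of_bool (h \<in> B')) \<inter> Rd \<subseteq> I"
          if "finite B'" "card B' = length ws" "\<forall>q\<in>B'. odd q \<and> q \<le> 1" for B'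
          using generic_weight_in_ideal[OF c I Rd B(1,3) that(1,3)] B(2) that(2) by simp
      qed (use ws(1) in \<open>auto simp: list_all_iff create_def\<close>)
      then show "WS (\<lambda>h. of_bool (h \<in> B) + - int (count_list (map snd ws) h)) \<inter> Rd \<subseteq> I" by simp
    qed (use ws(1) in \<open>auto simp: list_all_iff create_def\<close>)
    moreover have "(\<lambda>h. int (count_list (map fst ws) h) + of_bool (h \<in> {}) + - int (count_list (map snd ws) h)) = \<mu>"
      using ws(2) by (auto simp: wt_def)
    moreover have "x \<mu> \<in> Rd"
      using weight_components[OF F(1) Rd(1), of x] eig F(2) v(2) that by blast
    ultimately show ?thesis using F(3)[of \<mu>] wtspan_WS[of \<mu>] by auto
  qed
  then show ?thesis unfolding F(2) by (intro subspace_sum[OF stable_subspace[OF I(1)]])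
qed

end

section \<open>Differential operators and matrix units\<close>

definition polyfun :: "(complex \<Rightarrow> complex) \<Rightarrow> bool" where
  "polyfun P \<longleftrightarrow> (\<exists>p. P = poly p)"

lemma polyfunI: "(\<And>x. P x = poly p x) \<Longrightarrow> polyfun P"
  by (auto simp: polyfun_def)

lemma polyfun_const [simp]: "polyfun (\<lambda>x. a)"
  by (rule polyfunI[of _ "[:a:]"]) simp

lemma polyfun_add: "polyfun P \<Longrightarrow> polyfun Q \<Longrightarrow> polyfun (\<lambda>x. P x + Q x)"
  unfolding polyfun_def by (auto simp flip: poly_add intro: exI[of _ "_ + _"])

lemma polyfun_mult: "polyfun P \<Longrightarrow> polyfun Q \<Longrightarrow> polyfun (\<lambda>x. P x * Q x)"
  unfolding polyfun_def by (auto simp flip: poly_mult intro: exI[of _ "_ * _"])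

lemma polyfun_diff: "polyfun P \<Longrightarrow> polyfun Q \<Longrightarrow> polyfun (\<lambda>x. P x - Q x)"
  unfolding polyfun_def by (auto simp flip: poly_diff intro: exI[of _ "_ - _"])

lemma polyfun_shift: "polyfun P \<Longrightarrow> polyfun (\<lambda>x. P (x + a))"
proof -
  assume "polyfun P"
  then obtain p where "P = poly p" by (auto simp: polyfun_def)
  then show ?thesis
    by (intro polyfunI[of _ "pcompose p [:a, 1:]"]) (simp add: poly_pcompose add.commute)
qed

lemma polyfun_linear [simp]: "polyfun (\<lambda>x. x - a)"
  by (rule polyfunI[of _ "[:- a, 1:]"]) simp

lemma polyfun_prod: "(\<And>i. i \<in> S \<Longrightarrow> polyfun (P i)) \<Longrightarrow> polyfun (\<lambda>x. \<Prod>i\<in>S. P i x)"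
  by (induction S rule: infinite_finite_induct) (auto simp: polyfun_mult)

lemma polyfun_sum: "(\<And>i. i \<in> S \<Longrightarrow> polyfun (P i)) \<Longrightarrow> polyfun (\<lambda>x. \<Sum>i\<in>S. P i x)"
  by (induction S rule: infinite_finite_induct) (auto simp: polyfun_add)

lemma polyfun_ff [simp]: "polyfun (\<lambda>x. ff x k)"
  unfolding ff_def by (rule polyfun_prod) simp

lemma polyfun_ff_shift [simp]: "polyfun (\<lambda>x. ff (x + a) k)"
  by (rule polyfun_shift) simp

lemma ff_Suc: "ff x (Suc k) = ff x k * (x - of_nat k)"
  by (simp add: ff_def)

lemma ff_of_nat: "ff (of_nat i) k = of_nat (i choose k) * fact k"
proof -
  have "ff (of_nat i) k = (\<Prod>j<k. of_nat i - of_nat j)" by (simp add: ff_def)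
  also have "\<dots> = (of_nat i gchoose k) * fact k"
    by (simp add: gbinomial_prod_rev atLeast0LessThan)
  finally show ?thesis by (simp add: binomial_gbinomial)
qed

text \<open>Forward differences of a falling factorial: after regrouping the binomials the sum
  becomes the expansion of \<open>(1 - 1)^(p - k)\<close>.\<close>

lemma fcoef_ff: "fcoef (\<lambda>x. ff x k) p = (if p = k then 1 else 0)"
proof (cases "k \<le> p")
  case False
  then have "(\<Sum>i\<le>p. (-1) ^ (p - i) * of_nat (p choose i) * ff (of_nat i) k) = (0::complex)"
    by (intro sum.neutral) (simp add: ff_of_nat)
  then show ?thesis using False by (simp add: fcoef_def)
next
  case True
  have "(\<Sum>i\<le>p. (-1) ^ (p - i) * of_nat (p choose i) * ff (of_nat i) k)
      = (\<Sum>i=k..p. (-1) ^ (p - i) * of_nat (p choose i) * ff (of_nat i) k :: complex)"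
    by (rule sum.mono_neutral_right) (auto simp: ff_of_nat)
  also have "\<dots> = (\<Sum>i=k..p. of_nat (p choose k) * fact k * ((-1) ^ (p - i) * of_nat ((p - k) choose (i - k))))"
  proof (intro sum.cong refl)
    fix i assume "i \<in> {k..p}"
    then have "(p choose i) * (i choose k) = (p choose k) * ((p - k) choose (i - k))"
      by (simp add: choose_mult)
    then have "of_nat (p choose i) * of_nat (i choose k) = (of_nat (p choose k) * of_nat ((p - k) choose (i - k)) :: complex)"
      by (metis of_nat_mult)
    moreover have "(-1) ^ (p - i) * of_nat (p choose i) * ff (of_nat i) k
        = (-1) ^ (p - i) * fact k * (of_nat (p choose i) * of_nat (i choose k) :: complex)"
      by (simp only: ff_of_nat mult_ac)
    ultimately show "(-1) ^ (p - i) * of_nat (p choose i) * ff (of_nat i) k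
        = (of_nat (p choose k) * fact k * ((-1) ^ (p - i) * of_nat ((p - k) choose (i - k))) :: complex)"
      by (simp only: mult_ac)
  qed
  also have "\<dots> = of_nat (p choose k) * fact k * (\<Sum>i=k..p. (-1) ^ (p - i) * of_nat ((p - k) choose (i - k)))"
    by (simp add: sum_distrib_left)
  also have "(\<Sum>i=k..p. (-1) ^ (p - i) * of_nat ((p - k) choose (i - k)))
      = (\<Sum>i\<le>p - k. (-1) ^ (p - k - i) * of_nat ((p - k) choose i) :: complex)"
    using True by (intro sum.reindex_bij_witness[where i = "\<lambda>i. i + k" and j = "\<lambda>i. i - k"]) auto
  also have "\<dots> = (1 + - 1) ^ (p - k)"
    by (simp only: binomial_ring) (simp add: mult.commute)
  finally show ?thesis using True by (auto simp: fcoef_def)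
qed

lemma fcoef_linear: "fcoef (\<lambda>x. a * P x + b * Q x) p = a * fcoef P p + b * fcoef Q p"
  by (simp add: fcoef_def add_divide_distrib[symmetric] sum_distrib_left sum.distrib[symmetric] algebra_simps)

lemma fcoef_add: "fcoef (\<lambda>x. P x + Q x) p = fcoef P p + fcoef Q p"
  using fcoef_linear[of 1 P 1 Q] by simp

lemma fcoef_scale: "fcoef (\<lambda>x. a * P x) p = a * fcoef P p"
  using fcoef_linear[of a P 0 P] by simp

lemma fcoef_zero [simp]: "fcoef (\<lambda>x. 0) p = 0"
  by (simp add: fcoef_def)

lemma fcoef_sum: "fcoef (\<lambda>x. \<Sum>i\<in>S. P i x) p = (\<Sum>i\<in>S. fcoef (P i) p)"
  by (induction S rule: infinite_finite_induct) (auto simp: fcoef_add)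

text \<open>Horner recursion: multiplication by \<open>x\<close> sends \<open>ff x k\<close> to
  \<open>ff x (Suc k) + k * ff x k\<close>.\<close>

lemma polyfun_ff_expansion:
  assumes "polyfun P"
  obtains d a where "P = (\<lambda>x. \<Sum>k<d. a k * ff x k)"
proof -
  have "\<exists>d a. \<forall>x. poly p x = (\<Sum>k<d. a k * ff x k)" for p :: "complex poly"
  proof (induction p)
    case 0
    then show ?case by (intro exI[of _ 0]) simp
  next
    case (pCons b p)
    then obtain d a where a: "\<And>x. poly p x = (\<Sum>k<d. a k * ff x k)" by blast
    define a' where "a' = (\<lambda>k. (if k < d then of_nat k * a k else 0) + (if 1 \<le> k then a (k - 1) else 0)
      + (if k = 0 then b else 0))"
    have "poly (pCons b p) x = (\<Sum>k<Suc d. a' k * ff x k)" for x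
    proof -
      have "x * (a k * ff x k) = a k * ff x (Suc k) + of_nat k * a k * ff x k" for k
        by (simp add: ff_Suc algebra_simps)
      then have "x * poly p x = (\<Sum>k<d. a k * ff x (Suc k)) + (\<Sum>k<d. of_nat k * a k * ff x k)"
        by (simp only: a sum_distrib_left sum.distrib)
      moreover have "(\<Sum>k<Suc d. (if k < d then of_nat k * a k else 0) * ff x k) = (\<Sum>k<d. of_nat k * a k * ff x k)"
        by simp
      moreover have "(\<Sum>k<Suc d. (if 1 \<le> k then a (k - 1) else 0) * ff x k) = (\<Sum>k<d. a k * ff x (Suc k))"
        by (subst sum.lessThan_Suc_shift) simp
      moreover have "(\<Sum>k<Suc d. (if k = 0 then b else 0) * ff x k) = b"
        by (subst sum.lessThan_Suc_shift) (simp add: ff_def)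
      ultimately show ?thesis by (simp only: a'_def distrib_right sum.distrib) simp
    qed
    then show ?case by blast
  qed
  then show ?thesis using assms that unfolding polyfun_def by metis
qed

definition fsupp :: "(complex \<Rightarrow> complex) \<Rightarrow> nat set" where
  "fsupp P = {p. fcoef P p \<noteq> 0}"

lemma newton:
  assumes "polyfun P"
  shows "finite (fsupp P)" "P x = (\<Sum>p\<in>fsupp P. fcoef P p * ff x p)"
proof -
  obtain d a where P: "P = (\<lambda>x. \<Sum>k<d. a k * ff x k)" using polyfun_ff_expansion[OF assms] .
  have f: "fcoef P p = (if p < d then a p else 0)" for p
    by (simp add: P fcoef_sum fcoef_scale fcoef_ff if_distrib[of "\<lambda>x. a _ * x"] cong: if_cong)
  then have sub: "fsupp P \<subseteq> {..<d}" by (auto simp: fsupp_def)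
  then show "finite (fsupp P)" by (rule finite_subset) simp
  have "P x = (\<Sum>p<d. fcoef P p * ff x p)" by (subst P) (simp add: f)
  also have "\<dots> = (\<Sum>p\<in>fsupp P. fcoef P p * ff x p)"
    using sub by (intro sum.mono_neutral_right) (auto simp: fsupp_def)
  finally show "P x = (\<Sum>p\<in>fsupp P. fcoef P p * ff x p)" .
qed

text \<open>Lagrange polynomial of the node \<open>j\<close> among the integers from
  \<open>-N\<close> to \<open>N\<close>. For \<open>j\<close> outside this window it vanishes at all
  nodes, consistently with \<open>lag_eq\<close>.\<close>

definition lag :: "int \<Rightarrow> int \<Rightarrow> complex \<Rightarrow> complex" where
  "lag j N x = (\<Prod>l\<in>{-N..N} - {j}. (x - of_int l) / of_int (j - l))"

lemma polyfun_lag [simp]: "polyfun (lag j N)"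
  unfolding lag_def divide_inverse by (intro polyfun_prod polyfun_mult) auto

lemma lag_eq: "\<bar>l\<bar> \<le> N \<Longrightarrow> lag j N (of_int l) = (if l = j then 1 else 0)"
proof (cases "l = j")
  case True
  then show ?thesis by (auto simp: lag_def intro!: prod.neutral simp flip: of_int_diff)
next
  case False
  assume "\<bar>l\<bar> \<le> N"
  then have "l \<in> {-N..N} - {j}" using False by auto
  then show ?thesis using False unfolding lag_def by (auto simp: prod_zero_iff intro!: bexI[of _ l])
qed

section \<open>Matrix entries, cocycle and bracket in terms of polynomial symbols\<close>

text \<open>\<open>True\<close> is the odd index.\<close>
fun unit :: "bool \<Rightarrow> bool \<Rightarrow> ent" where
  "unit False False = E0"
| "unit False True = Ep"
| "unit True False = Em"
| "unit True True = E1"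

lemma unit_cases: obtains r s where "a = unit r s"
  by (cases a) (metis unit.simps)+

lemma UNIV_ent: "UNIV = {E0, E1, Ep, Em}"
  using ent.exhaust by auto

lemma emul_unit: "emul (unit r s) (unit s' t) = (if s = s' then Some (unit r t) else None)"
  by (cases r; cases s; cases s'; cases t) auto

lemma odd_unit [simp]: "odd_ent (unit r s) \<longleftrightarrow> r \<noteq> s"
  by (cases r; cases s) (auto simp: odd_ent_def)

lemma str_unit: "str_ent (Some (unit r t)) = (if r = t then if r then -1 else 1 else 0)"
  by (cases r; cases t) auto

lemma unit_inject [simp]: "unit r s = unit r' s' \<longleftrightarrow> r = r' \<and> s = s'"
  by (cases r; cases s; cases r'; cases s') auto

definition usg :: "bool \<Rightarrow> bool \<Rightarrow> bool \<Rightarrow> bool \<Rightarrow> complex" where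
  "usg r s r' s' = (if r \<noteq> s \<and> r' \<noteq> s' then -1 else 1)"

text \<open>The cocycle for arbitrary functions in place of falling factorials: bilinear, and so
  applicable to interpolating polynomials.\<close>

definition Psi :: "int \<Rightarrow> bool \<Rightarrow> bool \<Rightarrow> (complex \<Rightarrow> complex) \<Rightarrow> int \<Rightarrow> bool \<Rightarrow> bool \<Rightarrow> (complex \<Rightarrow> complex) \<Rightarrow> complex" where
  "Psi n r s P m r' s' Q = (if n + m \<noteq> 0 \<or> s \<noteq> r' \<or> r \<noteq> s' then 0
     else if 0 \<le> n then (if r then -1 else 1) * (\<Sum>j\<in>{-n..-1}. P (of_int j) * Q (of_int (j + n)))
     else - usg r s r' s' * (if s then -1 else 1) * (\<Sum>j\<in>{-m..-1}. Q (of_int j) * P (of_int (j + m))))"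

lemma psi_unit: "psi (J (unit r s) k n) (J (unit r' s') l m) = Psi n r s (\<lambda>x. ff x k) m r' s' (\<lambda>x. ff x l)"
  by (auto simp: Psi_def ssgn_def usg_def emul_unit str_unit sum_distrib_left sum_distrib_right sum_negf mult_ac)

lemma Psi_scale_sum1: "Psi n r s (\<lambda>x. \<Sum>i\<in>S. u i * P i x) m r' s' Q = (\<Sum>i\<in>S. u i * Psi n r s (P i) m r' s' Q)"
  unfolding Psi_def
  by (auto simp: sum_distrib_left sum_distrib_right mult_ac sum_negf intro: sum.swap)

lemma Psi_scale_sum2: "Psi n r s P m r' s' (\<lambda>x. \<Sum>i\<in>S. u i * Q i x) = (\<Sum>i\<in>S. u i * Psi n r s P m r' s' (Q i))"
  unfolding Psi_def
  by (auto simp: sum_distrib_left sum_distrib_right mult_ac sum_negf intro: sum.swap)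

definition br_poly :: "ent \<Rightarrow> nat \<Rightarrow> int \<Rightarrow> ent \<Rightarrow> nat \<Rightarrow> int \<Rightarrow> ent \<Rightarrow> complex \<Rightarrow> complex" where
  "br_poly a k n b l m e x = ind (emul a b) e * ff (x + of_int m) k * ff x l
     - ssgn (J a k n) (J b l m) * ind (emul b a) e * ff x k * ff (x + of_int n) l"

lemma polyfun_br_poly [simp]: "polyfun (br_poly a k n b l m e)"
  unfolding br_poly_def by (intro polyfun_diff polyfun_mult) simp_all

text \<open>The support of a bracket is reindexed by matrix entry and Newton degree. The vector
  space is arbitrary because the formula serves both passages, from the algebra to matrix units and
  back.\<close>

lemma sum_br:
  fixes f :: "gb \<Rightarrow> 'v::ab_group_add" and scale :: "complex \<Rightarrow> 'v \<Rightarrow> 'v"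
  assumes "vector_space scale"
  shows "finite {z. br (J a k n) (J b l m) z \<noteq> 0}" (is "finite ?Z")
    and "(\<Sum>z\<in>{z. br (J a k n) (J b l m) z \<noteq> 0}. scale (br (J a k n) (J b l m) z) (f z))
      = scale (psi (J a k n) (J b l m)) (f Cb)
      + (\<Sum>e\<in>UNIV. \<Sum>p\<in>fsupp (br_poly a k n b l m e). scale (- fcoef (br_poly a k n b l m e) p) (f (J e p (n + m))))"
proof -
  interpret vector_space scale by fact
  define R where "R = br_poly a k n b l m"
  have poly: "polyfun (R e)" for e by (simp add: R_def)
  have br: "br (J a k n) (J b l m) (J e p (n + m)) = - fcoef (R e) p" for e p
    by (simp add: R_def br_poly_def[abs_def])
  define T where "T = (\<lambda>(e, p). J e p (n + m)) ` (SIGMA e:UNIV. fsupp (R e))"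
  have fin: "finite (SIGMA e:UNIV. fsupp (R e))"
    using newton(1)[OF poly] by (intro finite_SigmaI) (auto simp: UNIV_ent)
  have sub: "?Z \<subseteq> insert Cb T"
  proof
    fix z assume z: "z \<in> ?Z"
    show "z \<in> insert Cb T"
    proof (cases z)
      case (J e p q)
      then have "q = n + m" using z by (auto split: if_splits)
      then have "p \<in> fsupp (R e)" using z br[of e p] J by (simp add: fsupp_def)
      then show ?thesis using J \<open>q = n + m\<close> by (auto simp: T_def)
    qed simp
  qed
  have fT: "finite (insert Cb T)" using fin by (simp add: T_def)
  then show "finite ?Z" using sub by (rule finite_subset[rotated])
  have "(\<Sum>z\<in>?Z. scale (br (J a k n) (J b l m) z) (f z))
      = (\<Sum>z\<in>insert Cb T. scale (br (J a k n) (J b l m) z) (f z))"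
    using fT sub by (intro sum.mono_neutral_left) auto
  also have "\<dots> = scale (psi (J a k n) (J b l m)) (f Cb) + (\<Sum>z\<in>T. scale (br (J a k n) (J b l m) z) (f z))"
    using fin by (subst sum.insert) (auto simp: T_def)
  also have "(\<Sum>z\<in>T. scale (br (J a k n) (J b l m) z) (f z))
      = (\<Sum>(e, p)\<in>(SIGMA e:UNIV. fsupp (R e)). scale (- fcoef (R e) p) (f (J e p (n + m))))"
    unfolding T_def
    by (subst sum.reindex) (auto simp: inj_on_def br simp del: br.simps intro!: sum.cong)
  also have "\<dots> = (\<Sum>e\<in>UNIV. \<Sum>p\<in>fsupp (R e). scale (- fcoef (R e) p) (f (J e p (n + m))))"
    using newton(1)[OF poly] by (subst sum.Sigma[symmetric]) (auto simp: UNIV_ent)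
  finally show "(\<Sum>z\<in>?Z. scale (br (J a k n) (J b l m) z) (f z))
      = scale (psi (J a k n) (J b l m)) (f Cb)
      + (\<Sum>e\<in>UNIV. \<Sum>p\<in>fsupp (br_poly a k n b l m e). scale (- fcoef (br_poly a k n b l m e) p) (f (J e p (n + m))))"
    unfolding R_def .
qed

text \<open>The axiom \<open>A_generated\<close> is the source of local finiteness. It is phrased
  through the action because the ambient space may contain vectors outside the module.\<close>

locale sdmod = vector_space scale
  for scale :: "complex \<Rightarrow> 'v::ab_group_add \<Rightarrow> 'v" (infixr "*s" 75) +
  fixes pr :: "'v \<Rightarrow> 'v" and A :: "gb \<Rightarrow> 'v \<Rightarrow> 'v" and vac :: 'v and c :: complex
  assumes pr_add: "pr (u + v) = pr u + pr v"
    and pr_scale: "pr (a *s v) = a *s pr v"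
    and pr_idem: "pr (pr v) = pr v"
    and pr_A: "pr (A x v) = A x v"
    and A_pr: "A x (pr v) = A x v"
    and pr_vac: "pr vac = vac"
    and A_add: "A x (u + v) = A x u + A x v"
    and A_scale: "A x (a *s v) = a *s A x v"
    and A_comm: "A x (A y v) = ssgn x y *s A y (A x v) + (\<Sum>z\<in>{z. br x y z \<noteq> 0}. br x y z *s A z v)"
    and A_central: "A Cb v = c *s pr v"
    and A_vac: "in_SP x \<Longrightarrow> A x vac = chi c x *s vac"
    and A_generated: "\<exists>u \<in> span {foldr A w vac | w. True}. \<forall>x. A x v = A x u"
begin

lemma A_zero [simp]: "A x 0 = 0"
  using A_scale[of x 0 0] by simp

lemma A_minus: "A x (- v) = - A x v"
  using A_scale[of x "-1" v] by simp

text \<open>The action of \<open>t\<^sup>n P(D) M\<^sub>a\<close>.\<close>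
definition B :: "int \<Rightarrow> (complex \<Rightarrow> complex) \<Rightarrow> ent \<Rightarrow> 'v \<Rightarrow> 'v" where
  "B n P a v = - (\<Sum>p\<in>fsupp P. fcoef P p *s A (J a p n) v)"

lemma B_superset:
  "finite S \<Longrightarrow> fsupp P \<subseteq> S \<Longrightarrow> B n P a v = - (\<Sum>p\<in>S. fcoef P p *s A (J a p n) v)"
  unfolding B_def by (intro arg_cong[of _ _ uminus] sum.mono_neutral_left) (auto simp: fsupp_def)

lemma B_ff: "B n (\<lambda>x. ff x k) a v = - A (J a k n) v"
  by (subst B_superset[of "{k}"]) (auto simp: fsupp_def fcoef_ff split: if_splits)

lemma B_pr: "B n P a (pr v) = B n P a v"
  by (simp add: B_def A_pr)

lemma pr_sum: "pr (\<Sum>i\<in>S. f i) = (\<Sum>i\<in>S. pr (f i))"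
proof (induction S rule: infinite_finite_induct)
qed (use pr_scale[of 0 0] in \<open>simp_all add: pr_add\<close>)

lemma pr_B: "pr (B n P a v) = B n P a v"
  using pr_scale[of "-1" "\<Sum>p\<in>fsupp P. fcoef P p *s A (J a p n) v"]
  by (simp add: B_def pr_sum pr_scale pr_A)

lemma B_vadd: "B n P a (u + v) = B n P a u + B n P a v"
  by (simp add: B_def A_add scale_right_distrib sum.distrib)

lemma B_vscale: "B n P a (x *s v) = x *s B n P a v"
  by (simp add: B_def A_scale scale_sum_right mult.commute)

lemma B_vzero [simp]: "B n P a 0 = 0"
  by (simp add: B_def)

lemma B_vsum: "B n P a (\<Sum>i\<in>S. f i) = (\<Sum>i\<in>S. B n P a (f i))"
  by (induction S rule: infinite_finite_induct) (auto simp: B_vadd)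

lemma B_sum:
  assumes "finite S" "\<And>i. i \<in> S \<Longrightarrow> polyfun (P i)"
  shows "B n (\<lambda>x. \<Sum>i\<in>S. u i * P i x) a v = (\<Sum>i\<in>S. u i *s B n (P i) a v)"
proof -
  define T where "T = (\<Union>i\<in>S. fsupp (P i))"
  have T: "finite T" using assms newton(1) by (auto simp: T_def)
  have f: "fcoef (\<lambda>x. \<Sum>i\<in>S. u i * P i x) p = (\<Sum>i\<in>S. u i * fcoef (P i) p)" for p
    by (simp add: fcoef_sum fcoef_scale)
  have "fsupp (\<lambda>x. \<Sum>i\<in>S. u i * P i x) \<subseteq> T"
  proof
    fix p assume "p \<in> fsupp (\<lambda>x. \<Sum>i\<in>S. u i * P i x)"
    then obtain i where "i \<in> S" "u i * fcoef (P i) p \<noteq> 0"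
      unfolding fsupp_def f by (auto elim: sum.not_neutral_contains_not_neutral)
    then show "p \<in> T" by (auto simp: T_def fsupp_def)
  qed
  then have "B n (\<lambda>x. \<Sum>i\<in>S. u i * P i x) a v = - (\<Sum>p\<in>T. \<Sum>i\<in>S. u i *s fcoef (P i) p *s A (J a p n) v)"
    using T by (subst B_superset[of T]) (simp_all add: f scale_sum_left)
  also have "\<dots> = (\<Sum>i\<in>S. u i *s - (\<Sum>p\<in>T. fcoef (P i) p *s A (J a p n) v))"
    by (subst sum.swap) (simp add: scale_sum_right sum_negf)
  also have "\<dots> = (\<Sum>i\<in>S. u i *s B n (P i) a v)"
  proof (intro sum.cong refl)
    fix i assume "i \<in> S"
    then have "fsupp (P i) \<subseteq> T" by (auto simp: T_def)
    then show "u i *s - (\<Sum>p\<in>T. fcoef (P i) p *s A (J a p n) v) = u i *s B n (P i) a v"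
      by (simp only: B_superset[OF T])
  qed
  finally show ?thesis .
qed

lemma B_linear:
  assumes "polyfun P" "polyfun Q"
  shows "B n (\<lambda>x. y * P x + z * Q x) a v = y *s B n P a v + z *s B n Q a v"
proof -
  have "B n (\<lambda>x. \<Sum>i\<in>{True, False}. (if i then y else z) * (if i then P else Q) x) a v
      = (\<Sum>i\<in>{True, False}. (if i then y else z) *s B n (if i then P else Q) a v)"
    using assms by (intro B_sum) auto
  then show ?thesis by simp
qed

lemma B_diff:
  assumes "polyfun P" "polyfun Q"
  shows "B n (\<lambda>x. P x - Q x) a v = B n P a v - B n Q a v"
  using B_linear[OF assms, of n 1 "-1"] by simp

lemma B_zero [simp]: "B n (\<lambda>x. 0) a v = 0"
  by (simp add: B_def)

lemma A_comm_J:
  "A (J a k n) (A (J b l m) v) = ssgn (J a k n) (J b l m) *s A (J b l m) (A (J a k n) v)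
    + (\<Sum>e\<in>UNIV. B (n + m) (br_poly a k n b l m e) e v) + (psi (J a k n) (J b l m) * c) *s pr v"
  unfolding A_comm[of "J a k n"] sum_br(2)[OF vector_space_axioms] A_central
  by (simp add: B_def sum_negf)

text \<open>The commutator formula as a predicate of the two symbols, to be extended bilinearly from
  falling factorials.\<close>

definition comm_ok :: "int \<Rightarrow> bool \<Rightarrow> bool \<Rightarrow> int \<Rightarrow> bool \<Rightarrow> bool \<Rightarrow> 'v
    \<Rightarrow> (complex \<Rightarrow> complex) \<Rightarrow> (complex \<Rightarrow> complex) \<Rightarrow> bool" where
  "comm_ok n r s m r' s' v P Q \<longleftrightarrow> B n P (unit r s) (B m Q (unit r' s') v)
    = usg r s r' s' *s B m Q (unit r' s') (B n P (unit r s) v)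
    + ((if s = r' then B (n + m) (\<lambda>x. P (x + of_int m) * Q x) (unit r s') v else 0)
    - (if s' = r then usg r s r' s' *s B (n + m) (\<lambda>x. P x * Q (x + of_int n)) (unit r' s) v else 0)
    + (Psi n r s P m r' s' Q * c) *s pr v)"

lemma comm_ok_ff: "comm_ok n r s m r' s' v (\<lambda>x. ff x k) (\<lambda>x. ff x l)"
proof -
  let ?a = "unit r s" and ?b = "unit r' s'"
  have sg: "ssgn (J ?a k n) (J ?b l m) = usg r s r' s'" by (auto simp: ssgn_def usg_def)
  have "B (n + m) (\<lambda>x. ind (emul ?a ?b) e * ff (x + of_int m) k * ff x l
      - usg r s r' s' * ind (emul ?b ?a) e * ff x k * ff (x + of_int n) l) e v
    = ind (emul ?a ?b) e *s B (n + m) (\<lambda>x. ff (x + of_int m) k * ff x l) e v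
      + (- (usg r s r' s' * ind (emul ?b ?a) e)) *s B (n + m) (\<lambda>x. ff x k * ff (x + of_int n) l) e v" for e
    by (subst B_linear[symmetric])
      (simp_all add: polyfun_mult mult.assoc)
  then have "(\<Sum>e\<in>UNIV. B (n + m) (\<lambda>x. ind (emul ?a ?b) e * ff (x + of_int m) k * ff x l
      - usg r s r' s' * ind (emul ?b ?a) e * ff x k * ff (x + of_int n) l) e v)
    = (if s = r' then B (n + m) (\<lambda>x. ff (x + of_int m) k * ff x l) (unit r s') v else 0)
    - (if s' = r then usg r s r' s' *s B (n + m) (\<lambda>x. ff x k * ff (x + of_int n) l) (unit r' s) v else 0)"
    by (cases r; cases s; cases r'; cases s') (simp_all add: UNIV_ent ind_def)
  then show ?thesis
    unfolding comm_ok_def B_ff A_minus using A_comm_J[of ?a k n ?b l m v, unfolded br_poly_def[abs_def]]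
    by (simp add: sg psi_unit A_minus del: psi.simps)
qed

lemma central_sum: "((\<Sum>i\<in>S. u i * p i) * c) *s v = (\<Sum>i\<in>S. (u i * p i * c) *s v)"
  by (simp add: sum_distrib_right scale_sum_left)

lemma comm_ok_sum1:
  assumes "finite S" "\<And>i. i \<in> S \<Longrightarrow> polyfun (P i)" "polyfun Q"
    and "\<And>i. i \<in> S \<Longrightarrow> comm_ok n r s m r' s' v (P i) Q"
  shows "comm_ok n r s m r' s' v (\<lambda>x. \<Sum>i\<in>S. u i * P i x) Q"
proof -
  have 1: "(\<lambda>x. (\<Sum>i\<in>S. u i * P i (x + of_int m)) * Q x) = (\<lambda>x. \<Sum>i\<in>S. u i * (P i (x + of_int m) * Q x))"
    "(\<lambda>x. (\<Sum>i\<in>S. u i * P i x) * Q (x + of_int n)) = (\<lambda>x. \<Sum>i\<in>S. u i * (P i x * Q (x + of_int n)))"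
    by (simp_all add: sum_distrib_right mult.assoc)
  have 2: "B (n + m) (\<lambda>x. \<Sum>i\<in>S. u i * (P i (x + of_int m) * Q x)) a v
      = (\<Sum>i\<in>S. u i *s B (n + m) (\<lambda>x. P i (x + of_int m) * Q x) a v)"
    "B (n + m) (\<lambda>x. \<Sum>i\<in>S. u i * (P i x * Q (x + of_int n))) a v
      = (\<Sum>i\<in>S. u i *s B (n + m) (\<lambda>x. P i x * Q (x + of_int n)) a v)" for a
    using assms by (intro B_sum polyfun_mult polyfun_shift; simp)+
  have 3: "B n (\<lambda>x. \<Sum>i\<in>S. u i * P i x) a w = (\<Sum>i\<in>S. u i *s B n (P i) a w)" for a w
    using assms by (intro B_sum) auto
  have "(\<Sum>i\<in>S. u i *s B n (P i) (unit r s) (B m Q (unit r' s') v))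
    = (\<Sum>i\<in>S. u i *s (usg r s r' s' *s B m Q (unit r' s') (B n (P i) (unit r s) v)
    + ((if s = r' then B (n + m) (\<lambda>x. P i (x + of_int m) * Q x) (unit r s') v else 0)
    - (if s' = r then usg r s r' s' *s B (n + m) (\<lambda>x. P i x * Q (x + of_int n)) (unit r' s) v else 0)
    + (Psi n r s (P i) m r' s' Q * c) *s pr v)))"
    using assms(4) unfolding comm_ok_def by (intro sum.cong refl arg_cong[of _ _ "scale _"])
  then show ?thesis
    unfolding comm_ok_def 1 2 3 Psi_scale_sum1 central_sum
    by (simp add: scale_right_distrib scale_right_diff_distrib sum.distrib sum_subtractf B_vsum B_vscale
        scale_sum_right scale_sum_left mult_ac)
qed

lemma comm_ok_sum2:
  assumes "finite S" "\<And>i. i \<in> S \<Longrightarrow> polyfun (Q i)" "polyfun P"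
    and "\<And>i. i \<in> S \<Longrightarrow> comm_ok n r s m r' s' v P (Q i)"
  shows "comm_ok n r s m r' s' v P (\<lambda>x. \<Sum>i\<in>S. u i * Q i x)"
proof -
  have 1: "(\<lambda>x. P (x + of_int m) * (\<Sum>i\<in>S. u i * Q i x)) = (\<lambda>x. \<Sum>i\<in>S. u i * (P (x + of_int m) * Q i x))"
    "(\<lambda>x. P x * (\<Sum>i\<in>S. u i * Q i (x + of_int n))) = (\<lambda>x. \<Sum>i\<in>S. u i * (P x * Q i (x + of_int n)))"
    by (simp_all add: sum_distrib_left mult.left_commute)
  have 2: "B (n + m) (\<lambda>x. \<Sum>i\<in>S. u i * (P (x + of_int m) * Q i x)) a v
      = (\<Sum>i\<in>S. u i *s B (n + m) (\<lambda>x. P (x + of_int m) * Q i x) a v)"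
    "B (n + m) (\<lambda>x. \<Sum>i\<in>S. u i * (P x * Q i (x + of_int n))) a v
      = (\<Sum>i\<in>S. u i *s B (n + m) (\<lambda>x. P x * Q i (x + of_int n)) a v)" for a
    using assms by (intro B_sum polyfun_mult polyfun_shift; simp)+
  have 3: "B m (\<lambda>x. \<Sum>i\<in>S. u i * Q i x) a w = (\<Sum>i\<in>S. u i *s B m (Q i) a w)" for a w
    using assms by (intro B_sum) auto
  have "(\<Sum>i\<in>S. u i *s B n P (unit r s) (B m (Q i) (unit r' s') v))
    = (\<Sum>i\<in>S. u i *s (usg r s r' s' *s B m (Q i) (unit r' s') (B n P (unit r s) v)
    + ((if s = r' then B (n + m) (\<lambda>x. P (x + of_int m) * Q i x) (unit r s') v else 0)
    - (if s' = r then usg r s r' s' *s B (n + m) (\<lambda>x. P x * Q i (x + of_int n)) (unit r' s) v else 0)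
    + (Psi n r s P m r' s' (Q i) * c) *s pr v)))"
    using assms(4) unfolding comm_ok_def by (intro sum.cong refl arg_cong[of _ _ "scale _"])
  then show ?thesis
    unfolding comm_ok_def 1 2 3 Psi_scale_sum2 central_sum
    by (simp add: scale_right_distrib scale_right_diff_distrib sum.distrib sum_subtractf B_vsum B_vscale
        scale_sum_right scale_sum_left mult_ac)
qed

lemma B_comm:
  assumes "polyfun P" "polyfun Q"
  shows "B n P (unit r s) (B m Q (unit r' s') v)
    = usg r s r' s' *s B m Q (unit r' s') (B n P (unit r s) v)
    + ((if s = r' then B (n + m) (\<lambda>x. P (x + of_int m) * Q x) (unit r s') v else 0)
    - (if s' = r then usg r s r' s' *s B (n + m) (\<lambda>x. P x * Q (x + of_int n)) (unit r' s) v else 0)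
    + (Psi n r s P m r' s' Q * c) *s pr v)"
proof -
  have P: "P = (\<lambda>x. \<Sum>p\<in>fsupp P. fcoef P p * ff x p)" and Q: "Q = (\<lambda>x. \<Sum>p\<in>fsupp Q. fcoef Q p * ff x p)"
    using newton(2) assms by blast+
  have "comm_ok n r s m r' s' v (\<lambda>x. ff x k) Q" for k
    by (subst Q, rule comm_ok_sum2) (use newton(1) assms comm_ok_ff in auto)
  then have "comm_ok n r s m r' s' v P Q"
    by (subst P, intro comm_ok_sum1) (use newton(1) assms in auto)
  then show ?thesis by (simp add: comm_ok_def)
qed

end

section \<open>Local finiteness and interpolated matrix units\<close>

text \<open>The bijection \<open>(i, r) \<mapsto> r - 2 i\<close> relabels the basis vector \<open>t\<^sup>i e\<^sub>r\<close> by an integer whose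
  parity is the parity of the vector; \<open>ix\<close> recovers the exponent \<open>i\<close>.\<close>
definition ix :: "int \<Rightarrow> int" where
  "ix h = - (h div 2)"

lemma ix_pos: "0 \<le> ix h \<longleftrightarrow> h \<le> 1"
  unfolding ix_def by linarith

lemma ix_eq: "odd h = odd k \<Longrightarrow> ix h = ix k \<longleftrightarrow> h = k"
proof -
  assume "odd h = odd k"
  then have "h mod 2 = k mod 2" by (simp add: mod_2_eq_odd)
  then show ?thesis using div_mod_decomp_int[of h 2] div_mod_decomp_int[of k 2] unfolding ix_def by force
qed

context sdmod
begin

text \<open>Equivalently, applying the symbol \<open>P\<close> in degree \<open>n\<close> to
  \<open>v\<close> depends only on the values of \<open>P\<close> at the integers from
  \<open>-N\<close> to \<open>N\<close>.\<close>

definition lfin :: "'v \<Rightarrow> int \<Rightarrow> int \<Rightarrow> bool" where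
  "lfin v n N \<longleftrightarrow> (\<forall>P a. polyfun P \<longrightarrow> (\<forall>l. \<bar>l\<bar> \<le> N \<longrightarrow> P (of_int l) = 0) \<longrightarrow> B n P a v = 0)"

lemma lfin_mono: "lfin v n N \<Longrightarrow> N \<le> N' \<Longrightarrow> lfin v n N'"
  unfolding lfin_def by (meson order_trans)

text \<open>The Newton coefficient of degree \<open>p\<close> involves only the values of
  \<open>P\<close> at \<open>0, ..., p\<close>, and the generators with \<open>p + n \<ge> 0\<close>
  kill the vacuum.\<close>

lemma B_vac:
  assumes "\<And>l. 0 \<le> l \<Longrightarrow> l < - n \<Longrightarrow> P (of_int l) = 0"
  shows "B n P a vac = 0"
proof -
  have zero: "fcoef P p *s A (J a p n) vac = 0" for p
  proof (cases "int p + n \<ge> 0")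
    case True
    then show ?thesis by (simp add: A_vac in_SP_def chi_def)
  next
    case False
    have "P (of_nat i) = 0" if "i \<le> p" for i
      using assms[of "int i"] False that by simp
    then have "fcoef P p = 0" by (simp add: fcoef_def)
    then show ?thesis by simp
  qed
  have "(\<Sum>p\<in>fsupp P. fcoef P p *s A (J a p n) vac) = 0"
    by (intro sum.neutral ballI zero)
  then show ?thesis by (simp add: B_def)
qed

lemma lfin_vac: "lfin vac n \<bar>n\<bar>"
  unfolding lfin_def by (auto intro!: B_vac)

lemma Psi_zero:
  assumes "(\<forall>l. \<bar>l\<bar> \<le> \<bar>n\<bar> \<longrightarrow> P (of_int l) = 0)"
  shows "Psi n r s P m r' s' Q = 0"
proof (cases "n + m = 0")
  case True
  then have "(\<Sum>j\<in>{-n..-1}. P (of_int j) * Q (of_int (j + n))) = 0"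
    using assms by (intro sum.neutral) auto
  moreover have "P (of_int (j + m)) = 0" if "j \<in> {-m..-1}" for j
    using assms[rule_format, of "j + m"] True that by auto
  then have "(\<Sum>j\<in>{-m..-1}. Q (of_int j) * P (of_int (j + m))) = 0"
    by (intro sum.neutral) simp
  ultimately show ?thesis by (simp add: Psi_def)
qed (simp add: Psi_def)

text \<open>Moving a symbol past a generator produces shifted products and a cocycle value; all of
  these see \<open>P\<close> only on a window enlarged by \<open>|m| + |n|\<close>.\<close>

lemma lfin_A:
  assumes "\<And>n. \<exists>N. lfin v n N"
  shows "\<exists>N. lfin (A x v) n N"
proof (cases x)
  case Cb
  then show ?thesis using assms[of n] by (auto simp: A_central lfin_def B_vscale B_pr)
next
  case (J b l m)
  obtain r' s' where b: "b = unit r' s'" by (rule unit_cases)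
  obtain N1 N2 where N: "lfin v n N1" "lfin v (n + m) N2" using assms by blast
  define N where "N = max N1 (max N2 0) + \<bar>m\<bar> + \<bar>n\<bar>"
  have "lfin (B m (\<lambda>x. ff x l) b v) n N"
    unfolding lfin_def
  proof (intro allI impI)
    fix P a assume P: "polyfun P" "\<forall>l. \<bar>l\<bar> \<le> N \<longrightarrow> P (of_int l) = 0"
    obtain r s where a: "a = unit r s" by (rule unit_cases)
    have 1: "B n P a v = 0"
      using lfin_mono[OF N(1), of N] P unfolding lfin_def N_def by auto
    have 2: "B (n + m) (\<lambda>x. P (x + of_int m) * ff x l) e v = 0"
      "B (n + m) (\<lambda>x. P x * ff (x + of_int n) l) e v = 0" for e
    proof -
      have "P (of_int i + of_int m) = 0" if "\<bar>i\<bar> \<le> N2" for i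
        using P(2)[rule_format, of "i + m"] that by (simp add: N_def)
      moreover have "P (of_int i) = 0" if "\<bar>i\<bar> \<le> N2" for i
        using P(2) that by (simp add: N_def)
      ultimately show "B (n + m) (\<lambda>x. P (x + of_int m) * ff x l) e v = 0"
        "B (n + m) (\<lambda>x. P x * ff (x + of_int n) l) e v = 0"
        using N(2)[unfolded lfin_def] P(1) polyfun_mult[OF polyfun_shift[OF P(1)]] polyfun_mult[OF P(1)] by auto
    qed
    have "Psi n r s P m r' s' (\<lambda>x. ff x l) = 0"
      using P(2) by (intro Psi_zero) (auto simp: N_def)
    then show "B n P a (B m (\<lambda>x. ff x l) b v) = 0"
      unfolding a b using B_comm[OF P(1) polyfun_ff] 1 2 by (simp add: a)
  qed
  moreover have "A (J b l m) v = (-1) *s B m (\<lambda>x. ff x l) b v" by (simp add: B_ff)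
  ultimately show ?thesis
    unfolding J by (auto simp: lfin_def B_vscale simp del: scale_minus_left)
qed

lemma lfin_ex: "\<exists>N\<ge>0. lfin v n N"
proof -
  have word: "\<forall>n. \<exists>N. lfin (foldr A w vac) n N" for w
    by (induction w) (use lfin_vac lfin_A in auto)
  have "\<forall>n. \<exists>N. lfin u n N" if "u \<in> span {foldr A w vac | w. True}" for u
    using that
  proof (induction rule: span_induct_alt)
    case base
    then show ?case by (simp add: lfin_def)
  next
    case (step a x y)
    show ?case
    proof
      fix n
      obtain N1 N2 where "lfin x n N1" "lfin y n N2" using step word by blast
      then have "lfin x n (max N1 N2)" "lfin y n (max N1 N2)"
        by (meson lfin_mono max.cobounded1 max.cobounded2)+
      then have "lfin (a *s x + y) n (max N1 N2)" by (simp add: lfin_def B_vadd B_vscale)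
      then show "\<exists>N. lfin (a *s x + y) n N" by blast
    qed
  qed
  moreover obtain u where u: "u \<in> span {foldr A w vac | w. True}" "\<And>x. A x v = A x u"
    using A_generated by blast
  ultimately have "\<forall>n. \<exists>N. lfin u n N" by blast
  then obtain N where "lfin u n N" by blast
  then have "lfin v n N" by (simp add: lfin_def B_def u(2))
  then have "lfin v n (max 0 N)" by (rule lfin_mono) simp
  then show ?thesis by (intro exI[of _ "max 0 N"]) simp
qed

definition bound :: "'v \<Rightarrow> int \<Rightarrow> int" where
  "bound v n = (SOME N. 0 \<le> N \<and> lfin v n N)"

lemma bound: "0 \<le> bound v n" "lfin v n (bound v n)"
  unfolding bound_def using someI_ex[OF lfin_ex[of v n]] by auto

text \<open>The matrix unit \<open>t\<^sup>j e\<^sub>s \<mapsto> t\<^sup>i e\<^sub>r\<close> is an infinite combination of the basis of the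
  algebra, but on a given vector it agrees with \<open>t\<^bsup>i-j\<^esup> P(D)\<close> for any polynomial \<open>P\<close> that is the
  indicator of \<open>j\<close> on a large enough interval.\<close>
definition E :: "int \<Rightarrow> int \<Rightarrow> 'v \<Rightarrow> 'v" where
  "E h k v = B (ix h - ix k) (lag (ix k) (bound v (ix h - ix k))) (unit (odd h) (odd k)) v"

text \<open>Independence of the interpolating polynomial: two choices differ by a polynomial
  vanishing on the smaller of two admissible windows.\<close>

lemma E_eq:
  assumes "polyfun P" "lfin v (ix h - ix k) N"
    and "\<And>l. \<bar>l\<bar> \<le> N \<Longrightarrow> P (of_int l) = (if l = ix k then 1 else 0)"
  shows "B (ix h - ix k) P (unit (odd h) (odd k)) v = E h k v"
proof -
  let ?n = "ix h - ix k" and ?L = "lag (ix k) (bound v (ix h - ix k))"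
  have "lfin v ?n (min N (bound v ?n))"
    using assms(2) bound(2)[of v ?n] by (simp add: min_def)
  moreover have "P (of_int l) - ?L (of_int l) = 0" if "\<bar>l\<bar> \<le> min N (bound v ?n)" for l
    using that assms(3)[of l] lag_eq[of l "bound v ?n" "ix k"] by simp
  ultimately have "B ?n (\<lambda>x. P x - ?L x) (unit (odd h) (odd k)) v = 0"
    unfolding lfin_def using assms(1) polyfun_diff[OF assms(1) polyfun_lag] by blast
  then show ?thesis using assms(1) by (simp add: B_diff E_def)
qed

lemma E_lag: "bound v (ix h - ix k) \<le> N \<Longrightarrow> B (ix h - ix k) (lag (ix k) N) (unit (odd h) (odd k)) v = E h k v"
  using lfin_mono[OF bound(2)] by (intro E_eq[where N = N]) (auto simp: lag_eq)

lemma E_vadd: "E h k (u + v) = E h k u + E h k v"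
proof -
  define N where "N = max (bound (u + v) (ix h - ix k)) (max (bound u (ix h - ix k)) (bound v (ix h - ix k)))"
  have "E h k (u + v) = B (ix h - ix k) (lag (ix k) N) (unit (odd h) (odd k)) (u + v)"
    "E h k u = B (ix h - ix k) (lag (ix k) N) (unit (odd h) (odd k)) u"
    "E h k v = B (ix h - ix k) (lag (ix k) N) (unit (odd h) (odd k)) v"
    by (rule E_lag[symmetric], simp add: N_def)+
  then show ?thesis by (simp add: B_vadd)
qed

lemma E_vscale: "E h k (a *s v) = a *s E h k v"
proof -
  define N where "N = max (bound (a *s v) (ix h - ix k)) (bound v (ix h - ix k))"
  have "E h k (a *s v) = B (ix h - ix k) (lag (ix k) N) (unit (odd h) (odd k)) (a *s v)"
    "E h k v = B (ix h - ix k) (lag (ix k) N) (unit (odd h) (odd k)) v"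
    by (rule E_lag[symmetric], simp add: N_def)+
  then show ?thesis by (simp add: B_vscale)
qed

lemma E_of_pr: "E h k (pr v) = E h k v"
proof -
  have "bound (pr v) n = bound v n" for n unfolding bound_def lfin_def B_pr ..
  then show ?thesis by (simp add: E_def B_pr)
qed

lemma E_annihilates_vac:
  assumes "\<not> create (h, k)"
  shows "E h k vac = 0"
proof -
  define N where "N = max (bound vac (ix h - ix k)) (\<bar>ix h\<bar> + \<bar>ix k\<bar>)"
  have "\<not> (ix h < 0 \<and> 0 \<le> ix k)" using assms ix_pos[of h] ix_pos[of k] by (auto simp: create_def)
  then have "lag (ix k) N (of_int l) = 0" if "0 \<le> l" "l < - (ix h - ix k)" for l
    using that by (subst lag_eq) (auto simp: N_def)
  then have "B (ix h - ix k) (lag (ix k) N) (unit (odd h) (odd k)) vac = 0"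
    by (intro B_vac)
  then show ?thesis by (subst (asm) E_lag) (simp_all add: N_def)
qed

text \<open>At most one summand of the cocycle survives, and it lies in the range of summation
  exactly if one of the two exponents is negative and the other is not.\<close>

lemma Psi_lag:
  assumes "\<bar>n\<bar> \<le> N" "\<bar>m\<bar> \<le> N" "n = ix h - ix k" "m = ix h' - ix k'"
  shows "Psi n (odd h) (odd k) (lag (ix k) N) m (odd h') (odd k') (lag (ix k') N) = coc h k h' k'"
proof (cases "n + m = 0 \<and> odd k = odd h' \<and> odd h = odd k'")
  case False
  then show ?thesis using assms by (auto simp: Psi_def coc_def)
next
  case True
  then have eq: "h = k' \<longleftrightarrow> ix h = ix k'" "k = h' \<longleftrightarrow> ix k = ix h'" "ix h = ix k' \<longleftrightarrow> ix k = ix h'"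
    using ix_eq[of h k'] ix_eq[of k h'] assms by auto
  have 1: "(\<Sum>j\<in>{-n..-1}. lag (ix k) N (of_int j) * lag (ix k') N (of_int (j + n)))
      = (if ix h = ix k' \<and> 0 \<le> ix h \<and> ix k < 0 then 1 else 0)" if "0 \<le> n"
  proof -
    have "(\<Sum>j\<in>{-n..-1}. lag (ix k) N (of_int j) * lag (ix k') N (of_int (j + n)))
        = (\<Sum>j\<in>{-n..-1}. if j = ix k then (if ix h = ix k' then 1 else 0) else 0)"
    proof (intro sum.cong refl)
      fix j assume "j \<in> {-n..-1}"
      then have "\<bar>j\<bar> \<le> N" "\<bar>j + n\<bar> \<le> N" using assms(1) that by auto
      then have "lag (ix k) N (of_int j) = (if j = ix k then 1 else 0)"
        "lag (ix k') N (of_int (j + n)) = (if j + n = ix k' then 1 else 0)"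
        by (simp_all only: lag_eq)
      then show "lag (ix k) N (of_int j) * lag (ix k') N (of_int (j + n))
          = (if j = ix k then (if ix h = ix k' then 1 else 0) else 0)"
        using assms(3) by (auto simp del: of_int_add)
    qed
    also have "\<dots> = (if ix h = ix k' \<and> 0 \<le> ix h \<and> ix k < 0 then 1 else 0)"
      using assms by (auto simp: sum.delta')
    finally show ?thesis .
  qed
  have 2: "(\<Sum>j\<in>{-m..-1}. lag (ix k') N (of_int j) * lag (ix k) N (of_int (j + m)))
      = (if ix h = ix k' \<and> 0 \<le> ix k \<and> ix h < 0 then 1 else 0)" if "\<not> 0 \<le> n"
  proof -
    have "(\<Sum>j\<in>{-m..-1}. lag (ix k') N (of_int j) * lag (ix k) N (of_int (j + m)))
        = (\<Sum>j\<in>{-m..-1}. if j = ix k' then (if ix h = ix k' then 1 else 0) else 0)"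
    proof (intro sum.cong refl)
      fix j assume "j \<in> {-m..-1}"
      then have "\<bar>j\<bar> \<le> N" "\<bar>j + m\<bar> \<le> N" using assms(2) that True by auto
      then have "lag (ix k') N (of_int j) = (if j = ix k' then 1 else 0)"
        "lag (ix k) N (of_int (j + m)) = (if j + m = ix k then 1 else 0)"
        by (simp_all only: lag_eq)
      then show "lag (ix k') N (of_int j) * lag (ix k) N (of_int (j + m))
          = (if j = ix k' then (if ix h = ix k' then 1 else 0) else 0)"
        using assms(3,4) True by (auto simp del: of_int_add)
    qed
    also have "\<dots> = (if ix h = ix k' \<and> 0 \<le> ix k \<and> ix h < 0 then 1 else 0)"
      using assms eq by (auto simp: sum.delta')
    finally show ?thesis .
  qed
  have coc: "coc h k h' k' = (if ix h = ix k' then (if odd h then -1 else 1)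
      * ((if 0 \<le> ix h then 1 else 0) - (if 0 \<le> ix k then 1 else 0)) else 0)"
    using eq by (auto simp: coc_def ix_pos)
  show ?thesis
  proof (cases "0 \<le> n")
    case n: True
    have "Psi n (odd h) (odd k) (lag (ix k) N) m (odd h') (odd k') (lag (ix k') N)
        = (if odd h then -1 else 1) * (if ix h = ix k' \<and> 0 \<le> ix h \<and> ix k < 0 then 1 else 0)"
      unfolding Psi_def 1[OF n] using True n by simp
    then show ?thesis unfolding coc using n assms(3) by (cases "0 \<le> ix h"; cases "0 \<le> ix k") simp_all
  next
    case n: False
    have "Psi n (odd h) (odd k) (lag (ix k) N) m (odd h') (odd k') (lag (ix k') N)
        = - usg (odd h) (odd k) (odd h') (odd k') * (if odd k then -1 else 1)
          * (if ix h = ix k' \<and> 0 \<le> ix k \<and> ix h < 0 then 1 else 0)"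
      unfolding Psi_def 2[OF n] using True n by simp
    moreover have "usg (odd h) (odd k) (odd h') (odd k') * (if odd k then -1 else 1) = (if odd h then -1 else 1)"
      using True by (cases "odd h"; cases "odd k") (simp_all add: usg_def)
    ultimately show ?thesis unfolding coc using n assms(3)
      by (cases "0 \<le> ix h"; cases "0 \<le> ix k") simp_all
  qed
qed

text \<open>On a window large enough for all vectors involved, a product of two shifted indicators
  is the indicator of one point if the inner indices match and zero otherwise;
  \<open>Psi_lag\<close> supplies the central term.\<close>

lemma E_comm_rel:
  "E h k (E h' k' v) = sg h k h' k' *s E h' k' (E h k v)
     + (if k = h' then E h k' v else 0) - (if h = k' then sg h k h' k' *s E h' k v else 0)
     + (coc h k h' k' * c) *s pr v"
proof -
  define n m where "n = ix h - ix k" and "m = ix h' - ix k'"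
  define N0 where "N0 = bound v (n + m)"
  \<comment> \<open>The last entry leaves room for the shifts by \<open>n\<close> and
    \<open>m\<close> around the window \<open>N0\<close>.\<close>
  define N where "N = Max {bound (E h' k' v) n, bound v m, bound (E h k v) m, bound v n, N0 + \<bar>n\<bar> + \<bar>m\<bar>}"
  have "\<forall>x\<in>{bound (E h' k' v) n, bound v m, bound (E h k v) m, bound v n, N0 + \<bar>n\<bar> + \<bar>m\<bar>}. x \<le> N"
    unfolding N_def by (intro ballI Max_ge) auto
  then have N: "bound (E h' k' v) n \<le> N" "bound v m \<le> N" "bound (E h k v) m \<le> N" "bound v n \<le> N"
    "N0 + \<bar>n\<bar> + \<bar>m\<bar> \<le> N" by auto
  have N0: "0 \<le> N0" "lfin v (n + m) N0" unfolding N0_def by (rule bound)+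
  define P Q where "P = lag (ix k) N" and "Q = lag (ix k') N"
  have poly: "polyfun P" "polyfun Q" by (simp_all add: P_def Q_def)
  let ?a = "unit (odd h) (odd k)" and ?b = "unit (odd h') (odd k')"
  have E: "E h k (E h' k' v) = B n P ?a (B m Q ?b v)" "E h' k' (E h k v) = B m Q ?b (B n P ?a v)"
  proof -
    have 1: "B n (lag (ix k) N) ?a w = E h k w" if "bound w n \<le> N" for w
      using E_lag[of w h k N] that by (simp add: n_def)
    have 2: "B m (lag (ix k') N) ?b w = E h' k' w" if "bound w m \<le> N" for w
      using E_lag[of w h' k' N] that by (simp add: m_def)
    show "E h k (E h' k' v) = B n P ?a (B m Q ?b v)" "E h' k' (E h k v) = B m Q ?b (B n P ?a v)"
      by (simp_all only: P_def Q_def 1 2 N)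
  qed
  have PQ: "P (of_int x + of_int m) * Q (of_int x) = (if x + m = ix k \<and> x = ix k' then 1 else 0)"
    "P (of_int x) * Q (of_int x + of_int n) = (if x = ix k \<and> x + n = ix k' then 1 else 0)" if "\<bar>x\<bar> \<le> N0" for x
    using that N(5) lag_eq[of "x + m" N "ix k"] lag_eq[of x N "ix k'"] lag_eq[of x N "ix k"] lag_eq[of "x + n" N "ix k'"]
    by (auto simp: P_def Q_def)
  have poly2: "polyfun (\<lambda>x. P (x + of_int m) * Q x)" "polyfun (\<lambda>x. P x * Q (x + of_int n))"
    using poly by (simp_all add: polyfun_mult polyfun_shift)
  have 1: "(if odd k = odd h' then B (n + m) (\<lambda>x. P (x + of_int m) * Q x) (unit (odd h) (odd k')) v else 0)
      = (if k = h' then E h k' v else 0)"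
  proof (cases "odd k = odd h' \<and> ix k = ix h'")
    case True
    then have "k = h'" using ix_eq by blast
    have nm: "n + m = ix h - ix k'" using True by (simp add: n_def m_def)
    have "B (ix h - ix k') (\<lambda>x. P (x + of_int m) * Q x) (unit (odd h) (odd k')) v = E h k' v"
      using N0 PQ(1) poly2 True unfolding nm by (intro E_eq[where N = N0]) (auto simp: m_def)
    then show ?thesis using \<open>k = h'\<close> nm by simp
  next
    case False
    have "odd k = odd h' \<Longrightarrow> B (n + m) (\<lambda>x. P (x + of_int m) * Q x) (unit (odd h) (odd k')) v = 0"
      using N0(2) PQ(1) poly2 False unfolding lfin_def by (auto simp: m_def)
    then show ?thesis using False by auto
  qed
  have 2: "(if odd k' = odd h then usg (odd h) (odd k) (odd h') (odd k') *s
        B (n + m) (\<lambda>x. P x * Q (x + of_int n)) (unit (odd h') (odd k)) v else 0)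
      = (if h = k' then sg h k h' k' *s E h' k v else 0)"
  proof (cases "odd k' = odd h \<and> ix k' = ix h")
    case True
    then have "h = k'" using ix_eq[of k' h] by blast
    have nm: "n + m = ix h' - ix k" using True by (simp add: n_def m_def)
    have "B (ix h' - ix k) (\<lambda>x. P x * Q (x + of_int n)) (unit (odd h') (odd k)) v = E h' k v"
      using N0 PQ(2) poly2 True unfolding nm by (intro E_eq[where N = N0]) (auto simp: n_def)
    then show ?thesis using \<open>h = k'\<close> nm by (auto simp: usg_def sg_def)
  next
    case False
    have "odd k' = odd h \<Longrightarrow> B (n + m) (\<lambda>x. P x * Q (x + of_int n)) (unit (odd h') (odd k)) v = 0"
      using N0(2) PQ(2) poly2 False unfolding lfin_def by (auto simp: n_def)
    then show ?thesis using False by auto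
  qed
  have 3: "Psi n (odd h) (odd k) P m (odd h') (odd k') Q = coc h k h' k'"
    unfolding P_def Q_def using N(5) N0(1) by (intro Psi_lag) (auto simp: n_def m_def)
  have sg: "usg (odd h) (odd k) (odd h') (odd k') = sg h k h' k'"
    by (auto simp: usg_def sg_def)
  show ?thesis
    unfolding E B_comm[OF poly, of n "odd h" "odd k" m "odd h'" "odd k'" v] 1 2 3
    unfolding sg by simp
qed

sublocale glmod scale pr E vac c
proof
  show "pr (u + v) = pr u + pr v" for u v by (rule pr_add)
  show "pr (a *s v) = a *s pr v" for a v by (rule pr_scale)
  show "pr (pr v) = pr v" for v by (rule pr_idem)
  show "pr (E h k v) = E h k v" for h k v unfolding E_def by (rule pr_B)
  show "E h k (pr v) = E h k v" for h k v by (rule E_of_pr)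
  show "pr vac = vac" by (rule pr_vac)
  show "E h k (u + v) = E h k u + E h k v" for h k u v by (rule E_vadd)
  show "E h k (a *s v) = a *s E h k v" for h k a v by (rule E_vscale)
  show "E h k (E l m v) = sg h k l m *s E l m (E h k v)
      + (if k = l then E h m v else 0) - (if h = m then sg h k l m *s E l k v else 0)
      + (coc h k l m * c) *s pr v" for h k l m v by (rule E_comm_rel)
  show "E h k vac = 0" if "\<not> create (h, k)" for h k using that by (rule E_annihilates_vac)
qed

text \<open>The way back: on a fixed vector a polynomial symbol is a finite combination of
  indicators, so subspaces stable under matrix units are stable under the algebra.\<close>

lemma B_via_E:
  assumes "polyfun P" "bound v n \<le> N"
  shows "B n P (unit r s) v
    = (\<Sum>j\<in>{-N..N}. P (of_int j) *s E (of_bool r - 2 * (j + n)) (of_bool s - 2 * j) v)"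
proof -
  have ix: "ix (of_bool r - 2 * i) = i" "odd (of_bool r - 2 * i :: int) = r" for r i
    by (auto simp: ix_def)
  define Q where "Q = (\<lambda>x. \<Sum>j\<in>{-N..N}. P (of_int j) * lag j N x)"
  have Q: "polyfun Q" unfolding Q_def by (intro polyfun_sum polyfun_mult) auto
  have "P (of_int l) - Q (of_int l) = 0" if "\<bar>l\<bar> \<le> N" for l
  proof -
    have "Q (of_int l) = (\<Sum>j\<in>{-N..N}. if j = l then P (of_int j) else 0)"
      unfolding Q_def using that by (intro sum.cong refl) (auto simp: lag_eq)
    moreover have "l \<in> {-N..N}" using that by auto
    ultimately show ?thesis by simp
  qed
  moreover have "lfin v n N" using bound(2) assms(2) by (rule lfin_mono)
  ultimately have "B n (\<lambda>x. P x - Q x) (unit r s) v = 0"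
    unfolding lfin_def using polyfun_diff[OF assms(1) Q] by blast
  then have "B n P (unit r s) v = B n Q (unit r s) v" using assms(1) Q by (simp add: B_diff)
  also have "\<dots> = (\<Sum>j\<in>{-N..N}. P (of_int j) *s B n (lag j N) (unit r s) v)"
    unfolding Q_def by (intro B_sum) auto
  also have "\<dots> = (\<Sum>j\<in>{-N..N}. P (of_int j) *s E (of_bool r - 2 * (j + n)) (of_bool s - 2 * j) v)"
  proof (intro sum.cong refl arg_cong[of _ _ "scale _"])
    fix j
    show "B n (lag j N) (unit r s) v = E (of_bool r - 2 * (j + n)) (of_bool s - 2 * j) v"
      using E_lag[of v "of_bool r - 2 * (j + n)" "of_bool s - 2 * j" N] assms(2) unfolding ix by simp
  qed
  finally show ?thesis .
qed

lemma stable_iff_A: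
  assumes "\<And>v. v \<in> W \<Longrightarrow> pr v = v"
  shows "stable W \<longleftrightarrow> subspace W \<and> (\<forall>v\<in>W. \<forall>x. A x v \<in> W)"
proof
  assume W: "stable W"
  have "A x v \<in> W" if "v \<in> W" for x v
  proof (cases x)
    case Cb
    then show ?thesis using W that by (simp add: A_central stable_def subspace_scale assms)
  next
    case (J a k n)
    obtain r s where "a = unit r s" by (rule unit_cases)
    then have "B n (\<lambda>x. ff x k) a v \<in> W"
      using B_via_E[where P = "\<lambda>x. ff x k" and v = v and n = n and r = r and s = s, OF polyfun_ff order_refl] W that
      by (auto simp: stable_def intro!: subspace_sum subspace_scale)
    with stable_subspace[OF W] have "- B n (\<lambda>x. ff x k) a v \<in> W" by (rule subspace_neg)
    then show ?thesis using J by (simp add: B_ff)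
  qed
  then show "subspace W \<and> (\<forall>v\<in>W. \<forall>x. A x v \<in> W)" using W by (simp add: stable_def)
next
  assume W: "subspace W \<and> (\<forall>v\<in>W. \<forall>x. A x v \<in> W)"
  then have "E h k v \<in> W" if "v \<in> W" for h k v
    unfolding E_def B_def using that by (auto intro!: subspace_neg subspace_sum subspace_scale)
  then show "stable W" using W by (simp add: stable_def)
qed

end

section \<open>Fock spaces\<close>

definition fscale :: "complex \<Rightarrow> ('a \<Rightarrow> complex) \<Rightarrow> 'a \<Rightarrow> complex" where
  "fscale a f = (\<lambda>x. a * f x)"

lemma fscale_apply [simp]: "fscale a f x = a * f x"
  by (simp add: fscale_def)

lemma vector_space_fscale: "vector_space fscale"
  by unfold_locales (auto simp: fscale_def fun_eq_iff algebra_simps)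

lemma sum_fun_apply: "(\<Sum>i\<in>S. f i) x = (\<Sum>i\<in>S. f i x)" for f :: "'i \<Rightarrow> 'a \<Rightarrow> complex"
  by (induction S rule: infinite_finite_induct) auto

text \<open>Oscillators on coefficient functions of occupation states; \<open>F\<close> selects the fermionic modes,
  whose signs follow Jordan and Wigner.\<close>
definition jw :: "(nat \<Rightarrow> bool) \<Rightarrow> nat \<Rightarrow> nat multiset \<Rightarrow> complex" where
  "jw F i X = (-1) ^ size (filter_mset (\<lambda>j. j < i \<and> F j) X)"

text \<open>Multiplicities of a fermionic mode are not restricted to 0 and 1: \<open>2 m\<close> and
  \<open>2 m + 1\<close> are the empty and the occupied level of a two-level system. The relations
  therefore hold for all coefficient functions.\<close>

definition cr :: "(nat \<Rightarrow> bool) \<Rightarrow> nat \<Rightarrow> (nat multiset \<Rightarrow> complex) \<Rightarrow> nat multiset \<Rightarrow> complex" where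
  "cr F i f X = (if F i then if odd (count X i) then jw F i X * f (X - {#i#}) else 0
     else if 0 < count X i then f (X - {#i#}) else 0)"

definition an :: "(nat \<Rightarrow> bool) \<Rightarrow> nat \<Rightarrow> (nat multiset \<Rightarrow> complex) \<Rightarrow> nat multiset \<Rightarrow> complex" where
  "an F i f X = (if F i then if even (count X i) then jw F i X * f (X + {#i#}) else 0
     else of_nat (Suc (count X i)) * f (X + {#i#}))"

definition psg :: "(nat \<Rightarrow> bool) \<Rightarrow> nat \<Rightarrow> nat \<Rightarrow> complex" where
  "psg F i j = (if F i \<and> F j then -1 else 1)"

lemma jw_add_mset: "jw F i (add_mset j X) = (if j < i \<and> F j then - jw F i X else jw F i X)"
  by (simp add: jw_def)

lemma jw_minus: "0 < count X j \<Longrightarrow> jw F i (X - {#j#}) = (if j < i \<and> F j then - jw F i X else jw F i X)"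
proof -
  assume "0 < count X j"
  then obtain Y where X: "X = add_mset j Y" by (metis count_greater_zero_iff insert_DiffM)
  show ?thesis unfolding X by (simp add: jw_add_mset)
qed

lemma jw_sq [simp]: "jw F i X * jw F i X = 1"
  by (simp add: jw_def flip: power_mult_distrib)

lemma jw_sq' [simp]: "jw F i X * (jw F i X * z) = z"
  by (simp add: mult.assoc[symmetric])

lemma minus_single_swap: "X - {#i#} - {#j#} = X - {#j#} - {#i#}" for X :: "'a multiset"
  by (metis diff_diff_add_mset add.commute)

lemma add_single_minus: "i \<noteq> j \<Longrightarrow> X - {#j#} + {#i#} = X + {#i#} - {#j#}" for X :: "'a multiset"
  by (rule multiset_eqI) auto

lemma odd_pos_nat: "odd (k::nat) \<Longrightarrow> 0 < k"
  by (cases k) auto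

lemma jw_minus_odd: "odd (count X j) \<Longrightarrow> jw F i (X - {#j#}) = (if j < i \<and> F j then - jw F i X else jw F i X)"
  by (rule jw_minus) (rule odd_pos_nat)

lemma cr_cr: "cr F i (cr F j f) = fscale (psg F i j) (cr F j (cr F i f))"
proof (cases "i = j")
  case True
  then show ?thesis by (auto simp: fun_eq_iff cr_def psg_def)
next
  case False
  show ?thesis
  proof
    fix X
    have c: "count (X - {#i#}) j = count X j" "count (X - {#j#}) i = count X i" using False by auto
    show "cr F i (cr F j f) X = fscale (psg F i j) (cr F j (cr F i f)) X"
      using False
      unfolding cr_def fscale_apply psg_def c minus_single_swap[of X i j]
      by (cases "F i"; cases "F j"; cases "i < j"; cases "odd (count X i)"; cases "odd (count X j)")
        (simp_all add: jw_minus jw_minus_odd)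
  qed
qed

lemma an_an: "an F i (an F j f) = fscale (psg F i j) (an F j (an F i f))"
proof (cases "i = j")
  case True
  then show ?thesis by (auto simp: fun_eq_iff an_def psg_def)
next
  case False
  show ?thesis
  proof
    fix X
    have c: "count (X + {#i#}) j = count X j" "count (X + {#j#}) i = count X i" using False by auto
    have s: "X + {#i#} + {#j#} = X + {#j#} + {#i#}" by simp
    show "an F i (an F j f) X = fscale (psg F i j) (an F j (an F i f)) X"
      using False
      unfolding an_def fscale_apply psg_def c s
      by (cases "F i"; cases "F j"; cases "i < j"; cases "even (count X i)"; cases "even (count X j)")
        (simp_all add: jw_add_mset mult_ac del: of_nat_Suc)
  qed
qed

lemma an_cr: "an F i (cr F j f) = fscale (psg F i j) (cr F j (an F i f)) + (if i = j then f else 0)"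
proof (cases "i = j")
  case True
  show ?thesis
  proof
    fix X
    show "an F i (cr F j f) X = (fscale (psg F i j) (cr F j (an F i f)) + (if i = j then f else 0)) X"
    proof (cases "count X j")
      case 0
      then show ?thesis using True by (simp add: an_def cr_def psg_def jw_add_mset)
    next
      case (Suc m)
      then obtain Y where X: "X = add_mset j Y" by (metis count_inI insert_DiffM nat.distinct(1))
      show ?thesis unfolding X using True
        by (cases "F j"; cases "even (count Y j)") (simp_all add: an_def cr_def psg_def jw_add_mset algebra_simps)
    qed
  qed
next
  case False
  show ?thesis
  proof
    fix X
    have c: "count (X + {#i#}) j = count X j" "count (X - {#j#}) i = count X i" using False by auto
    show "an F i (cr F j f) X = (fscale (psg F i j) (cr F j (an F i f)) + (if i = j then f else 0)) X"
      using False
      unfolding an_def cr_def plus_fun_apply fscale_apply psg_def c add_single_minus[OF False]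
      by (cases "F i"; cases "F j"; cases "i < j"; cases "even (count X i)"; cases "even (count X j)";
          cases "0 < count X j")
        (simp_all add: jw_add_mset jw_minus jw_minus_odd not_in_iff mult_ac del: of_nat_Suc)
  qed
qed

section \<open>The oscillator module of central charge n\<close>

definition mode :: "nat \<Rightarrow> int \<Rightarrow> nat" where
  "mode s h = prod_encode (s, int_encode h)"

lemma mode_inject [simp]: "mode s h = mode t k \<longleftrightarrow> s = t \<and> h = k"
  by (simp add: mode_def inj_eq[OF inj_int_encode])

text \<open>Copy \<open>0\<close> has the opposite statistics and contributes \<open>-1\<close> to the central charge,
  every other copy contributes \<open>1\<close>.\<close>
definition ferm :: "nat \<Rightarrow> bool" where
  "ferm i = (case prod_decode i of (s, a) \<Rightarrow> if s = 0 then odd (int_decode a) else even (int_decode a))"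

lemma ferm_mode: "ferm (mode s h) \<longleftrightarrow> (if s = 0 then odd h else even h)"
  by (simp add: ferm_def mode_def)

type_synonym fock = "nat multiset \<Rightarrow> complex"

text \<open>Dirac sea: for labels at most 1 creation and annihilation are exchanged, so that the
  matrix units with \<open>create\<close> consist of two creations.\<close>

definition cre :: "nat \<Rightarrow> int \<Rightarrow> fock \<Rightarrow> fock" where
  "cre s h = (if 2 \<le> h then cr ferm (mode s h) else an ferm (mode s h))"

text \<open>The sign at exchanged bosonic modes makes the contraction in \<open>des_cre\<close>
  equal to +1 for all labels.\<close>

definition des :: "nat \<Rightarrow> int \<Rightarrow> fock \<Rightarrow> fock" where
  "des s h f = (if 2 \<le> h then an ferm (mode s h) f
     else fscale (if ferm (mode s h) then 1 else -1) (cr ferm (mode s h) f))"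

definition msg :: "nat \<Rightarrow> int \<Rightarrow> nat \<Rightarrow> int \<Rightarrow> complex" where
  "msg s h t k = psg ferm (mode s h) (mode t k)"

lemma cr_add: "cr F i (f + g) = cr F i f + cr F i g"
  and an_add: "an F i (f + g) = an F i f + an F i g"
  by (auto simp: fun_eq_iff cr_def an_def algebra_simps)

lemma cr_scale: "cr F i (fscale a f) = fscale a (cr F i f)"
  and an_scale: "an F i (fscale a f) = fscale a (an F i f)"
  by (auto simp: fun_eq_iff cr_def an_def)

interpretation fs: vector_space "fscale :: complex \<Rightarrow> ('a \<Rightarrow> complex) \<Rightarrow> 'a \<Rightarrow> complex"
  by (rule vector_space_fscale)

lemma cre_add: "cre s h (f + g) = cre s h f + cre s h g"
  and cre_scale: "cre s h (fscale a f) = fscale a (cre s h f)"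
  by (simp_all add: cre_def cr_add an_add cr_scale an_scale)

lemma des_add: "des s h (f + g) = des s h f + des s h g"
  and des_scale: "des s h (fscale a f) = fscale a (des s h f)"
  by (simp_all add: des_def cr_add an_add cr_scale an_scale fs.scale_right_distrib mult.commute)

lemma zero_if_scale0: "f 0 = (0 :: 'a \<Rightarrow> complex)" if "\<And>a g. f (fscale a g) = fscale a (f g)"
  for f :: "('b \<Rightarrow> complex) \<Rightarrow> 'a \<Rightarrow> complex"
  using that[of 0 0] by simp

lemma cre_zero [simp]: "cre s h 0 = 0"
  by (rule zero_if_scale0) (rule cre_scale)

lemma des_zero [simp]: "des s h 0 = 0"
  by (rule zero_if_scale0) (rule des_scale)

lemma an_cr_ne: "i \<noteq> j \<Longrightarrow> an F i (cr F j f) = fscale (psg F i j) (cr F j (an F i f))"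
  by (simp add: an_cr)

lemma psg_sym: "psg F j i = psg F i j" and psg_sq [simp]: "psg F i j * psg F i j = 1"
  by (auto simp: psg_def)

lemma cr_an_ne: "i \<noteq> j \<Longrightarrow> cr F j (an F i f) = fscale (psg F i j) (an F i (cr F j f))"
  by (simp add: an_cr)

lemma cre_high: "2 \<le> h \<Longrightarrow> cre s h f = cr ferm (mode s h) f"
  and cre_low: "\<not> 2 \<le> h \<Longrightarrow> cre s h f = an ferm (mode s h) f"
  and des_high: "2 \<le> h \<Longrightarrow> des s h f = an ferm (mode s h) f"
  and des_low: "\<not> 2 \<le> h \<Longrightarrow> des s h f = fscale (if ferm (mode s h) then 1 else -1) (cr ferm (mode s h) f)"
  by (simp_all add: cre_def des_def)

lemma cre_cre: "cre s h (cre t k f) = fscale (msg s h t k) (cre t k (cre s h f))"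
proof -
  consider "2 \<le> h" "2 \<le> k" | "2 \<le> h" "\<not> 2 \<le> k" | "\<not> 2 \<le> h" "2 \<le> k" | "\<not> 2 \<le> h" "\<not> 2 \<le> k" by blast
  then show ?thesis
  proof cases
    case 1
    show ?thesis unfolding cre_high[OF 1(1)] cre_high[OF 1(2)] msg_def by (rule cr_cr)
  next
    case 2
    have ne: "mode t k \<noteq> mode s h" using 2 by auto
    show ?thesis unfolding cre_high[OF 2(1)] cre_low[OF 2(2)] msg_def psg_sym[of ferm "mode s h" "mode t k"]
      by (rule cr_an_ne[OF ne])
  next
    case 3
    have ne: "mode s h \<noteq> mode t k" using 3 by auto
    show ?thesis unfolding cre_low[OF 3(1)] cre_high[OF 3(2)] msg_def by (rule an_cr_ne[OF ne])
  next
    case 4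
    show ?thesis unfolding cre_low[OF 4(1)] cre_low[OF 4(2)] msg_def by (rule an_an)
  qed
qed

lemma des_des: "des s h (des t k f) = fscale (msg s h t k) (des t k (des s h f))"
proof -
  consider "2 \<le> h" "2 \<le> k" | "2 \<le> h" "\<not> 2 \<le> k" | "\<not> 2 \<le> h" "2 \<le> k" | "\<not> 2 \<le> h" "\<not> 2 \<le> k" by blast
  then show ?thesis
  proof cases
    case 1
    show ?thesis unfolding des_high[OF 1(1)] des_high[OF 1(2)] msg_def by (rule an_an)
  next
    case 2
    have ne: "mode s h \<noteq> mode t k" using 2 by auto
    show ?thesis unfolding des_high[OF 2(1)] des_low[OF 2(2)] msg_def an_scale an_cr_ne[OF ne]
      by (rule fs.scale_left_commute)
  next
    case 3
    have ne: "mode t k \<noteq> mode s h" using 3 by auto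
    show ?thesis unfolding des_low[OF 3(1)] des_high[OF 3(2)] msg_def an_scale cr_an_ne[OF ne]
        psg_sym[of ferm "mode s h" "mode t k"]
      by (rule fs.scale_left_commute)
  next
    case 4
    show ?thesis unfolding des_low[OF 4(1)] des_low[OF 4(2)] msg_def cr_scale
        cr_cr[of ferm "mode s h" "mode t k" f]
      by (simp only: fs.scale_scale mult_ac)
  qed
qed

lemma des_cre: "des s h (cre t k f) = fscale (msg s h t k) (cre t k (des s h f)) + (if s = t \<and> h = k then f else 0)"
proof -
  let ?i = "mode s h" and ?j = "mode t k" and ?e = "if ferm (mode s h) then 1 else -1 :: complex"
  have \<delta>: "(if ?i = ?j then f else 0) = (if s = t \<and> h = k then f else 0)" by simp
  consider "2 \<le> h" "2 \<le> k" | "2 \<le> h" "\<not> 2 \<le> k" | "\<not> 2 \<le> h" "2 \<le> k" | "\<not> 2 \<le> h" "\<not> 2 \<le> k" by blast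
  then show ?thesis
  proof cases
    case 1
    show ?thesis using an_cr[of ferm ?i ?j f]
      unfolding des_high[OF 1(1)] cre_high[OF 1(2)] msg_def \<delta> .
  next
    case 2
    have z: "(if s = t \<and> h = k then f else 0) = 0" using 2 by auto
    show ?thesis unfolding des_high[OF 2(1)] cre_low[OF 2(2)] msg_def z add_0_right by (rule an_an)
  next
    case 3
    have z: "(if s = t \<and> h = k then f else 0) = 0" using 3 by auto
    show ?thesis unfolding des_low[OF 3(1)] cre_high[OF 3(2)] msg_def z add_0_right cr_scale
        cr_cr[of ferm ?i ?j f]
      by (rule fs.scale_left_commute)
  next
    case 4
    \<comment> \<open>With both modes exchanged, the relation is \<open>an_cr\<close> read from
      right to left; the factor \<open>?e\<close> turns the contraction into \<open>f\<close>
      again.\<close>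
    have "an ferm ?j (cr ferm ?i f) = fscale (psg ferm ?i ?j) (cr ferm ?i (an ferm ?j f)) + (if ?i = ?j then f else 0)"
      unfolding an_cr[of ferm ?j ?i f] psg_sym[of ferm ?j ?i] by auto
    then have "fscale (psg ferm ?i ?j) (fscale ?e (an ferm ?j (cr ferm ?i f)))
      = fscale ?e (cr ferm ?i (an ferm ?j f)) + (if ?i = ?j then fscale (psg ferm ?i ?i * ?e) f else 0)"
      by (cases "s = t"; cases "h = k"; cases "ferm ?i"; cases "ferm ?j") (simp_all add: fun_eq_iff psg_def)
    moreover have neg: "fscale (psg ferm ?i ?i * ?e) f = - f" by (simp add: psg_def fun_eq_iff)
    moreover have "L = R + (if b then - f else 0) \<Longrightarrow> R = L + (if b then f else 0)" for L R :: fock and b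
      by auto
    ultimately have "fscale ?e (cr ferm ?i (an ferm ?j f))
        = fscale (psg ferm ?i ?j) (fscale ?e (an ferm ?j (cr ferm ?i f))) + (if ?i = ?j then f else 0)"
      unfolding neg by blast
    then show ?thesis unfolding des_low[OF 4(1)] cre_low[OF 4(2)] msg_def an_scale \<delta> .
  qed
qed

text \<open>The product of the four crossing signs is \<open>sg\<close>: the bilinear of
  \<open>cre s h\<close> and \<open>des s k\<close> has the parity of \<open>h + k\<close> in every
  copy, whatever its statistics.\<close>

lemma msg_signs:
  "msg s k t l * msg s h t l * msg s k t m = sg h k l m * msg t m s h"
  by (cases "s = 0"; cases "t = 0"; cases "even h"; cases "even k"; cases "even l"; cases "even m")
    (simp_all add: msg_def psg_def ferm_mode sg_def)

lemma quadratic_comm: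
  "cre s h (des s k (cre t l (des t m f))) = fscale (sg h k l m) (cre t l (des t m (cre s h (des s k f))))
    + (if s = t then (if k = l then cre s h (des s m f) else 0)
        - (if h = m then fscale (sg h k l m) (cre s l (des s k f)) else 0) else 0)"
proof -
  \<comment> \<open>The quartic term in a common order: both products reduce to it, with signs
    related by \<open>msg_signs\<close>.\<close>
  define Q where "Q = cre t l (cre s h (des t m (des s k f)))"
  have "cre s h (des s k (cre t l (des t m f)))
      = fscale (msg s k t l * msg s h t l * msg s k t m) Q + (if s = t \<and> k = l then cre s h (des s m f) else 0)"
    unfolding des_cre[of s k t l] cre_add cre_scale cre_cre[of s h t l] des_des[of s k t m]
    by (auto simp: Q_def)
  moreover have "cre t l (des t m (cre s h (des s k f)))
      = fscale (msg t m s h) Q + (if s = t \<and> h = m then cre s l (des s k f) else 0)"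
    unfolding des_cre[of t m s h] cre_add cre_scale by (auto simp: Q_def)
  ultimately show ?thesis
    unfolding msg_signs
    by (cases "s = t"; cases "k = l"; cases "h = m") (simp_all add: fs.scale_right_distrib)
qed

text \<open>Normal ordering constant: the eigenvalue of the unordered bilinears on the vacuum,
  summed over the copies. Subtracting it creates the central term.\<close>

definition kap :: "nat \<Rightarrow> int \<Rightarrow> int \<Rightarrow> complex" where
  "kap n h k = (if h = k \<and> h \<le> 1 then (if even h then 1 else -1) * of_nat n else 0)"

text \<open>One copy of charge -1 and \<open>n + 1\<close> of charge 1. The reversed copy supplies
  bosonic modes of even label, on which \<open>fock_Zv_nonzero\<close> relies.\<close>

definition copies :: "nat \<Rightarrow> nat set" where
  "copies n = {..Suc n}"

lemma finite_copies [simp]: "finite (copies n)"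
  by (simp add: copies_def)

definition Ef :: "nat \<Rightarrow> int \<Rightarrow> int \<Rightarrow> fock \<Rightarrow> fock" where
  "Ef n h k f = (\<Sum>s\<in>copies n. cre s h (des s k f)) - fscale (kap n h k) f"

lemma cre_sum: "cre s h (\<Sum>i\<in>S. f i) = (\<Sum>i\<in>S. cre s h (f i))"
  by (induction S rule: infinite_finite_induct) (simp_all only: sum.infinite sum.empty sum.insert cre_zero cre_add not_False_eq_True)

lemma des_sum: "des s h (\<Sum>i\<in>S. f i) = (\<Sum>i\<in>S. des s h (f i))"
  by (induction S rule: infinite_finite_induct) (simp_all only: sum.infinite sum.empty sum.insert des_zero des_add not_False_eq_True)

definition Eq :: "nat \<Rightarrow> int \<Rightarrow> int \<Rightarrow> fock \<Rightarrow> fock" where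
  "Eq n h k f = (\<Sum>s\<in>copies n. cre s h (des s k f))"

lemma Eq_add: "Eq n h k (f + g) = Eq n h k f + Eq n h k g"
  by (simp add: Eq_def des_add cre_add sum.distrib)

lemma Eq_scale: "Eq n h k (fscale a f) = fscale a (Eq n h k f)"
  by (simp add: Eq_def des_scale cre_scale fs.scale_sum_right)

lemma Eq_comm:
  "Eq n h k (Eq n l m f) = fscale (sg h k l m) (Eq n l m (Eq n h k f))
    + ((if k = l then Eq n h m f else 0) - (if h = m then fscale (sg h k l m) (Eq n l k f) else 0))"
proof -
  have "Eq n h k (Eq n l m f) = (\<Sum>s\<in>copies n. \<Sum>t\<in>copies n. cre s h (des s k (cre t l (des t m f))))"
    by (simp add: Eq_def des_sum cre_sum)
  also have "\<dots> = (\<Sum>s\<in>copies n. \<Sum>t\<in>copies n. fscale (sg h k l m) (cre t l (des t m (cre s h (des s k f)))))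
    + (\<Sum>s\<in>copies n. \<Sum>t\<in>copies n. (if s = t then (if k = l then cre s h (des s m f) else 0)
        - (if h = m then fscale (sg h k l m) (cre s l (des s k f)) else 0) else 0))"
    by (subst quadratic_comm) (simp only: sum.distrib)
  also have "(\<Sum>s\<in>copies n. \<Sum>t\<in>copies n. fscale (sg h k l m) (cre t l (des t m (cre s h (des s k f)))))
      = fscale (sg h k l m) (Eq n l m (Eq n h k f))"
    by (subst sum.swap) (simp only: Eq_def des_sum cre_sum fs.scale_sum_right)
  also have "(\<Sum>s\<in>copies n. \<Sum>t\<in>copies n. (if s = t then (if k = l then cre s h (des s m f) else 0)
        - (if h = m then fscale (sg h k l m) (cre s l (des s k f)) else 0) else 0))
      = (\<Sum>s\<in>copies n. (if k = l then cre s h (des s m f) else 0)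
        - (if h = m then fscale (sg h k l m) (cre s l (des s k f)) else 0))"
    by (intro sum.cong refl) (simp add: sum.delta)
  also have "\<dots> = (if k = l then Eq n h m f else 0) - (if h = m then fscale (sg h k l m) (Eq n l k f) else 0)"
    by (simp add: sum_subtractf Eq_def fs.scale_sum_right)
  finally show ?thesis .
qed

lemma Ef_Eq: "Ef n h k f = Eq n h k f + fscale (- kap n h k) f"
  by (simp add: Ef_def Eq_def)

text \<open>The constants drop out of the bracket of \<open>Eq\<close>, because they vanish on odd
  operators. Rewriting its right-hand side through \<open>Ef\<close> brings in the constants of
  \<open>E h m\<close> and \<open>E l k\<close>, which add up to the cocycle.\<close>

lemma Ef_comm:
  "Ef n h k (Ef n l m f) = fscale (sg h k l m) (Ef n l m (Ef n h k f))
     + (if k = l then Ef n h m f else 0) - (if h = m then fscale (sg h k l m) (Ef n l k f) else 0)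
     + fscale (coc h k l m * of_nat n) f"
proof -
  have k: "(1 - sg h k l m) * kap n h k = 0" "(1 - sg h k l m) * kap n l m = 0"
    by (auto simp: sg_def kap_def)
  have k': "kap n h k = sg h k l m * kap n h k" "kap n l m = sg h k l m * kap n l m"
    using k by (simp_all add: algebra_simps)
  have coc: "(if k = l then kap n h m else 0) - (if h = m then sg h k l m * kap n l k else 0) = coc h k l m * of_nat n"
    by (auto simp: kap_def coc_def sg_def)
  have 1: "Ef n h k (Ef n l m f) = Eq n h k (Eq n l m f) + fscale (- kap n l m) (Eq n h k f)
      + fscale (- kap n h k) (Eq n l m f) + fscale (kap n h k * kap n l m) f"
    by (simp add: Ef_Eq Eq_add Eq_scale fs.scale_right_distrib fs.scale_right_diff_distrib del: fs.scale_minus_left)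
  have 2: "Ef n l m (Ef n h k f) = Eq n l m (Eq n h k f) + fscale (- kap n h k) (Eq n l m f)
      + fscale (- kap n l m) (Eq n h k f) + fscale (kap n h k * kap n l m) f"
    by (simp add: Ef_Eq Eq_add Eq_scale fs.scale_right_distrib fs.scale_right_diff_distrib mult.commute
        del: fs.scale_minus_left)
  have 3: "fscale (sg h k l m) (Ef n l m (Ef n h k f)) = fscale (sg h k l m) (Eq n l m (Eq n h k f))
      + fscale (- kap n h k) (Eq n l m f) + fscale (- kap n l m) (Eq n h k f) + fscale (kap n h k * kap n l m) f"
  proof -
    have "sg h k l m * - kap n h k = - kap n h k" "sg h k l m * - kap n l m = - kap n l m"
      "sg h k l m * (kap n h k * kap n l m) = kap n h k * kap n l m"
      using k' by (auto simp flip: mult.assoc)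
    then show ?thesis
      unfolding 2 fs.scale_right_distrib fs.scale_scale by presburger
  qed
  have 4: "(if k = l then Ef n h m f else 0) - (if h = m then fscale (sg h k l m) (Ef n l k f) else 0)
      = (if k = l then Eq n h m f else 0) - (if h = m then fscale (sg h k l m) (Eq n l k f) else 0)
        - fscale (coc h k l m * of_nat n) f"
    unfolding coc[symmetric] Ef_Eq by (auto simp: fun_eq_iff algebra_simps)
  have "Ef n h k (Ef n l m f) = fscale (sg h k l m) (Ef n l m (Ef n h k f))
     + ((if k = l then Ef n h m f else 0) - (if h = m then fscale (sg h k l m) (Ef n l k f) else 0))
     + fscale (coc h k l m * of_nat n) f"
    unfolding 1 3 4 Eq_comm[of n h k l m f] by simp
  then show ?thesis by simp
qed

definition fvac :: fock where
  "fvac X = (if X = {#} then 1 else 0)"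

lemma an_fvac: "an F i fvac = 0"
  by (auto simp: fun_eq_iff an_def fvac_def)

lemma Ef_vac:
  assumes "\<not> create (h, k)"
  shows "Ef n h k fvac = 0"
proof (cases "2 \<le> k")
  case True
  then have "des s k fvac = 0" for s by (simp add: des_def an_fvac)
  then show ?thesis using True by (simp add: Ef_Eq Eq_def kap_def)
next
  case False
  then have h: "h \<le> 1" using assms by (simp add: create_def)
  have *: "cre s h (des s k fvac) = (if h = k then fscale (if ferm (mode s h) then 1 else -1) fvac else 0)" for s
    using h False an_cr[of ferm "mode s h" "mode s k" fvac] cr_scale[of _ _ 0 0]
    by (simp add: cre_def des_def an_scale an_fvac)
  have "(\<Sum>s\<in>copies n. if ferm (mode s h) then 1 else - 1 :: complex) = (if even h then 1 else -1) * of_nat n"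
    by (simp add: copies_def ferm_mode sum.atMost_Suc_shift del: sum.atMost_Suc)
  then have "Eq n h k fvac = fscale (kap n h k) fvac"
    using h by (auto simp: Eq_def * kap_def simp flip: fs.scale_sum_left)
  then show ?thesis by (simp add: Ef_Eq)
qed

interpretation fock: glmod fscale "\<lambda>v. v" "Ef n" fvac "of_nat n" for n
proof unfold_locales
  show "Ef n h k (u + v) = Ef n h k u + Ef n h k v" for h k u v
    by (simp add: Ef_Eq Eq_add fs.scale_right_distrib del: fs.scale_minus_left)
  show "Ef n h k (fscale a v) = fscale a (Ef n h k v)" for h k a v
    by (simp add: Ef_Eq Eq_scale fs.scale_right_distrib mult.commute del: fs.scale_minus_left)
  show "Ef n h k (Ef n l m v) = fscale (sg h k l m) (Ef n l m (Ef n h k v))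
      + (if k = l then Ef n h m v else 0) - (if h = m then fscale (sg h k l m) (Ef n l k v) else 0)
      + fscale (coc h k l m * of_nat n) v" for h k l m v by (rule Ef_comm)
  show "Ef n h k fvac = 0" if "\<not> create (h, k)" for h k using that by (rule Ef_vac)
qed (rule refl)+

text \<open>The coefficient is read off at the state with \<open>r\<close> bosons in each of the
  modes 2 and 0 of the reversed copy; no other copy reaches it, and every factor contributes
  -1.\<close>

lemma fock_Zv_nonzero: "fock.Zv n r \<noteq> 0"
proof -
  define X where "X = (\<lambda>r. replicate_mset r (mode 0 2) + replicate_mset r (mode 0 0))"
  have "fock.Zv n r (X r) = (-1) ^ r"
  proof (induction r)
    case 0
    have "fvac {#} = 1" by (simp add: fvac_def)
    then show ?case by (simp add: fock.Zv_def X_def)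
  next
    case (Suc r)
    define f where "f = fock.Zv n r"
    have "cre s 2 (des s 0 f) (X (Suc r)) = (if s = 0 then - f (X r) else 0)" for s
    proof (cases "s = 0")
      case True
      have "X (Suc r) - {#mode 0 2#} - {#mode 0 0#} = X r" by (simp add: X_def)
      moreover have "0 < count (X (Suc r)) (mode 0 2)" "0 < count (X (Suc r) - {#mode 0 2#}) (mode 0 0)"
        by (simp_all add: X_def)
      ultimately show ?thesis using True by (simp add: cre_def des_def cr_def ferm_mode)
    next
      case False
      then have "count (X (Suc r)) (mode s 2) = 0" by (simp add: X_def)
      then show ?thesis using False by (simp add: cre_def cr_def ferm_mode)
    qed
    then have "Ef n 2 0 f (X (Suc r)) = - f (X r)"
      by (simp add: Ef_def kap_def sum_fun_apply copies_def)
    then show ?case using Suc by (simp add: fock.Zv_def f_def)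
  qed
  then show ?thesis by (metis power_not_zero zero_fun_apply zero_neq_neg_one)
qed

section \<open>Differential operators acting on locally finite modules\<close>

lemma idx_eq: "of_bool r - 2 * a = of_bool s - 2 * (b::int) \<longleftrightarrow> r = s \<and> a = b"
  by (cases r; cases s; simp; presburger)

lemma finite_idx: "finite {j. of_bool s - 2 * (j + n) = (h::int)}"
proof (rule finite_subset)
  show "{j. of_bool s - 2 * (j + n) = h} \<subseteq> {(of_bool s - h) div 2 - n}" by auto
qed simp

context glmod
begin

text \<open>The matrix unit sending exponent \<open>j\<close> in component \<open>s\<close> to
  exponent \<open>j + n\<close> in component \<open>r\<close>.\<close>

definition eop :: "int \<Rightarrow> bool \<Rightarrow> bool \<Rightarrow> int \<Rightarrow> 'v \<Rightarrow> 'v" where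
  "eop n r s j v = E (of_bool r - 2 * (j + n)) (of_bool s - 2 * j) v"

definition esupp :: "int \<Rightarrow> bool \<Rightarrow> bool \<Rightarrow> 'v \<Rightarrow> int set" where
  "esupp n r s v = {j. eop n r s j v \<noteq> 0}"

text \<open>Vectors on which the infinite sums of matrix units become finite. The Fock space
  contains infinite combinations of states, so this is a real restriction.\<close>

definition LF :: "'v set" where
  "LF = {v. \<forall>n r s. finite (esupp n r s v)}"

lemma eop_add: "eop n r s j (u + v) = eop n r s j u + eop n r s j v"
  and eop_scale: "eop n r s j (a *s v) = a *s eop n r s j v"
  and eop_sum: "eop n r s j (\<Sum>i\<in>S. f i) = (\<Sum>i\<in>S. eop n r s j (f i))"
  by (simp_all add: eop_def E_add E_scale E_sum)

lemma LF_D: "v \<in> LF \<Longrightarrow> finite (esupp n r s v)"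
  and LF_I: "(\<And>n r s. finite (esupp n r s v)) \<Longrightarrow> v \<in> LF"
  by (simp_all add: LF_def)

lemma LF_subspace: "subspace LF"
proof (rule subspaceI)
  show "0 \<in> LF" by (simp add: LF_def esupp_def eop_def)
  fix u v assume uv: "u \<in> LF" "v \<in> LF"
  have "esupp n r s (u + v) \<subseteq> esupp n r s u \<union> esupp n r s v" for n r s
    by (auto simp: esupp_def eop_add)
  then show "u + v \<in> LF" using uv by (intro LF_I) (meson LF_D finite_UnI finite_subset)
next
  fix a v assume v: "v \<in> LF"
  have "esupp n r s (a *s v) \<subseteq> esupp n r s v" for n r s
    by (auto simp: esupp_def eop_scale)
  then show "a *s v \<in> LF" using v by (intro LF_I) (meson LF_D finite_subset)
qed

lemma LF_E: assumes "v \<in> LF" shows "E h k v \<in> LF"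
proof (rule LF_I)
  fix n r s
  have "esupp n r s (E h k v) \<subseteq> esupp n r s v \<union> {j. of_bool s - 2 * j = h} \<union> {j. of_bool r - 2 * (j + n) = k}"
  proof
    fix j assume "j \<in> esupp n r s (E h k v)"
    moreover have "eop n r s j (E h k v) = 0"
      if "eop n r s j v = 0" "of_bool s - 2 * j \<noteq> h" "of_bool r - 2 * (j + n) \<noteq> k"
    proof -
      have "coc (of_bool r - 2 * (j + n)) (of_bool s - 2 * j) h k = 0" unfolding coc_def using that(2) by metis
      then show ?thesis
        using that unfolding eop_def E_comm[of "of_bool r - 2 * (j + n)" "of_bool s - 2 * j" h k] by simp
    qed
    ultimately show "j \<in> esupp n r s v \<union> {j. of_bool s - 2 * j = h} \<union> {j. of_bool r - 2 * (j + n) = k}"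
      unfolding esupp_def by blast
  qed
  moreover have "finite {j. of_bool s - 2 * j = h}" "finite {j. of_bool r - 2 * (j + n) = k}"
    using finite_idx[of s 0 h] finite_idx[of r n k] by simp_all
  moreover have "finite (esupp n r s v)" using assms by (simp add: LF_def)
  ultimately show "finite (esupp n r s (E h k v))" by (meson finite_UnI finite_subset)
qed

lemma LF_vac: "vac \<in> LF"
proof (rule LF_I)
  fix n r s
  have "esupp n r s vac \<subseteq> {0..-n}"
  proof
    fix j assume "j \<in> esupp n r s vac"
    then have "create (of_bool r - 2 * (j + n), of_bool s - 2 * j)"
      using E_vac unfolding esupp_def eop_def by blast
    then show "j \<in> {0..-n}" by (cases r; cases s) (auto simp: create_def)
  qed
  then show "finite (esupp n r s vac)" by (rule finite_subset) simp
qed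

definition bsum :: "int \<Rightarrow> (complex \<Rightarrow> complex) \<Rightarrow> bool \<Rightarrow> bool \<Rightarrow> 'v \<Rightarrow> 'v" where
  "bsum n P r s v = (\<Sum>j\<in>esupp n r s v. P (of_int j) *s eop n r s j v)"

lemma bsum_superset: "finite S \<Longrightarrow> esupp n r s v \<subseteq> S \<Longrightarrow> bsum n P r s v = (\<Sum>j\<in>S. P (of_int j) *s eop n r s j v)"
  unfolding bsum_def by (rule sum.mono_neutral_left) (auto simp: esupp_def)

lemma bsum_LF: "v \<in> LF \<Longrightarrow> bsum n P r s v \<in> LF"
  unfolding bsum_def by (intro subspace_sum[OF LF_subspace] subspace_scale[OF LF_subspace]) (simp add: eop_def LF_E)

lemma eop_comm:
  "eop n r s j (eop m r' s' i v) = usg r s r' s' *s eop m r' s' i (eop n r s j v)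
    + (if s = r' \<and> j = i + m then eop (n + m) r s' i v else 0)
    - (if r = s' \<and> i = j + n then usg r s r' s' *s eop (n + m) r' s j v else 0)
    + ((if r = s' \<and> s = r' \<and> i = j + n \<and> j = i + m
        then (if r then -1 else 1) * ((if 0 \<le> j + n then 1 else 0) - (if 0 \<le> j then 1 else 0)) else 0) * c) *s pr v"
proof -
  have sg: "sg (of_bool r - 2 * (j + n)) (of_bool s - 2 * j) (of_bool r' - 2 * (i + m)) (of_bool s' - 2 * i) = usg r s r' s'"
    by (cases r; cases s; cases r'; cases s') (simp_all add: sg_def usg_def)
  have low: "of_bool t - 2 * x \<le> (1::int) \<longleftrightarrow> 0 \<le> x" for t and x :: int
  proof (cases t)
    case False
    have "- (2 * x) \<le> 1 \<longleftrightarrow> 0 \<le> x" by presburger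
    then show ?thesis using False by simp
  qed simp
  have coc: "coc (of_bool r - 2 * (j + n)) (of_bool s - 2 * j) (of_bool r' - 2 * (i + m)) (of_bool s' - 2 * i)
    = (if r = s' \<and> s = r' \<and> i = j + n \<and> j = i + m
        then (if r then -1 else 1) * ((if 0 \<le> j + n then 1 else 0) - (if 0 \<le> j then 1 else 0)) else 0)"
  proof -
    have ev: "even (of_bool r - 2 * (j + n)) \<longleftrightarrow> \<not> r" by simp
    have cond: "((r = s' \<and> j + n = i) \<and> s = r' \<and> j = i + m) = (r = s' \<and> s = r' \<and> i = j + n \<and> j = i + m)"
      by (rule iffI; elim conjE; intro conjI; (assumption | erule sym))
    have sign: "(if \<not> r then 1 else -1 :: complex) = (if r then -1 else 1)" by simp
    show ?thesis unfolding coc_def idx_eq low ev cond sign ..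
  qed
  have 1: "(if s = r' \<and> j = i + m then E (of_bool r - 2 * (j + n)) (of_bool s' - 2 * i) v else 0)
      = (if s = r' \<and> j = i + m then eop (n + m) r s' i v else 0)"
  proof (cases "s = r' \<and> j = i + m")
    case True
    then have j: "j + n = i + (n + m)" by simp
    show ?thesis unfolding if_P[OF True] eop_def j ..
  next
    case False
    show ?thesis unfolding if_not_P[OF False] ..
  qed
  have 2: "(if r = s' \<and> j + n = i then usg r s r' s' *s E (of_bool r' - 2 * (i + m)) (of_bool s - 2 * j) v else 0)
      = (if r = s' \<and> i = j + n then usg r s r' s' *s eop (n + m) r' s j v else 0)"
  proof (cases "r = s' \<and> j + n = i")
    case True
    then have True': "r = s' \<and> i = j + n" and i: "i + m = j + (n + m)" by simp_all
    show ?thesis unfolding if_P[OF True] if_P[OF True'] eop_def i ..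
  next
    case False
    then have False': "\<not> (r = s' \<and> i = j + n)" by metis
    show ?thesis unfolding if_not_P[OF False] if_not_P[OF False'] ..
  qed
  show ?thesis
    unfolding 1[symmetric] 2[symmetric]
    unfolding eop_def E_comm[of "of_bool r - 2 * (j + n)" "of_bool s - 2 * j"] sg coc
    unfolding idx_eq ..
qed

lemma sum_diag1:
  fixes f :: "int \<Rightarrow> int \<Rightarrow> 'v"
  shows "(\<Sum>j\<in>{-N..N}. \<Sum>i\<in>{-N..N}. if Q \<and> j = i + m then f j i else 0)
    = (\<Sum>i\<in>{-N..N}. if Q \<and> \<bar>i + m\<bar> \<le> N then f (i + m) i else 0)"
proof -
  have "(\<Sum>j\<in>{-N..N}. if Q \<and> j = i + m then f j i else 0) = (if Q \<and> \<bar>i + m\<bar> \<le> N then f (i + m) i else 0)" for i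
  proof -
    have "(\<Sum>j\<in>{-N..N}. if Q \<and> j = i + m then f j i else 0)
        = (\<Sum>j\<in>{-N..N}. if j = i + m then (if Q then f (i + m) i else 0) else 0)"
      by (intro sum.cong) auto
    also have "\<dots> = (if Q \<and> \<bar>i + m\<bar> \<le> N then f (i + m) i else 0)"
      by (subst sum.delta) auto
    finally show ?thesis .
  qed
  then show ?thesis by (subst sum.swap) simp
qed

lemma sum_diag2:
  fixes f :: "int \<Rightarrow> int \<Rightarrow> 'v"
  shows "(\<Sum>j\<in>{-N..N}. \<Sum>i\<in>{-N..N}. if Q \<and> i = j + n then f j i else 0)
    = (\<Sum>j\<in>{-N..N}. if Q \<and> \<bar>j + n\<bar> \<le> N then f j (j + n) else 0)"
  by (subst sum.swap) (rule sum_diag1[where f = "\<lambda>i j. f j i"])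

text \<open>The double sum collapses to \<open>i = j + n\<close>, and the step functions select the
  \<open>j\<close> for which \<open>j\<close> and \<open>j + n\<close> lie on different sides of 0.
  For negative \<open>n\<close> the substitution \<open>i = j + n\<close> gives the skew-symmetric
  extension of the cocycle.\<close>

lemma central_diag:
  assumes "\<bar>n\<bar> \<le> N" "\<bar>m\<bar> \<le> N"
  shows "(\<Sum>j\<in>{-N..N}. \<Sum>i\<in>{-N..N}. (P (of_int j) * Q (of_int i)) * (if r = s' \<and> s = r' \<and> i = j + n \<and> j = i + m
        then (if r then -1 else 1) * ((if 0 \<le> j + n then 1 else 0) - (if 0 \<le> j then 1 else 0)) else 0))
    = Psi n r s P m r' s' Q"
proof (cases "r = s' \<and> s = r' \<and> n + m = 0")
  case False
  then have "\<not> (r = s' \<and> s = r' \<and> i = j + n \<and> j = i + m)" for i j by auto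
  moreover have "Psi n r s P m r' s' Q = 0" using False by (auto simp: Psi_def)
  ultimately show ?thesis by (simp only: if_False mult_zero_right sum.neutral_const)
next
  case True
  then have cond: "r = s' \<and> s = r' \<and> i = j + n \<and> j = i + m \<longleftrightarrow> i = j + n" for i j by auto
  define \<epsilon> :: complex where "\<epsilon> = (if r then -1 else 1)"
  let ?d = "\<lambda>j. (if 0 \<le> j + n then 1 else 0) - (if 0 \<le> j then 1 else 0) :: complex"
  have "(\<Sum>i\<in>{-N..N}. (P (of_int j) * Q (of_int i)) * (if r = s' \<and> s = r' \<and> i = j + n \<and> j = i + m
        then \<epsilon> * ?d j else 0))
      = (if j + n \<in> {-N..N} then P (of_int j) * Q (of_int (j + n)) * (\<epsilon> * ?d j) else 0)" for j
  proof -
    have "(\<Sum>i\<in>{-N..N}. (P (of_int j) * Q (of_int i)) * (if r = s' \<and> s = r' \<and> i = j + n \<and> j = i + m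
        then \<epsilon> * ?d j else 0))
      = (\<Sum>i\<in>{-N..N}. if i = j + n then P (of_int j) * Q (of_int (j + n)) * (\<epsilon> * ?d j) else 0)"
      unfolding cond by (intro sum.cong refl) (simp split: if_split)
    then show ?thesis by (simp add: sum.delta')
  qed
  then have L: "(\<Sum>j\<in>{-N..N}. \<Sum>i\<in>{-N..N}. (P (of_int j) * Q (of_int i)) * (if r = s' \<and> s = r' \<and> i = j + n \<and> j = i + m
        then \<epsilon> * ?d j else 0))
    = (\<Sum>j\<in>{-N..N}. if j + n \<in> {-N..N} then P (of_int j) * Q (of_int (j + n)) * (\<epsilon> * ?d j) else 0)"
    by simp
  show ?thesis
  proof (cases "0 \<le> n")
    case n: True
    have "(\<Sum>j\<in>{-N..N}. if j + n \<in> {-N..N} then P (of_int j) * Q (of_int (j + n)) * (\<epsilon> * ?d j) else 0)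
        = (\<Sum>j\<in>{-n..-1}. if j + n \<in> {-N..N} then P (of_int j) * Q (of_int (j + n)) * (\<epsilon> * ?d j) else 0)"
      using n assms by (intro sum.mono_neutral_right) auto
    also have "\<dots> = (\<Sum>j\<in>{-n..-1}. \<epsilon> * (P (of_int j) * Q (of_int (j + n))))"
      using n assms by (intro sum.cong) auto
    also have "\<dots> = Psi n r s P m r' s' Q"
      unfolding sum_distrib_left[symmetric] using True n by (simp add: Psi_def \<epsilon>_def)
    finally show ?thesis unfolding \<epsilon>_def[symmetric] L .
  next
    case n: False
    have "(\<Sum>j\<in>{-N..N}. if j + n \<in> {-N..N} then P (of_int j) * Q (of_int (j + n)) * (\<epsilon> * ?d j) else 0)
        = (\<Sum>j\<in>{0..-n-1}. if j + n \<in> {-N..N} then P (of_int j) * Q (of_int (j + n)) * (\<epsilon> * ?d j) else 0)"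
      using n assms by (intro sum.mono_neutral_right) auto
    also have "\<dots> = (\<Sum>i\<in>{-m..-1}. - \<epsilon> * (Q (of_int i) * P (of_int (i + m))))"
      using n assms True
      by (intro sum.reindex_bij_witness[where i = "\<lambda>i. i + m" and j = "\<lambda>j. j + n"]) (auto simp: algebra_simps)
    also have "\<dots> = Psi n r s P m r' s' Q"
    proof -
      have "- \<epsilon> = - usg r s r' s' * (if s then -1 else 1)"
        using True by (cases r; cases s) (simp_all add: \<epsilon>_def usg_def)
      then show ?thesis unfolding sum_distrib_left[symmetric] using True n by (simp add: Psi_def)
    qed
    finally show ?thesis unfolding \<epsilon>_def[symmetric] L .
  qed
qed


end

fun erow :: "ent \<Rightarrow> bool" where
  "erow E0 = False" | "erow Ep = False" | "erow Em = True" | "erow E1 = True"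

fun ecol :: "ent \<Rightarrow> bool" where
  "ecol E0 = False" | "ecol Ep = True" | "ecol Em = False" | "ecol E1 = True"

lemma unit_row_col: "unit (erow a) (ecol a) = a"
  by (cases a) auto

lemma finite_br: "finite {z. br x y z \<noteq> 0}"
proof (cases x)
  case x: (J a k n)
  show ?thesis
  proof (cases y)
    case y: (J b l m)
    show ?thesis unfolding x y by (rule sum_br(1)[OF vector_space_fscale])
  qed simp
qed simp

lemma comm_rel_eq:
  "comm_rel u x y v = wd (u @ [x, y] @ v) - fscale (ssgn x y) (wd (u @ [y, x] @ v))
     - (\<Sum>z\<in>{z. br x y z \<noteq> 0}. fscale (br x y z) (wd (u @ [z] @ v)))"
proof
  fix w
  have "(\<Sum>z\<in>{z. br x y z \<noteq> 0}. br x y z * wd (u @ [z] @ v) w)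
      = (if length w = length u + 1 + length v \<and> take (length u) w = u
           \<and> drop (Suc (length u)) w = v then br x y (w ! length u) else 0)"
  proof (cases "\<exists>z. w = u @ [z] @ v")
    case True
    then obtain z where w: "w = u @ [z] @ v" by blast
    have "(\<Sum>z'\<in>{z. br x y z \<noteq> 0}. br x y z' * wd (u @ [z'] @ v) w)
        = (\<Sum>z'\<in>{z. br x y z \<noteq> 0}. if z' = z then br x y z' else 0)"
      by (intro sum.cong) (auto simp: wd_def w)
    then show ?thesis using finite_br[of x y] by (simp add: w)
  next
    case False
    have "\<not> (length w = length u + 1 + length v \<and> take (length u) w = u \<and> drop (Suc (length u)) w = v)"
    proof
      assume a: "length w = length u + 1 + length v \<and> take (length u) w = u \<and> drop (Suc (length u)) w = v"
      then have "w = u @ [w ! length u] @ v"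
        using id_take_nth_drop[of "length u" w] by simp
      then show False using False by blast
    qed
    moreover have "wd (u @ [z] @ v) w = 0" for z using False by (auto simp: wd_def)
    ultimately show ?thesis by (simp only: if_False mult_zero_right sum.neutral_const)
  qed
  then show "comm_rel u x y v w = (wd (u @ [x, y] @ v) - fscale (ssgn x y) (wd (u @ [y, x] @ v))
     - (\<Sum>z\<in>{z. br x y z \<noteq> 0}. fscale (br x y z) (wd (u @ [z] @ v)))) w"
    by (simp add: comm_rel_def sum_fun_apply)
qed

lemma ind_rel_eq: "ind_rel c u p = wd (u @ [p]) - fscale (chi c p) (wd u)"
  by (simp add: fun_eq_iff ind_rel_def)

lemma Tfin_subspace: "fs.subspace Tfin"
proof (rule fs.subspaceI)
    show "0 \<in> Tfin" by (simp add: Tfin_def)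
    fix f g :: tens assume fg: "f \<in> Tfin" "g \<in> Tfin"
    have "{w. (f + g) w \<noteq> 0} \<subseteq> {w. f w \<noteq> 0} \<union> {w. g w \<noteq> 0}" by auto
    then show "f + g \<in> Tfin" using fg finite_subset unfolding Tfin_def by blast
  next
    fix a and f :: tens assume f: "f \<in> Tfin"
    have "{w. fscale a f w \<noteq> 0} \<subseteq> {w. f w \<noteq> 0}" by auto
    then show "fscale a f \<in> Tfin" using f finite_subset unfolding Tfin_def by blast
qed

lemma wd_Tfin [simp]: "wd w \<in> Tfin"
  by (simp add: Tfin_def wd_def)

lemma Tfin_expand: "f \<in> Tfin \<Longrightarrow> f = (\<Sum>w\<in>{w. f w \<noteq> 0}. fscale (f w) (wd w))"
proof
  fix u assume "f \<in> Tfin"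
  have "(\<Sum>w\<in>{w. f w \<noteq> 0}. fscale (f w) (wd w)) u = (\<Sum>w\<in>{w. f w \<noteq> 0}. if w = u then f u else 0)"
    by (simp only: sum_fun_apply, intro sum.cong) (auto simp: wd_def)
  also have "\<dots> = f u" using \<open>f \<in> Tfin\<close> by (simp add: Tfin_def)
  finally show "f u = (\<Sum>w\<in>{w. f w \<noteq> 0}. fscale (f w) (wd w)) u" by simp
qed

lemma Lrel_induct [consumes 1, case_names zero comm ind]:
  assumes "f \<in> Lrel c"
    and "P 0"
    and "\<And>a u x y v g. P g \<Longrightarrow> P (fscale a (comm_rel u x y v) + g)"
    and "\<And>a u p g. in_SP p \<Longrightarrow> P g \<Longrightarrow> P (fscale a (ind_rel c u p) + g)"
  shows "P f"
  using assms(1) unfolding Lrel_def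
proof (induction rule: lspan.induct)
  case zero
  then show ?case using assms(2) by (simp add: zero_fun_def)
next
  case (add f g a)
  have "(\<lambda>w. a * f w + g w) = fscale a f + g" by (simp add: fun_eq_iff)
  then show ?case using add assms(3,4) by auto
qed

context glmod
begin

text \<open>Both operators are expanded over one window, which reduces the claim to the relations of
  matrix units. The window exceeds every support involved by \<open>|n| + |m|\<close>, so that
  shifted indices stay inside.\<close>

lemma bsum_comm:
  assumes v: "v \<in> LF"
  shows "bsum n P r s (bsum m Q r' s' v) = usg r s r' s' *s bsum m Q r' s' (bsum n P r s v)
    + ((if s = r' then bsum (n + m) (\<lambda>x. P (x + of_int m) * Q x) r s' v else 0)
    - (if s' = r then usg r s r' s' *s bsum (n + m) (\<lambda>x. P x * Q (x + of_int n)) r' s v else 0)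
    + (Psi n r s P m r' s' Q * c) *s pr v)"
proof -
  define S where "S = esupp n r s v \<union> esupp m r' s' v \<union> esupp n r s (bsum m Q r' s' v)
    \<union> esupp m r' s' (bsum n P r s v) \<union> esupp (n + m) r s' v \<union> esupp (n + m) r' s v"
  have "finite S" unfolding S_def using v bsum_LF[OF v] by (intro finite_UnI LF_D)
  then have "finite (abs ` S)" by simp
  then obtain N0 where N0: "\<And>x. x \<in> abs ` S \<Longrightarrow> x \<le> N0" by (meson bdd_above_def bdd_above_finite)
  define N where "N = max N0 0 + \<bar>n\<bar> + \<bar>m\<bar>"
  let ?I = "{-N..N}"
  have S0: "\<bar>x\<bar> \<le> N - \<bar>n\<bar> - \<bar>m\<bar>" if "x \<in> S" for x using N0[of "\<bar>x\<bar>"] that by (auto simp: N_def)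
  have sub: "T \<subseteq> ?I" if "T \<subseteq> S" for T using that S0 by fastforce
  have b: "bsum n' R r0 s0 w = (\<Sum>j\<in>?I. R (of_int j) *s eop n' r0 s0 j w)"
    if "esupp n' r0 s0 w \<subseteq> S" for n' R r0 s0 w
    using that sub by (intro bsum_superset) auto
  have out: "eop n' r0 s0 j v = 0" if "esupp n' r0 s0 v \<subseteq> S" "\<not> \<bar>j\<bar> \<le> N - \<bar>n\<bar> - \<bar>m\<bar>" for n' r0 s0 j
    using that S0 by (auto simp: esupp_def)
  have L1: "bsum n P r s (bsum m Q r' s' v)
      = (\<Sum>j\<in>?I. \<Sum>i\<in>?I. (P (of_int j) * Q (of_int i)) *s eop n r s j (eop m r' s' i v))"
    by (subst b[where w = "bsum m Q r' s' v"], force simp: S_def)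
      (subst b, force simp: S_def, simp add: eop_sum eop_scale scale_sum_right)
  have L2: "bsum m Q r' s' (bsum n P r s v)
      = (\<Sum>j\<in>?I. \<Sum>i\<in>?I. (P (of_int j) * Q (of_int i)) *s eop m r' s' i (eop n r s j v))"
    by (subst b[where w = "bsum n P r s v"], force simp: S_def, subst b, force simp: S_def, subst sum.swap)
      (simp add: eop_sum eop_scale scale_sum_right mult.commute)
  have T1: "(\<Sum>j\<in>?I. \<Sum>i\<in>?I. if s = r' \<and> j = i + m then (P (of_int j) * Q (of_int i)) *s eop (n + m) r s' i v else 0)
      = (if s = r' then bsum (n + m) (\<lambda>x. P (x + of_int m) * Q x) r s' v else 0)"
  proof (cases "s = r'")
    case True
    have "(\<Sum>i\<in>?I. if s = r' \<and> \<bar>i + m\<bar> \<le> N then (P (of_int (i + m)) * Q (of_int i)) *s eop (n + m) r s' i v else 0)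
        = (\<Sum>i\<in>?I. (P (of_int i + of_int m) * Q (of_int i)) *s eop (n + m) r s' i v)"
    proof (intro sum.cong refl)
      fix i
      have "esupp (n + m) r s' v \<subseteq> S" by (auto simp: S_def)
      then show "(if s = r' \<and> \<bar>i + m\<bar> \<le> N then (P (of_int (i + m)) * Q (of_int i)) *s eop (n + m) r s' i v else 0)
        = (P (of_int i + of_int m) * Q (of_int i)) *s eop (n + m) r s' i v"
        using True out[of "n + m" r s' i] by (cases "\<bar>i + m\<bar> \<le> N") auto
    qed
    moreover have "esupp (n + m) r s' v \<subseteq> S" by (auto simp: S_def)
    ultimately show ?thesis unfolding sum_diag1 using True b[of "n + m" r s' v] by simp
  qed simp
  have T2: "(\<Sum>j\<in>?I. \<Sum>i\<in>?I. if r = s' \<and> i = j + n then (P (of_int j) * Q (of_int i)) *s usg r s r' s' *s eop (n + m) r' s j v else 0)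
      = (if s' = r then usg r s r' s' *s bsum (n + m) (\<lambda>x. P x * Q (x + of_int n)) r' s v else 0)"
  proof (cases "r = s'")
    case True
    have "(\<Sum>j\<in>?I. if r = s' \<and> \<bar>j + n\<bar> \<le> N then (P (of_int j) * Q (of_int (j + n))) *s usg r s r' s' *s eop (n + m) r' s j v else 0)
        = (\<Sum>j\<in>?I. usg r s r' s' *s (P (of_int j) * Q (of_int j + of_int n)) *s eop (n + m) r' s j v)"
    proof (intro sum.cong refl)
      fix j
      have "esupp (n + m) r' s v \<subseteq> S" by (auto simp: S_def)
      then show "(if r = s' \<and> \<bar>j + n\<bar> \<le> N then (P (of_int j) * Q (of_int (j + n))) *s usg r s r' s' *s eop (n + m) r' s j v else 0)
        = usg r s r' s' *s (P (of_int j) * Q (of_int j + of_int n)) *s eop (n + m) r' s j v"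
        using True out[of "n + m" r' s j] by (cases "\<bar>j + n\<bar> \<le> N") (auto simp: mult.commute)
    qed
    moreover have "esupp (n + m) r' s v \<subseteq> S" by (auto simp: S_def)
    ultimately show ?thesis unfolding sum_diag2 using True b[of "n + m" r' s v]
      by (simp add: scale_sum_right)
  qed simp
  have T3: "(\<Sum>j\<in>?I. \<Sum>i\<in>?I. (P (of_int j) * Q (of_int i)) *s ((if r = s' \<and> s = r' \<and> i = j + n \<and> j = i + m
        then (if r then -1 else 1) * ((if 0 \<le> j + n then 1 else 0) - (if 0 \<le> j then 1 else 0)) else 0) * c) *s pr v)
      = (Psi n r s P m r' s' Q * c) *s pr v"
  proof -
    have "\<bar>n\<bar> \<le> N" "\<bar>m\<bar> \<le> N" by (auto simp: N_def)
    from central_diag[OF this, of P Q r s' s r'] show ?thesis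
      by (simp only: scale_scale mult.assoc[symmetric] flip: scale_sum_left sum_distrib_right)
  qed
  have "bsum n P r s (bsum m Q r' s' v) = (\<Sum>j\<in>?I. \<Sum>i\<in>?I.
      (P (of_int j) * Q (of_int i)) *s usg r s r' s' *s eop m r' s' i (eop n r s j v)
      + (if s = r' \<and> j = i + m then (P (of_int j) * Q (of_int i)) *s eop (n + m) r s' i v else 0)
      - (if r = s' \<and> i = j + n then (P (of_int j) * Q (of_int i)) *s usg r s r' s' *s eop (n + m) r' s j v else 0)
      + (P (of_int j) * Q (of_int i)) *s ((if r = s' \<and> s = r' \<and> i = j + n \<and> j = i + m
        then (if r then -1 else 1) * ((if 0 \<le> j + n then 1 else 0) - (if 0 \<le> j then 1 else 0)) else 0) * c) *s pr v)"
    unfolding L1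
  proof (intro sum.cong refl)
    fix j i
    have scale_if: "a *s (if b then w else 0) = (if b then a *s w else 0)" for a b w by simp
    show "(P (of_int j) * Q (of_int i)) *s eop n r s j (eop m r' s' i v) =
      (P (of_int j) * Q (of_int i)) *s usg r s r' s' *s eop m r' s' i (eop n r s j v)
      + (if s = r' \<and> j = i + m then (P (of_int j) * Q (of_int i)) *s eop (n + m) r s' i v else 0)
      - (if r = s' \<and> i = j + n then (P (of_int j) * Q (of_int i)) *s usg r s r' s' *s eop (n + m) r' s j v else 0)
      + (P (of_int j) * Q (of_int i)) *s ((if r = s' \<and> s = r' \<and> i = j + n \<and> j = i + m
        then (if r then -1 else 1) * ((if 0 \<le> j + n then 1 else 0) - (if 0 \<le> j then 1 else 0)) else 0) * c) *s pr v"
      unfolding eop_comm[of n r s j m r' s' i v] scale_right_distrib scale_right_diff_distrib scale_if ..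
  qed
  also have "\<dots> = usg r s r' s' *s bsum m Q r' s' (bsum n P r s v)
    + (if s = r' then bsum (n + m) (\<lambda>x. P (x + of_int m) * Q x) r s' v else 0)
    - (if s' = r then usg r s r' s' *s bsum (n + m) (\<lambda>x. P x * Q (x + of_int n)) r' s v else 0)
    + (Psi n r s P m r' s' Q * c) *s pr v"
    unfolding sum.distrib sum_subtractf T1 T2 T3 L2 scale_sum_right
    by (simp only: scale_left_commute)
  finally show ?thesis by simp
qed

lemma bsum_add:
  assumes "u \<in> LF" "v \<in> LF"
  shows "bsum n P r s (u + v) = bsum n P r s u + bsum n P r s v"
proof -
  have fin: "finite (esupp n r s u \<union> esupp n r s v)" using assms by (simp add: LF_D)
  have "bsum n P r s w = (\<Sum>j\<in>esupp n r s u \<union> esupp n r s v. P (of_int j) *s eop n r s j w)"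
    if "esupp n r s w \<subseteq> esupp n r s u \<union> esupp n r s v" for w
    using bsum_superset[OF fin that] .
  moreover have "esupp n r s (u + v) \<subseteq> esupp n r s u \<union> esupp n r s v" by (auto simp: esupp_def eop_add)
  ultimately show ?thesis by (simp add: eop_add scale_right_distrib sum.distrib)
qed

lemma bsum_scale:
  assumes "v \<in> LF"
  shows "bsum n P r s (a *s v) = a *s bsum n P r s v"
proof -
  have "esupp n r s (a *s v) \<subseteq> esupp n r s v" by (auto simp: esupp_def eop_scale)
  then have "bsum n P r s (a *s v) = (\<Sum>j\<in>esupp n r s v. P (of_int j) *s eop n r s j (a *s v))"
    by (rule bsum_superset[OF LF_D[OF assms]])
  also have "\<dots> = a *s bsum n P r s v"
    by (simp add: bsum_def eop_scale scale_sum_right mult.commute)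
  finally show ?thesis .
qed

lemma bsum_linear: "bsum n (\<lambda>x. y * P x + z * Q x) r s v = y *s bsum n P r s v + z *s bsum n Q r s v"
  by (simp add: bsum_def scale_left_distrib sum.distrib scale_sum_right)

lemma bsum_newton:
  assumes "polyfun R"
  shows "(\<Sum>p\<in>fsupp R. fcoef R p *s bsum n (\<lambda>x. ff x p) r s v) = bsum n R r s v"
proof -
  have "(\<Sum>p\<in>fsupp R. fcoef R p *s bsum n (\<lambda>x. ff x p) r s v)
      = (\<Sum>j\<in>esupp n r s v. \<Sum>p\<in>fsupp R. (fcoef R p * ff (of_int j) p) *s eop n r s j v)"
    unfolding bsum_def by (subst sum.swap) (simp add: scale_sum_right)
  also have "\<dots> = bsum n R r s v"
    unfolding bsum_def by (simp only: newton(2)[OF assms] scale_sum_left)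
  finally show ?thesis .
qed

text \<open>Inverse to the passage from generators to matrix units: a symbol acts as a locally
  finite sum.\<close>

definition W :: "gb \<Rightarrow> 'v \<Rightarrow> 'v" where
  "W x v = (case x of Cb \<Rightarrow> c *s pr v | J a k n \<Rightarrow> - bsum n (\<lambda>x. ff x k) (erow a) (ecol a) v)"

lemma eop_pr: "eop n r s j (pr v) = eop n r s j v"
  by (simp add: eop_def E_pr)

lemma esupp_pr: "esupp n r s (pr v) = esupp n r s v"
  by (simp add: esupp_def eop_pr)

lemma pr_LF: "v \<in> LF \<Longrightarrow> pr v \<in> LF"
  by (rule LF_I) (simp add: esupp_pr LF_D)

lemma W_pr: "W x (pr v) = W x v"
  by (cases x) (simp_all add: W_def bsum_def eop_pr esupp_pr pr_idem)

lemma pr_W: "pr (W x v) = W x v"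
  by (cases x) (simp_all add: W_def bsum_def pr_minus pr_sum pr_scale eop_def pr_E pr_idem)

lemma W_LF: "v \<in> LF \<Longrightarrow> W x v \<in> LF"
  by (cases x) (auto simp: W_def pr_LF subspace_scale[OF LF_subspace] subspace_neg[OF LF_subspace] bsum_LF)

lemma W_add: "u \<in> LF \<Longrightarrow> v \<in> LF \<Longrightarrow> W x (u + v) = W x u + W x v"
  by (cases x) (auto simp: W_def bsum_add pr_add scale_right_distrib)

lemma W_scale: "v \<in> LF \<Longrightarrow> W x (a *s v) = a *s W x v"
  by (cases x) (auto simp: W_def bsum_scale pr_scale mult.commute)

lemma W_zero: "W x 0 = 0"
  using W_scale[of 0 x 0] LF_subspace by (simp add: subspace_0)

lemma W_sum: "(\<And>i. i \<in> S \<Longrightarrow> f i \<in> LF) \<Longrightarrow> W x (\<Sum>i\<in>S. f i) = (\<Sum>i\<in>S. W x (f i))"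
  by (induction S rule: infinite_finite_induct) (auto simp: W_zero W_add subspace_sum[OF LF_subspace])

lemma W_comm_J:
  assumes v: "v \<in> LF"
  shows "W (J a k n) (W (J b l m) v) = ssgn (J a k n) (J b l m) *s W (J b l m) (W (J a k n) v)
    + (\<Sum>z\<in>{z. br (J a k n) (J b l m) z \<noteq> 0}. br (J a k n) (J b l m) z *s W z v)"
proof -
  define r s r' s' where "r = erow a" and "s = ecol a" and "r' = erow b" and "s' = ecol b"
  have a: "a = unit r s" and b: "b = unit r' s'" by (simp_all add: r_def s_def r'_def s'_def unit_row_col)
  have sg: "ssgn (J a k n) (J b l m) = usg r s r' s'" by (auto simp: ssgn_def usg_def a b)
  have WJ: "W (J a k n) w = - bsum n (\<lambda>x. ff x k) r s w" "W (J b l m) w = - bsum m (\<lambda>x. ff x l) r' s' w" for w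
    by (simp_all add: W_def r_def s_def r'_def s'_def)
  have neg: "bsum n' P r0 s0 (- w) = - bsum n' P r0 s0 w" if "w \<in> LF" for n' P r0 s0 w
    using bsum_scale[OF that, of n' P r0 s0 "-1"] by simp
  have "(\<Sum>e\<in>UNIV. \<Sum>p\<in>fsupp (br_poly a k n b l m e). (- fcoef (br_poly a k n b l m e) p) *s W (J e p (n + m)) v)
      = (\<Sum>e\<in>UNIV. bsum (n + m) (br_poly a k n b l m e) (erow e) (ecol e) v)"
    by (simp add: W_def bsum_newton)
  also have "\<dots> = (\<Sum>e\<in>UNIV. ind (emul a b) e *s bsum (n + m) (\<lambda>x. ff (x + of_int m) k * ff x l) (erow e) (ecol e) v
      + (- (usg r s r' s' * ind (emul b a) e)) *s bsum (n + m) (\<lambda>x. ff x k * ff (x + of_int n) l) (erow e) (ecol e) v)"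
    unfolding bsum_linear[symmetric] by (simp add: br_poly_def[abs_def] sg mult.assoc)
  also have "\<dots> = (if s = r' then bsum (n + m) (\<lambda>x. ff (x + of_int m) k * ff x l) r s' v else 0)
    - (if s' = r then usg r s r' s' *s bsum (n + m) (\<lambda>x. ff x k * ff (x + of_int n) l) r' s v else 0)"
    unfolding a b by (cases r; cases s; cases r'; cases s') (simp_all add: UNIV_ent ind_def)
  finally have S: "(\<Sum>z\<in>{z. br (J a k n) (J b l m) z \<noteq> 0}. br (J a k n) (J b l m) z *s W z v)
    = (Psi n r s (\<lambda>x. ff x k) m r' s' (\<lambda>x. ff x l) * c) *s pr v
      + ((if s = r' then bsum (n + m) (\<lambda>x. ff (x + of_int m) k * ff x l) r s' v else 0)
    - (if s' = r then usg r s r' s' *s bsum (n + m) (\<lambda>x. ff x k * ff (x + of_int n) l) r' s v else 0))"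
    unfolding sum_br(2)[OF vector_space_axioms] a b psi_unit by (simp add: W_def)
  show ?thesis
    unfolding S sg WJ neg[OF bsum_LF[OF v]] minus_minus bsum_comm[OF v, of n "\<lambda>x. ff x k" r s m "\<lambda>x. ff x l" r' s']
    by simp
qed

lemma W_comm:
  assumes v: "v \<in> LF"
  shows "W x (W y v) = ssgn x y *s W y (W x v) + (\<Sum>z\<in>{z. br x y z \<noteq> 0}. br x y z *s W z v)"
proof -
  consider "x = Cb" | "y = Cb" | a k n b l m where "x = J a k n" "y = J b l m"
    by (cases x; cases y) auto
  then show ?thesis
  proof cases
    case 1
    then show ?thesis using W_scale[OF pr_LF[OF v]] by (simp add: W_def[of Cb] ssgn_def pr_W W_pr)
  next
    case 2
    then show ?thesis using W_scale[OF pr_LF[OF v]] by (simp add: W_def[of Cb] ssgn_def pr_W W_pr)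
  next
    case 3
    show ?thesis unfolding 3 by (rule W_comm_J[OF v])
  qed
qed

text \<open>A matrix unit in this sum that does not kill the vacuum has
  \<open>0 \<le> j < -n \<le> k\<close>, and there the falling factorial \<open>ff j k\<close> is
  zero.\<close>

lemma W_vac:
  assumes "in_SP x"
  shows "W x vac = chi c x *s vac"
proof (cases x)
  case (J a k n)
  have "ff (of_int j) k *s eop n (erow a) (ecol a) j vac = 0" for j
  proof (cases "create (of_bool (erow a) - 2 * (j + n), of_bool (ecol a) - 2 * j)")
    case True
    then have "0 \<le> j" "j + n < 0" by (cases "erow a"; cases "ecol a"; simp add: create_def)+
    then have "nat j < k" "of_int j = (of_nat (nat j) :: complex)" using assms J by (auto simp: in_SP_def)
    then show ?thesis by (simp add: ff_of_nat)
  next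
    case False
    then show ?thesis by (simp add: eop_def E_vac)
  qed
  then have "bsum n (\<lambda>x. ff x k) (erow a) (ecol a) vac = 0"
    unfolding bsum_def by (intro sum.neutral ballI)
  then show ?thesis using J by (simp add: W_def chi_def)
qed (simp add: W_def chi_def pr_vac)

section \<open>Evaluation of tensors on a module over the matrix units\<close>

definition wact :: "gb list \<Rightarrow> 'v" where
  "wact w = foldr W w vac"

lemma wact_LF: "wact w \<in> LF"
  by (induction w) (auto simp: wact_def LF_vac W_LF)

definition eval_tens :: "tens \<Rightarrow> 'v" where
  "eval_tens f = (\<Sum>w\<in>{w. f w \<noteq> 0}. f w *s wact w)"

lemma eval_superset: "finite S \<Longrightarrow> {w. f w \<noteq> 0} \<subseteq> S \<Longrightarrow> eval_tens f = (\<Sum>w\<in>S. f w *s wact w)"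
  unfolding eval_tens_def by (rule sum.mono_neutral_left) auto

lemma eval_LF: "eval_tens f \<in> LF"
  unfolding eval_tens_def by (intro subspace_sum[OF LF_subspace] subspace_scale[OF LF_subspace] wact_LF)

lemma eval_wd [simp]: "eval_tens (wd w) = wact w"
  by (subst eval_superset[of "{w}"]) (auto simp: wd_def split: if_splits)

lemma eval_add:
  assumes "f \<in> Tfin" "g \<in> Tfin"
  shows "eval_tens (f + g) = eval_tens f + eval_tens g"
proof -
  define S where "S = {w. f w \<noteq> 0} \<union> {w. g w \<noteq> 0}"
  have S: "finite S" using assms by (simp add: S_def Tfin_def)
  have "eval_tens h = (\<Sum>w\<in>S. h w *s wact w)" if "{w. h w \<noteq> 0} \<subseteq> S" for h
    using eval_superset[OF S that] .
  moreover have "{w. (f + g) w \<noteq> 0} \<subseteq> S" "{w. f w \<noteq> 0} \<subseteq> S" "{w. g w \<noteq> 0} \<subseteq> S" by (auto simp: S_def)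
  ultimately show ?thesis by (simp add: scale_left_distrib sum.distrib)
qed

lemma eval_scale: "eval_tens (fscale a f) = a *s eval_tens f"
proof (cases "a = 0")
  case False
  then show ?thesis by (simp add: eval_tens_def scale_sum_right)
qed (simp add: eval_tens_def)

lemma eval_sum: "(\<And>i. i \<in> S \<Longrightarrow> f i \<in> Tfin) \<Longrightarrow> eval_tens (\<Sum>i\<in>S. f i) = (\<Sum>i\<in>S. eval_tens (f i))"
proof (induction S rule: infinite_finite_induct)
  case (insert x F)
  have "(\<Sum>i\<in>F. f i) \<in> Tfin" using insert by (intro fs.subspace_sum[OF Tfin_subspace]) auto
  then show ?case using insert by (simp only: sum.insert eval_add insert_iff simp_thms)
qed (simp_all add: eval_tens_def)

end

section \<open>The vacuum module\<close>

lemma act_Nil [simp]: "act x f [] = 0"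
  and act_Cons [simp]: "act x f (y # w) = (if y = x then f w else 0)"
  by (simp_all add: act_def)

lemma act_add: "act x (f + g) = act x f + act x g"
proof
  show "act x (f + g) w = (act x f + act x g) w" for w by (cases w) simp_all
qed

lemma act_diff: "act x (f - g) = act x f - act x g"
proof
  show "act x (f - g) w = (act x f - act x g) w" for w by (cases w) simp_all
qed

lemma act_scale: "act x (fscale a f) = fscale a (act x f)"
proof
  show "act x (fscale a f) w = fscale a (act x f) w" for w by (cases w) simp_all
qed

lemma act_zero [simp]: "act x 0 = 0"
proof
  show "act x 0 w = 0 w" for w by (cases w) simp_all
qed

lemma act_wd [simp]: "act x (wd w) = wd (x # w)"
proof
  show "act x (wd w) u = wd (x # w) u" for u by (cases u) (simp_all add: wd_def)
qed

lemma act_sum: "act x (\<Sum>i\<in>S. f i) = (\<Sum>i\<in>S. act x (f i))"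
  by (induction S rule: infinite_finite_induct) (simp_all only: sum.infinite sum.empty sum.insert act_zero act_add not_False_eq_True)

lemma act_Tfin: "f \<in> Tfin \<Longrightarrow> act x f \<in> Tfin"
  by (subst Tfin_expand, assumption)
    (simp only: act_sum act_scale act_wd, intro fs.subspace_sum[OF Tfin_subspace] fs.subspace_scale[OF Tfin_subspace] wd_Tfin)

lemma Tfin_induct [consumes 1, case_names zero step]:
  assumes "f \<in> Tfin" "P 0" "\<And>a w g. g \<in> Tfin \<Longrightarrow> P g \<Longrightarrow> P (fscale a (wd w) + g)"
  shows "P f"
proof -
  have "P (\<Sum>w\<in>S. fscale (f w) (wd w)) \<and> (\<Sum>w\<in>S. fscale (f w) (wd w)) \<in> Tfin" if "finite S" for S
    using that
  proof (induction S rule: finite_induct)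
    case empty
    show ?case unfolding sum.empty using assms(2) fs.subspace_0[OF Tfin_subspace] by (rule conjI)
  next
    case (insert w S)
    then show ?case
      using assms(3) fs.subspace_add[OF Tfin_subspace] fs.subspace_scale[OF Tfin_subspace]
      by (simp only: sum.insert wd_Tfin not_False_eq_True)
  qed
  then show ?thesis using Tfin_expand[OF assms(1)] assms(1) by (metis (mono_tags, lifting) Tfin_def mem_Collect_eq)
qed

lemma lspan_span: "lspan S = fs.span S"
proof
  show "lspan S \<subseteq> fs.span S"
  proof
    fix f assume "f \<in> lspan S"
    then show "f \<in> fs.span S"
    proof (induction rule: lspan.induct)
      case zero
      show ?case using fs.span_zero[of S] unfolding zero_fun_def .
    next
      case (add f g a)
      have "(\<lambda>w. a * f w + g w) = fscale a f + g" by (simp add: fun_eq_iff)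
      then show ?case using add by (simp only: fs.span_add fs.span_scale fs.span_base)
    qed
  qed
  show "fs.span S \<subseteq> lspan S"
  proof
    fix f assume "f \<in> fs.span S"
    then show "f \<in> lspan S"
    proof (induction rule: fs.span_induct_alt)
      case base
      show ?case using lspan.zero[of S] unfolding zero_fun_def .
    next
      case (step a f g)
      have "(\<lambda>w. a * f w + g w) = fscale a f + g" by (simp add: fun_eq_iff)
      then show ?case using lspan.add[OF step, of a] by (simp only:)
    qed
  qed
qed

lemma Lrel_subspace: "fs.subspace (Lrel c)"
  by (simp add: Lrel_def lspan_span)

lemma comm_rel_Lrel: "comm_rel u x y v \<in> Lrel c"
  unfolding Lrel_def lspan_span by (rule fs.span_base) blast

lemma ind_rel_Lrel: "in_SP p \<Longrightarrow> ind_rel c u p \<in> Lrel c"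
  unfolding Lrel_def lspan_span by (rule fs.span_base) blast

lemma act_comm_rel: "act a (comm_rel u x y v) = comm_rel (a # u) x y v"
  unfolding comm_rel_eq act_diff act_sum act_scale act_wd by simp

lemma act_ind_rel: "act a (ind_rel c u p) = ind_rel c (a # u) p"
  unfolding ind_rel_eq act_diff act_scale act_wd by simp

lemma Lrel_act: "f \<in> Lrel c \<Longrightarrow> act a f \<in> Lrel c"
proof (induction rule: Lrel_induct)
  case zero
  show ?case unfolding act_zero by (rule fs.subspace_0[OF Lrel_subspace])
next
  case (comm b u x y v g)
  show ?case unfolding act_add act_scale act_comm_rel
    by (intro fs.subspace_add fs.subspace_scale Lrel_subspace comm_rel_Lrel comm)
next
  case (ind b u p g)
  show ?case unfolding act_add act_scale act_ind_rel
    by (intro fs.subspace_add fs.subspace_scale Lrel_subspace ind_rel_Lrel ind)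
qed

lemma comm_rel_Tfin: "comm_rel u x y v \<in> Tfin"
  unfolding comm_rel_eq
  by (intro fs.subspace_diff[OF Tfin_subspace] fs.subspace_sum[OF Tfin_subspace] fs.subspace_scale[OF Tfin_subspace] wd_Tfin)

lemma ind_rel_Tfin: "ind_rel c u p \<in> Tfin"
  unfolding ind_rel_eq
  by (intro fs.subspace_diff[OF Tfin_subspace] fs.subspace_scale[OF Tfin_subspace] wd_Tfin)

lemma Lrel_Tfin: "f \<in> Lrel c \<Longrightarrow> f \<in> Tfin"
proof (induction rule: Lrel_induct)
  case zero
  show ?case by (rule fs.subspace_0[OF Tfin_subspace])
next
  case (comm b u x y v g)
  then show ?case by (intro fs.subspace_add[OF Tfin_subspace] fs.subspace_scale[OF Tfin_subspace] comm_rel_Tfin)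
next
  case (ind b u p g)
  then show ?case by (intro fs.subspace_add[OF Tfin_subspace] fs.subspace_scale[OF Tfin_subspace] ind_rel_Tfin)
qed

section \<open>Grading by doubled conformal weight\<close>

lemma comp_apply: "comp d f w = (if wwt w = d then f w else 0)"
  by (simp add: comp_def)

lemma comp_add: "comp d (f + g) = comp d f + comp d g"
  by (rule ext) (simp add: comp_apply)

lemma comp_scale: "comp d (fscale a f) = fscale a (comp d f)"
  by (rule ext) (simp add: comp_apply)

lemma comp_diff: "comp d (f - g) = comp d f - comp d g"
  by (rule ext) (simp add: comp_apply)

lemma comp_zero [simp]: "comp d 0 = 0"
  by (rule ext) (simp add: comp_apply)

lemma comp_wd: "comp d (wd w) = (if wwt w = d then wd w else 0)"
  by (rule ext) (simp add: comp_apply wd_def)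

lemma comp_sum: "comp d (\<Sum>i\<in>S. f i) = (\<Sum>i\<in>S. comp d (f i))"
  by (induction S rule: infinite_finite_induct) (simp_all only: sum.infinite sum.empty sum.insert comp_zero comp_add not_False_eq_True)

lemma comp_comp: "comp d (comp e f) = (if d = e then comp e f else 0)"
  by (auto simp: comp_def fun_eq_iff)

lemma comp_homog: "homog d f \<Longrightarrow> comp e f = (if e = d then f else 0)"
  by (auto simp: homog_def comp_def fun_eq_iff)

lemma comp_act: "comp d (act x f) = act x (comp (d - gwt x) f)"
  by (auto simp: comp_def act_def fun_eq_iff wwt_def split: list.split)

lemma comp_Tfin: "f \<in> Tfin \<Longrightarrow> comp d f \<in> Tfin"
  unfolding Tfin_def comp_def by (auto elim: rev_finite_subset)

lemma homog_act: "homog d f \<Longrightarrow> homog (d + gwt x) (act x f)"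
  by (auto simp: homog_def act_def wwt_def split: list.splits if_splits)

lemma homog_scale: "homog d f \<Longrightarrow> homog d (fscale a f)"
  by (auto simp: homog_def)

lemma homog_sum: "(\<And>i. i \<in> S \<Longrightarrow> homog d (f i)) \<Longrightarrow> homog d (\<Sum>i\<in>S. f i)"
  unfolding homog_def sum_fun_apply by (meson sum.not_neutral_contains_not_neutral)

lemma homog_wd: "homog (wwt w) (wd w)"
  by (auto simp: homog_def wd_def)

lemma gwt_unit: "gwt (J (unit r s) k n) = - 2 * n + of_bool r - of_bool s"
  by (cases r; cases s) auto

lemma br_weight:
  assumes "br x y z \<noteq> 0"
  shows "gwt z = gwt x + gwt y"
proof -
  obtain a k n b l m where x: "x = J a k n" and y: "y = J b l m"
    using assms by (cases x; cases y) auto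
  obtain r s where a: "a = unit r s" by (rule unit_cases)
  obtain r' s' where b: "b = unit r' s'" by (rule unit_cases)
  show ?thesis
  proof (cases z)
    case Cb
    then have "Psi n r s (\<lambda>x. ff x k) m r' s' (\<lambda>x. ff x l) \<noteq> 0"
      using assms psi_unit[of r s k n r' s' l m] by (simp add: x y a b del: psi.simps)
    then have "n + m = 0" "s = r'" "r = s'" by (auto simp: Psi_def split: if_splits)
    then show ?thesis unfolding Cb x y a b gwt_unit by simp
  next
    case (J e p q)
    obtain r0 s0 where e: "e = unit r0 s0" by (rule unit_cases)
    have q: "q = n + m" using assms by (auto simp: x y J split: if_splits)
    have f: "fcoef (\<lambda>u. ind (emul a b) e * ff (u + of_int m) k * ff u l
        - ssgn x y * ind (emul b a) e * ff u k * ff (u + of_int n) l) p \<noteq> 0"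
      using assms by (simp add: x y J q)
    have "emul a b = Some e \<or> emul b a = Some e"
    proof (rule ccontr)
      assume "\<not> ?thesis"
      then show False using f by (simp add: ind_def)
    qed
    then have "s = r' \<and> r0 = r \<and> s0 = s' \<or> s' = r \<and> r0 = r' \<and> s0 = s"
      unfolding a b e emul_unit by (auto split: if_splits)
    then show ?thesis unfolding J x y a b e gwt_unit q by auto
  qed
qed

lemma wwt_append [simp]: "wwt (u @ v) = wwt u + wwt v"
  and wwt_Cons [simp]: "wwt (x # v) = gwt x + wwt v"
  and wwt_Nil [simp]: "wwt [] = 0"
  by (simp_all add: wwt_def)

lemma comp_comm_rel: "comp d (comm_rel u x y v) = (if wwt u + gwt x + gwt y + wwt v = d then comm_rel u x y v else 0)"
proof -
  let ?e = "wwt u + gwt x + gwt y + wwt v"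
  have "(\<Sum>z\<in>{z. br x y z \<noteq> 0}. fscale (br x y z) (comp d (wd (u @ [z] @ v))))
      = (\<Sum>z\<in>{z. br x y z \<noteq> 0}. fscale (br x y z) (if ?e = d then wd (u @ [z] @ v) else 0))"
  proof (intro sum.cong refl)
    fix z assume "z \<in> {z. br x y z \<noteq> 0}"
    then have "wwt (u @ [z] @ v) = ?e" using br_weight[of x y z] by simp
    then show "fscale (br x y z) (comp d (wd (u @ [z] @ v))) = fscale (br x y z) (if ?e = d then wd (u @ [z] @ v) else 0)"
      by (simp only: comp_wd)
  qed
  moreover have "wwt (u @ [x, y] @ v) = ?e" "wwt (u @ [y, x] @ v) = ?e" by simp_all
  ultimately show ?thesis
    unfolding comm_rel_eq comp_diff comp_sum comp_scale comp_wd[of d "u @ [x, y] @ v"] comp_wd[of d "u @ [y, x] @ v"]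
    by (cases "?e = d") (simp_all only: simp_thms if_True if_False fs.scale_zero_right sum.neutral_const diff_zero)
qed

lemma comp_ind_rel: "in_SP p \<Longrightarrow> comp d (ind_rel c u p) = (if wwt u + gwt p = d then ind_rel c u p else 0)"
  unfolding ind_rel_eq comp_diff comp_scale comp_wd
  by (cases p) (auto simp: chi_def)

lemma Lrel_comp: "f \<in> Lrel c \<Longrightarrow> comp d f \<in> Lrel c"
proof (induction rule: Lrel_induct)
  case zero
  show ?case unfolding comp_zero by (rule fs.subspace_0[OF Lrel_subspace])
next
  case (comm b u x y v g)
  have "comp d (comm_rel u x y v) \<in> Lrel c"
    unfolding comp_comm_rel using comm_rel_Lrel fs.subspace_0[OF Lrel_subspace] by simp
  then show ?case unfolding comp_add comp_scale
    by (intro fs.subspace_add fs.subspace_scale Lrel_subspace comm)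
next
  case (ind b u p g)
  have "comp d (ind_rel c u p) \<in> Lrel c"
    unfolding comp_ind_rel[OF ind(1)] using ind_rel_Lrel[OF ind(1)] fs.subspace_0[OF Lrel_subspace] by simp
  then show ?case unfolding comp_add comp_scale
    by (intro fs.subspace_add fs.subspace_scale Lrel_subspace ind)
qed

context glmod
begin

lemma foldr_W:
  assumes "v \<in> LF"
  shows "foldr W u v \<in> LF" "foldr W u (a *s v) = a *s foldr W u v"
proof -
  show LF: "foldr W u v \<in> LF" for u using assms by (induction u) (auto simp: W_LF)
  show "foldr W u (a *s v) = a *s foldr W u v" by (induction u) (simp_all add: W_scale[OF LF])
qed

lemma foldr_W_add: "v \<in> LF \<Longrightarrow> w \<in> LF \<Longrightarrow> foldr W u (v + w) = foldr W u v + foldr W u w"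
  by (induction u) (auto simp: W_add foldr_W)

lemma foldr_W_sum: "(\<And>i. i \<in> S \<Longrightarrow> f i \<in> LF) \<Longrightarrow> foldr W u (\<Sum>i\<in>S. f i) = (\<Sum>i\<in>S. foldr W u (f i))"
  by (induction u) (auto simp: W_sum foldr_W)

lemma eval_comm_rel: "eval_tens (comm_rel u x y v) = 0"
proof -
  have LF: "wact v \<in> LF" by (rule wact_LF)
  have eq: "W x (W y (wact v)) = ssgn x y *s W y (W x (wact v)) + (\<Sum>z\<in>{z. br x y z \<noteq> 0}. br x y z *s W z (wact v))"
    by (rule W_comm[OF LF])
  have LF3: "(\<Sum>z\<in>{z. br x y z \<noteq> 0}. br x y z *s W z (wact v)) \<in> LF"
    using LF by (intro subspace_sum[OF LF_subspace] subspace_scale[OF LF_subspace] W_LF)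
  have "wact (u @ [x, y] @ v) = foldr W u (W x (W y (wact v)))" by (simp add: wact_def)
  also have "\<dots> = ssgn x y *s foldr W u (W y (W x (wact v))) + (\<Sum>z\<in>{z. br x y z \<noteq> 0}. br x y z *s foldr W u (W z (wact v)))"
    unfolding eq using LF LF3
    by (simp add: foldr_W_add foldr_W_sum foldr_W W_LF subspace_scale[OF LF_subspace])
  also have "\<dots> = ssgn x y *s wact (u @ [y, x] @ v) + (\<Sum>z\<in>{z. br x y z \<noteq> 0}. br x y z *s wact (u @ [z] @ v))"
    by (simp add: wact_def)
  finally have eq1: "wact (u @ [x, y] @ v) = \<dots>" .
  have "comm_rel u x y v + (fscale (ssgn x y) (wd (u @ [y, x] @ v))
      + (\<Sum>z\<in>{z. br x y z \<noteq> 0}. fscale (br x y z) (wd (u @ [z] @ v)))) = wd (u @ [x, y] @ v)"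
    unfolding comm_rel_eq by (simp only: diff_diff_eq diff_add_cancel)
  then have eq2: "eval_tens (comm_rel u x y v) + (ssgn x y *s wact (u @ [y, x] @ v)
      + (\<Sum>z\<in>{z. br x y z \<noteq> 0}. br x y z *s wact (u @ [z] @ v))) = wact (u @ [x, y] @ v)"
  proof -
    have T: "fscale (ssgn x y) (wd (u @ [y, x] @ v)) \<in> Tfin" "\<And>z. fscale (br x y z) (wd (u @ [z] @ v)) \<in> Tfin"
      "(\<Sum>z\<in>{z. br x y z \<noteq> 0}. fscale (br x y z) (wd (u @ [z] @ v))) \<in> Tfin"
      by (intro fs.subspace_sum[OF Tfin_subspace] fs.subspace_scale[OF Tfin_subspace] wd_Tfin)+
    assume "comm_rel u x y v + (fscale (ssgn x y) (wd (u @ [y, x] @ v))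
      + (\<Sum>z\<in>{z. br x y z \<noteq> 0}. fscale (br x y z) (wd (u @ [z] @ v)))) = wd (u @ [x, y] @ v)"
    from arg_cong[OF this, of eval_tens] show ?thesis
      unfolding eval_add[OF comm_rel_Tfin fs.subspace_add[OF Tfin_subspace T(1,3)]] eval_add[OF T(1,3)]
        eval_sum[OF T(2)] eval_scale eval_wd .
  qed
  show ?thesis by (rule add_right_imp_eq) (unfold add_0_left, rule eq2[unfolded eq1])
qed

lemma eval_ind_rel:
  assumes "in_SP p"
  shows "eval_tens (ind_rel c u p) = 0"
proof -
  have "ind_rel c u p + fscale (chi c p) (wd u) = wd (u @ [p])"
    unfolding ind_rel_eq by (simp only: diff_add_cancel)
  from arg_cong[OF this, of eval_tens]
  have "eval_tens (ind_rel c u p) + chi c p *s wact u = wact (u @ [p])"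
    unfolding eval_add[OF ind_rel_Tfin fs.subspace_scale[OF Tfin_subspace wd_Tfin]] eval_scale eval_wd .
  moreover have "wact (u @ [p]) = chi c p *s wact u"
    using W_vac[OF assms] by (simp add: wact_def foldr_W[OF LF_vac])
  ultimately show ?thesis by simp
qed

text \<open>Evaluation thus descends to the vacuum module, and a tensor with nonzero value
  represents a nonzero vector there.\<close>

lemma eval_Lrel: "f \<in> Lrel c \<Longrightarrow> eval_tens f = 0"
proof -
  assume "f \<in> Lrel c"
  then have "f \<in> Tfin \<and> eval_tens f = 0"
  proof (induction rule: Lrel_induct)
    case zero
    have "eval_tens 0 = 0" by (simp add: eval_tens_def)
    then show ?case using fs.subspace_0[OF Tfin_subspace] by blast
  next
    case (comm b u x y v g)
    have "fscale b (comm_rel u x y v) \<in> Tfin" by (intro fs.subspace_scale[OF Tfin_subspace] comm_rel_Tfin)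
    then show ?case using comm fs.subspace_add[OF Tfin_subspace]
      by (simp only: eval_add eval_scale eval_comm_rel scale_zero_right add_0_left simp_thms)
  next
    case (ind b u p g)
    have "fscale b (ind_rel c u p) \<in> Tfin" by (intro fs.subspace_scale[OF Tfin_subspace] ind_rel_Tfin)
    then show ?case using ind fs.subspace_add[OF Tfin_subspace]
      by (simp only: eval_add eval_scale eval_ind_rel scale_zero_right add_0_left simp_thms)
  qed
  then show ?thesis ..
qed

lemma eval_act:
  assumes "f \<in> Tfin"
  shows "eval_tens (act x f) = W x (eval_tens f)"
  using assms
proof (induction rule: Tfin_induct)
  case zero
  have "eval_tens 0 = 0" by (simp add: eval_tens_def)
  then show ?case by (simp only: act_zero W_zero)
next
  case (step a w g)
  have T: "fscale a (wd w) \<in> Tfin" "fscale a (wd (x # w)) \<in> Tfin"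
    by (intro fs.subspace_scale[OF Tfin_subspace] wd_Tfin)+
  have "eval_tens (act x (fscale a (wd w) + g)) = a *s wact (x # w) + W x (eval_tens g)"
    unfolding act_add act_scale act_wd eval_add[OF T(2) act_Tfin[OF step(1)]] eval_scale eval_wd step(2) ..
  also have "a *s wact (x # w) = W x (a *s wact w)" using W_scale[OF wact_LF] by (simp add: wact_def)
  also have "W x (a *s wact w) + W x (eval_tens g) = W x (a *s wact w + eval_tens g)"
    by (rule W_add[symmetric]) (intro subspace_scale[OF LF_subspace] wact_LF eval_LF)+
  also have "a *s wact w + eval_tens g = eval_tens (fscale a (wd w) + g)"
    unfolding eval_add[OF T(1) step(1)] eval_scale eval_wd ..
  finally show ?case .
qed

end

lemma (in glmod) pr_wspan: "pr d = d \<Longrightarrow> v \<in> wspan R d \<Longrightarrow> pr v = v"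
  unfolding wspan_def
  by (rotate_tac, induction rule: span_induct_alt) (auto simp: pr_add pr_scale pr_ew pr_zero)

text \<open>A basis \<open>B1\<close> of \<open>L\<close> is extended to a basis \<open>B2\<close>
  of \<open>T\<close>, and \<open>B1\<close> is sent to 0. The linear extension takes its values in
  the span of the images of \<open>B2\<close> even at arguments outside \<open>T\<close>, which
  makes \<open>p\<close> total.\<close>

lemma linear_projection:
  assumes "fs.subspace L" "fs.subspace T" "L \<subseteq> T"
  obtains p :: "('a \<Rightarrow> complex) \<Rightarrow> ('a \<Rightarrow> complex)" where
    "\<And>f g. p (f + g) = p f + p g" "\<And>a f. p (fscale a f) = fscale a (p f)"
    "\<And>f. p f \<in> T" "\<And>f. f \<in> T \<Longrightarrow> p f - f \<in> L" "\<And>f. f \<in> L \<Longrightarrow> p f = 0" "\<And>f. p (p f) = p f"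
proof -
  interpret fsp: vector_space_pair fscale fscale
    by (rule vector_space_pair.intro) (rule vector_space_fscale)+
  obtain B1 where B1: "B1 \<subseteq> L" "fs.independent B1" "L \<subseteq> fs.span B1"
    using fs.maximal_independent_subset[of L] by blast
  obtain B2 where B2: "B1 \<subseteq> B2" "B2 \<subseteq> T" "fs.independent B2" "T \<subseteq> fs.span B2"
    using fs.maximal_independent_subset_extend[of B1 T] B1 assms(3) by (metis order_trans)
  define g where "g = (\<lambda>b. if b \<in> B1 then 0 else b)"
  define p where "p = fsp.construct B2 g"
  have lin: "Vector_Spaces.linear fscale fscale p"
    unfolding p_def by (rule fsp.linear_construct[OF B2(3)])
  interpret p: Vector_Spaces.linear fscale fscale p by (rule lin)
  have basis: "p b = g b" if "b \<in> B2" for b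
    unfolding p_def by (rule fsp.construct_basis[OF B2(3) that])
  have zero: "p f = 0" if "f \<in> L" for f
  proof -
    have "f \<in> fs.span B1" using that B1(3) by blast
    then show ?thesis
    proof (induction rule: fs.span_induct_alt)
      case base
      show ?case by (rule p.zero)
    next
      case (step a x y)
      have "p x = 0" using basis[of x] step(1) B2(1) by (auto simp only: g_def if_True)
      then show ?case unfolding p.add p.scale step(2) by (simp only: fs.scale_zero_right add_0_left)
    qed
  qed
  have range: "p f \<in> fs.span (g ` B2)" for f
    unfolding p_def by (rule fsp.construct_in_span[OF B2(3)])
  have gT: "g ` B2 \<subseteq> T"
    using B2(2) fs.subspace_0[OF assms(2)] by (auto simp only: g_def split: if_splits)
  have diff: "p f - f \<in> L" if "f \<in> T" for f
  proof -
    have "f \<in> fs.span B2" using that B2(4) by blast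
    then show ?thesis
    proof (induction rule: fs.span_induct_alt)
      case base
      show ?case unfolding p.zero diff_0_right by (rule fs.subspace_0[OF assms(1)])
    next
      case (step a x y)
      have "p x - x \<in> L"
      proof (cases "x \<in> B1")
        case True
        then have "p x - x = - x" using basis[OF step(1)] by (simp only: g_def if_True diff_0)
        then show ?thesis using True B1(1) fs.subspace_neg[OF assms(1), of x] by (simp only: subsetD)
      next
        case False
        then have "p x - x = 0" using basis[OF step(1)] by (simp only: g_def if_False diff_self)
        then show ?thesis using fs.subspace_0[OF assms(1)] by (simp only:)
      qed
      moreover have "p (fscale a x + y) - (fscale a x + y) = fscale a (p x - x) + (p y - y)"
        unfolding p.add p.scale fs.scale_right_diff_distrib by (simp only: add_diff_add)
      ultimately show ?case
        using step(2) fs.subspace_add[OF assms(1)] fs.subspace_scale[OF assms(1)] by (simp only:)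
    qed
  qed
  have idem: "p h = h" if "h \<in> fs.span (g ` B2)" for h
    using that
  proof (induction rule: fs.span_induct_alt)
    case base
    show ?case by (rule p.zero)
  next
    case (step a x y)
    from step(1) obtain b where b: "b \<in> B2" "x = g b" by blast
    have "p x = x"
    proof (cases "b \<in> B1")
      case True
      then have "x = 0" using b(2) by (simp only: g_def if_True)
      then show ?thesis using p.zero by (simp only:)
    next
      case False
      then have "x = b" using b(2) by (simp only: g_def if_False)
      then show ?thesis using basis[OF b(1)] b(2) by (simp only:)
    qed
    then show ?case unfolding p.add p.scale step(2) by (simp only:)
  qed
  show thesis
  proof (rule that)
    show "p (f + g) = p f + p g" for f g by (rule p.add)
    show "p (fscale a f) = fscale a (p f)" for a f by (rule p.scale)
    show "p f \<in> T" for f using range fs.span_minimal[OF gT assms(2)] by blast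
    show "p (p f) = p f" for f by (rule idem[OF range])
  qed (fact diff zero)+
qed

lemma act_comm_Lrel:
  assumes "g \<in> Tfin"
  shows "act x (act y g) - fscale (ssgn x y) (act y (act x g))
    - (\<Sum>z\<in>{z. br x y z \<noteq> 0}. fscale (br x y z) (act z g)) \<in> Lrel c" (is "?R g \<in> _")
  using assms
proof (induction rule: Tfin_induct)
  case zero
  have "?R 0 = 0" by (simp only: act_zero fs.scale_zero_right sum.neutral_const diff_zero)
  then show ?case using fs.subspace_0[OF Lrel_subspace] by (simp only:)
next
  case (step a w g)
  have "?R (wd w) = comm_rel [] x y w"
    unfolding comm_rel_eq by (simp only: act_wd append_Nil append_Cons)
  moreover have "?R (fscale a (wd w) + g) = fscale a (?R (wd w)) + ?R g"
    unfolding act_add act_scale by (rule ext) (simp add: sum_fun_apply sum.distrib sum_distrib_left algebra_simps)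
  ultimately have "?R (fscale a (wd w) + g) = fscale a (comm_rel [] x y w) + ?R g" by (simp only:)
  moreover have "fscale a (comm_rel [] x y w) + ?R g \<in> Lrel c"
    by (intro fs.subspace_add fs.subspace_scale Lrel_subspace comm_rel_Lrel step(2))
  ultimately show ?case by (simp only:)
qed

text \<open>All brackets with \<open>Cb\<close> vanish, so it moves to the right end of each word,
  where the induction relation replaces it by the scalar.\<close>

lemma act_central_Lrel:
  assumes "g \<in> Tfin"
  shows "act Cb g - fscale c g \<in> Lrel c"
proof -
  have word: "wd (Cb # w) - fscale c (wd w) \<in> Lrel c" for w
  proof (induction w)
    case Nil
    have "ind_rel c [] Cb = wd [Cb] - fscale c (wd [])" by (simp add: ind_rel_eq chi_def)
    moreover have "in_SP Cb" by (simp add: in_SP_def)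
    ultimately show ?case using ind_rel_Lrel[of Cb c "[]"] by (simp only:)
  next
    case (Cons x w)
    have "comm_rel [] Cb x w = wd (Cb # x # w) - wd (x # Cb # w)"
      unfolding comm_rel_eq by (cases x) (simp_all add: ssgn_def)
    then have "wd (Cb # x # w) - fscale c (wd (x # w))
        = comm_rel [] Cb x w + act x (wd (Cb # w) - fscale c (wd w))"
      by (simp only: act_diff act_scale act_wd) simp
    moreover have "\<dots> \<in> Lrel c"
      by (intro fs.subspace_add Lrel_subspace comm_rel_Lrel Lrel_act Cons)
    ultimately show ?case by (simp only:)
  qed
  show ?thesis using assms
  proof (induction rule: Tfin_induct)
    case zero
    show ?case unfolding act_zero fs.scale_zero_right diff_zero by (rule fs.subspace_0[OF Lrel_subspace])
  next
    case (step a w g)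
    have "act Cb (fscale a (wd w) + g) - fscale c (fscale a (wd w) + g)
        = fscale a (wd (Cb # w) - fscale c (wd w)) + (act Cb g - fscale c g)"
      unfolding act_add act_scale act_wd by (rule ext) (simp add: algebra_simps)
    moreover have "\<dots> \<in> Lrel c"
      by (intro fs.subspace_add fs.subspace_scale Lrel_subspace word step(2))
    ultimately show ?case by (simp only:)
  qed
qed

text \<open>The vacuum module is realised inside the tensor space as the range of a linear
  projection \<open>p\<close> of \<open>Tfin\<close> along the relations.\<close>
locale vacmod =
  fixes c :: complex and p :: "tens \<Rightarrow> tens"
  assumes p_add: "p (f + g) = p f + p g"
    and p_scale: "p (fscale a f) = fscale a (p f)"
    and p_Tfin: "p f \<in> Tfin"
    and p_diff_Lrel: "f \<in> Tfin \<Longrightarrow> p f - f \<in> Lrel c"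
    and p_Lrel: "f \<in> Lrel c \<Longrightarrow> p f = 0"
    and p_idem: "p (p f) = p f"
begin

lemma p_zero: "p 0 = 0"
  by (rule p_Lrel) (rule fs.subspace_0[OF Lrel_subspace])

lemma p_diff: "p (f - g) = p f - p g"
proof -
  have "p (f - g) + p g = p f" unfolding p_add[symmetric] diff_add_cancel ..
  then show ?thesis by (rule add_implies_diff)
qed

lemma p_sum: "p (\<Sum>i\<in>S. f i) = (\<Sum>i\<in>S. p (f i))"
  by (induction S rule: infinite_finite_induct)
    (simp_all only: sum.infinite sum.empty sum.insert p_zero p_add not_False_eq_True)

lemma p_eq_iff:
  assumes "f \<in> Tfin" "g \<in> Tfin"
  shows "p f = p g \<longleftrightarrow> f - g \<in> Lrel c"
proof
  assume "p f = p g"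
  then have "(p g - g) - (p f - f) = f - g" by simp
  moreover have "(p g - g) - (p f - f) \<in> Lrel c"
    by (rule fs.subspace_diff[OF Lrel_subspace]) (simp_all only: p_diff_Lrel assms)
  ultimately show "f - g \<in> Lrel c" by (simp only:)
next
  assume "f - g \<in> Lrel c"
  then have "p f - p g = 0" unfolding p_diff[symmetric] by (rule p_Lrel)
  then show "p f = p g" by (simp only: right_minus_eq)
qed

lemma p_eq_0_iff: "f \<in> Tfin \<Longrightarrow> p f = 0 \<longleftrightarrow> f \<in> Lrel c"
  using p_eq_iff[of f 0] fs.subspace_0[OF Tfin_subspace] by (simp only: p_zero diff_zero)

lemma p_act: "f \<in> Tfin \<Longrightarrow> p (act x (p f)) = p (act x f)"
  by (subst p_eq_iff) (simp_all only: act_Tfin p_Tfin act_diff[symmetric] Lrel_act p_diff_Lrel)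

abbreviation Ap :: "gb \<Rightarrow> tens \<Rightarrow> tens" where
  "Ap x v \<equiv> p (act x (p v))"

lemma Ap_p: "f \<in> Tfin \<Longrightarrow> Ap x (p f) = p (act x f)"
  unfolding p_idem by (rule p_act)

lemma p_wd: "p (wd w) = foldr Ap w (p (wd []))"
proof (induction w)
  case (Cons x w)
  have "p (wd (x # w)) = Ap x (p (wd w))" using Ap_p[OF wd_Tfin, of x w] by (simp only: act_wd)
  then show ?case unfolding Cons by (simp only: foldr.simps comp_apply o_apply)
qed simp

lemma p_in_span:
  assumes "f \<in> Tfin"
  shows "p f \<in> fs.span {foldr Ap w (p (wd [])) | w. True}"
  using assms
proof (induction rule: Tfin_induct)
  case zero
  show ?case unfolding p_zero by (rule fs.span_zero)
next
  case (step a w g)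
  have "p (wd w) \<in> fs.span {foldr Ap w (p (wd [])) | w. True}"
    by (rule fs.span_base) (use p_wd in blast)
  then show ?case unfolding p_add p_scale using step(2) by (intro fs.span_add fs.span_scale)
qed

lemma Ap_comm:
  "Ap x (Ap y v) = fscale (ssgn x y) (Ap y (Ap x v)) + (\<Sum>z\<in>{z. br x y z \<noteq> 0}. fscale (br x y z) (Ap z v))"
proof -
  define g where "g = p v"
  have g: "g \<in> Tfin" unfolding g_def by (rule p_Tfin)
  have 2: "Ap a (p (act b g)) = p (act a (act b g))" for a b
    by (rule Ap_p[OF act_Tfin[OF g]])
  have "p (act x (act y g) - fscale (ssgn x y) (act y (act x g))
    - (\<Sum>z\<in>{z. br x y z \<noteq> 0}. fscale (br x y z) (act z g))) = 0"
    by (rule p_Lrel[OF act_comm_Lrel[OF g]])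
  then show ?thesis
    unfolding g_def[symmetric] 2 p_diff p_scale p_sum by (simp only: diff_diff_eq right_minus_eq)
qed

lemma Ap_central: "Ap Cb v = fscale c (p v)"
proof -
  have "p (act Cb (p v) - fscale c (p v)) = 0" by (rule p_Lrel[OF act_central_Lrel[OF p_Tfin]])
  then show ?thesis unfolding p_diff p_scale p_idem by (simp only: right_minus_eq)
qed

lemma Ap_vac:
  assumes "in_SP x"
  shows "Ap x (p (wd [])) = fscale (chi c x) (p (wd []))"
proof -
  have "p (ind_rel c [] x) = 0" by (rule p_Lrel[OF ind_rel_Lrel[OF assms]])
  then have "p (wd [x]) = fscale (chi c x) (p (wd []))"
    unfolding ind_rel_eq p_diff p_scale append_Nil by (simp only: right_minus_eq)
  then show ?thesis using Ap_p[OF wd_Tfin, of x "[]"] by (simp only: act_wd)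
qed

sublocale sdmod fscale p Ap "p (wd [])" c
proof (rule sdmod.intro[OF vector_space_fscale], unfold_locales)
  fix f g :: tens and a :: complex and x y :: gb
  show "p (f + g) = p f + p g" by (rule p_add)
  show "p (fscale a f) = fscale a (p f)" by (rule p_scale)
  show "p (p f) = p f" by (rule p_idem)
  show "p (Ap x f) = Ap x f" by (rule p_idem)
  show "Ap x (p f) = Ap x f" unfolding p_idem ..
  show "p (p (wd [])) = p (wd [])" by (rule p_idem)
  show "Ap x (f + g) = Ap x f + Ap x g" unfolding p_add act_add ..
  show "Ap x (fscale a f) = fscale a (Ap x f)" unfolding p_scale act_scale ..
  show "Ap x (Ap y f) = fscale (ssgn x y) (Ap y (Ap x f)) + (\<Sum>z\<in>{z. br x y z \<noteq> 0}. fscale (br x y z) (Ap z f))"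
    by (rule Ap_comm)
  show "Ap Cb f = fscale c (p f)" by (rule Ap_central)
  show "Ap x (p (wd [])) = fscale (chi c x) (p (wd []))" if "in_SP x" by (rule Ap_vac[OF that])
  show "\<exists>u \<in> fs.span {foldr Ap w (p (wd [])) | w. True}. \<forall>x. Ap x f = Ap x u"
  proof (rule bexI)
    show "p f \<in> fs.span {foldr Ap w (p (wd [])) | w. True}"
      using p_in_span[OF p_Tfin, of f] unfolding p_idem .
    show "\<forall>x. Ap x f = Ap x (p f)" unfolding p_idem by blast
  qed
qed

end

section \<open>The maximal submodule\<close>

lemma submod_iff:
  "submod c W \<longleftrightarrow> W \<subseteq> Tfin \<and> Lrel c \<subseteq> W \<and> fs.subspace W \<and> (\<forall>f\<in>W. \<forall>x. act x f \<in> W)"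
proof -
  have "0 \<in> W" if "Lrel c \<subseteq> W" using that fs.subspace_0[OF Lrel_subspace] by blast
  then show ?thesis unfolding submod_def fs.subspace_def plus_fun_def fscale_def by blast
qed

lemma foldr_act_closed: "(\<And>f x. f \<in> W \<Longrightarrow> act x f \<in> W) \<Longrightarrow> f \<in> W \<Longrightarrow> foldr act u f \<in> W"
  by (induction u) simp_all

lemma foldr_act_add: "foldr act u (f + g) = foldr act u f + foldr act u g"
  by (induction u) (simp_all only: foldr.simps o_apply id_apply act_add)

lemma foldr_act_scale: "foldr act u (fscale a f) = fscale a (foldr act u f)"
  by (induction u) (simp_all only: foldr.simps o_apply id_apply act_scale)

lemma foldr_act_zero: "foldr act u 0 = 0"
  by (induction u) (simp_all only: foldr.simps o_apply id_apply act_zero)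

lemma foldr_act_wd: "foldr act u (wd w) = wd (u @ w)"
  by (induction u) simp_all

lemma comp_foldr_act: "comp d (foldr act u f) = foldr act u (comp (d - wwt u) f)"
  by (induction u arbitrary: d) (simp_all add: comp_act algebra_simps)

lemma submod_eq_Tfin:
  assumes "submod c W" "wd [] \<in> W"
  shows "W = Tfin"
proof
  show "W \<subseteq> Tfin" using assms(1) by (simp add: submod_iff)
  have W: "fs.subspace W" "\<And>f x. f \<in> W \<Longrightarrow> act x f \<in> W" using assms(1) by (auto simp: submod_iff)
  have word: "wd w \<in> W" for w
    using foldr_act_closed[of W "wd []" w] W(2) assms(2) by (simp add: foldr_act_wd)
  show "Tfin \<subseteq> W"
  proof
    fix f assume "f \<in> Tfin"
    then show "f \<in> W"
    proof (induction rule: Tfin_induct)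
      case zero
      show ?case by (rule fs.subspace_0[OF W(1)])
    next
      case (step a w g)
      then show ?case by (intro fs.subspace_add[OF W(1)] fs.subspace_scale[OF W(1)] word)
    qed
  qed
qed

text \<open>The vectors from which no element of the enveloping algebra leads back to the vacuum.\<close>
definition Rad :: "complex \<Rightarrow> tens set" where
  "Rad c = {f \<in> Tfin. \<forall>u. comp 0 (foldr act u f) \<in> Lrel c}"

lemma Rad_submod: "submod c (Rad c)"
  unfolding submod_iff
proof (intro conjI ballI allI)
  show "Rad c \<subseteq> Tfin" by (auto simp: Rad_def)
  show "Lrel c \<subseteq> Rad c"
    using foldr_act_closed[of "Lrel c"] Lrel_act Lrel_Tfin Lrel_comp unfolding Rad_def by blast
  show "fs.subspace (Rad c)"
  proof (rule fs.subspaceI)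
    show "0 \<in> Rad c"
      unfolding Rad_def foldr_act_zero comp_zero mem_Collect_eq
      using fs.subspace_0[OF Tfin_subspace] fs.subspace_0[OF Lrel_subspace] by blast
    show "f + g \<in> Rad c" if "f \<in> Rad c" "g \<in> Rad c" for f g
      using that fs.subspace_add[OF Tfin_subspace] fs.subspace_add[OF Lrel_subspace]
      unfolding Rad_def foldr_act_add comp_add mem_Collect_eq by blast
    show "fscale a f \<in> Rad c" if "f \<in> Rad c" for a f
      using that fs.subspace_scale[OF Tfin_subspace] fs.subspace_scale[OF Lrel_subspace]
      unfolding Rad_def foldr_act_scale comp_scale mem_Collect_eq by blast
  qed
  fix f x assume f: "f \<in> Rad c"
  have "foldr act u (act x f) = foldr act (u @ [x]) f" for u by simp
  then show "act x f \<in> Rad c" using f act_Tfin unfolding Rad_def mem_Collect_eq by metis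
qed

lemma Rad_graded: "graded (Rad c)"
  unfolding graded_def
proof (intro ballI allI)
  fix f d assume f: "f \<in> Rad c"
  have "comp 0 (foldr act u (comp d f)) \<in> Lrel c" for u
  proof (cases "0 - wwt u = d")
    case True
    then have "comp 0 (foldr act u (comp d f)) = comp 0 (foldr act u f)"
      unfolding comp_foldr_act comp_comp by simp
    then show ?thesis using f by (simp add: Rad_def)
  next
    case False
    then have "comp 0 (foldr act u (comp d f)) = 0"
      unfolding comp_foldr_act comp_comp by (simp only: if_False foldr_act_zero)
    then show ?thesis using fs.subspace_0[OF Lrel_subspace] by (simp only:)
  qed
  then show "comp d f \<in> Rad c" using f comp_Tfin unfolding Rad_def by blast
qed

lemma vac_not_Rad:
  assumes "wd [] \<notin> Lrel c"
  shows "wd [] \<notin> Rad c"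
proof
  assume "wd [] \<in> Rad c"
  then have "comp 0 (foldr act [] (wd [])) \<in> Lrel c" unfolding Rad_def by blast
  then show False using assms by (simp only: foldr.simps id_apply comp_wd wwt_Nil simp_thms if_True)
qed

section \<open>Leading terms and the largest proper graded submodule\<close>

context vacmod
begin

definition H :: "int \<Rightarrow> tens set" where
  "H d = {p f | f. f \<in> Tfin \<and> homog d f}"

lemma H_I: "f \<in> Tfin \<Longrightarrow> homog d f \<Longrightarrow> p f \<in> H d"
  unfolding H_def by blast

lemma H_scale: "v \<in> H d \<Longrightarrow> fscale a v \<in> H d"
proof -
  assume "v \<in> H d"
  then obtain f where f: "v = p f" "f \<in> Tfin" "homog d f" unfolding H_def by blast
  show ?thesis unfolding f(1) p_scale[symmetric]
    by (intro H_I fs.subspace_scale[OF Tfin_subspace] homog_scale f)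
qed

lemma H_sum: "(\<And>i. i \<in> S \<Longrightarrow> f i \<in> H d) \<Longrightarrow> (\<Sum>i\<in>S. f i) \<in> H d"
proof -
  assume "\<And>i. i \<in> S \<Longrightarrow> f i \<in> H d"
  then have "\<forall>i\<in>S. \<exists>g. f i = p g \<and> g \<in> Tfin \<and> homog d g" unfolding H_def by blast
  then obtain g where g: "\<And>i. i \<in> S \<Longrightarrow> f i = p (g i) \<and> g i \<in> Tfin \<and> homog d (g i)" by metis
  have "(\<Sum>i\<in>S. f i) = p (\<Sum>i\<in>S. g i)" unfolding p_sum using g by (intro sum.cong) blast+
  moreover have "p (\<Sum>i\<in>S. g i) \<in> H d"
    using g by (intro H_I fs.subspace_sum[OF Tfin_subspace] homog_sum) blast+
  ultimately show ?thesis by (simp only:)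
qed

lemma H_Ap: "v \<in> H d \<Longrightarrow> Ap x v \<in> H (d + gwt x)"
proof -
  assume "v \<in> H d"
  then obtain f where f: "v = p f" "f \<in> Tfin" "homog d f" unfolding H_def by blast
  show ?thesis unfolding f(1) Ap_p[OF f(2)] by (intro H_I act_Tfin homog_act f)
qed

text \<open>Here the labelling pays off: every generator that interpolates \<open>E h k\<close> has
  doubled weight \<open>h - k\<close>.\<close>

lemma H_E:
  assumes "v \<in> H d"
  shows "E h k v \<in> H (d + (h - k))"
proof -
  have w: "gwt (J (unit (odd h) (odd k)) q (ix h - ix k)) = h - k" for q
    unfolding gwt_unit ix_def by (cases "odd h"; cases "odd k") (auto elim!: oddE evenE)
  have "Ap (J (unit (odd h) (odd k)) q (ix h - ix k)) v \<in> H (d + (h - k))" for q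
    using H_Ap[OF assms, of "J (unit (odd h) (odd k)) q (ix h - ix k)"] unfolding w .
  then have "(\<Sum>q\<in>fsupp P. fscale (fcoef P q) (Ap (J (unit (odd h) (odd k)) q (ix h - ix k)) v)) \<in> H (d + (h - k))" for P
    by (intro H_sum H_scale)
  from H_scale[OF this, where a = "-1"] show ?thesis
    unfolding E_def B_def fs.scale_minus_left fs.scale_one .
qed

lemma vac_H: "p (wd []) \<in> H 0"
  using H_I[OF wd_Tfin homog_wd, of "[]"] by simp

lemma Dv_H: "Dv n \<in> H (2 * int n + 1)"
proof (induction n)
  case 0
  show ?case using H_E[OF vac_H, of 2 1] unfolding Dv_def funpow.simps id_apply by simp
next
  case (Suc n)
  have "2 * int n + 1 + (2 - 0) = 2 * int (Suc n) + 1" by simp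
  then show ?case using H_E[OF Suc, of 2 0] unfolding Dv_def funpow.simps o_apply by (simp only:)
qed

lemma ew_H:
  assumes v: "v \<in> H e" and R: "\<And>h k. R (h, k) \<Longrightarrow> k < h"
  shows "list_all R ws \<Longrightarrow> \<exists>d. ew ws v \<in> H d \<and> e \<le> d \<and> (ws \<noteq> [] \<longrightarrow> e < d)"
proof (induction ws)
  case Nil
  show ?case unfolding ew_Nil using v by blast
next
  case (Cons x ws)
  obtain h k where x: "x = (h, k)" by force
  have "list_all R ws" using Cons(2) by simp
  then obtain d where d: "ew ws v \<in> H d" "e \<le> d" using Cons(1) by blast
  have "k < h" using Cons(2) R x by simp
  then have "e < d + (h - k)" using d(2) by simp
  then show ?case unfolding x ew_Cons using H_E[OF d(1)] less_imp_le by blast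
qed

text \<open>Each letter with \<open>k < h\<close> strictly raises the weight, so the empty word
  alone contributes in weight at most \<open>e\<close>. The lemma is used for the vacuum as well as
  for the singular vector.\<close>

lemma wspan_leading:
  assumes Df: "Df \<in> Tfin" "homog e Df" and R: "\<And>h k. R (h, k) \<Longrightarrow> k < h"
    and v: "v \<in> wspan R (p Df)"
  shows "\<exists>s g. g \<in> Tfin \<and> (\<forall>d\<le>e. comp d g = 0) \<and> v = p (fscale s Df + g)"
proof -
  define S where "S = {v. \<exists>s g. g \<in> Tfin \<and> (\<forall>d\<le>e. comp d g = 0) \<and> v = p (fscale s Df + g)}"
  have SI: "p (fscale s Df + g) \<in> S" if "g \<in> Tfin" "\<And>d. d \<le> e \<Longrightarrow> comp d g = 0" for s g
    unfolding S_def using that by blast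
  have "fs.subspace S"
  proof (rule fs.subspaceI)
    have "p (fscale 0 Df + 0) \<in> S"
      by (rule SI[OF fs.subspace_0[OF Tfin_subspace] comp_zero])
    then show "0 \<in> S" unfolding fs.scale_zero_left add_0_left p_zero .
    show "u + v \<in> S" if "u \<in> S" "v \<in> S" for u v
    proof -
      from that obtain s g t h where
        u: "g \<in> Tfin" "\<And>d. d \<le> e \<Longrightarrow> comp d g = 0" "u = p (fscale s Df + g)" and
        v: "h \<in> Tfin" "\<And>d. d \<le> e \<Longrightarrow> comp d h = 0" "v = p (fscale t Df + h)"
        unfolding S_def by blast
      have "u + v = p (fscale (s + t) Df + (g + h))"
        unfolding u v p_add[symmetric] fs.scale_left_distrib by (simp only: ac_simps)
      moreover have "\<dots> \<in> S"
        by (rule SI) (simp_all only: fs.subspace_add[OF Tfin_subspace] u(1,2) v(1,2) comp_add add_0_left)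
      ultimately show ?thesis by (simp only:)
    qed
    show "fscale a u \<in> S" if "u \<in> S" for a u
    proof -
      from that obtain s g where
        u: "g \<in> Tfin" "\<And>d. d \<le> e \<Longrightarrow> comp d g = 0" "u = p (fscale s Df + g)"
        unfolding S_def by blast
      have "fscale a u = p (fscale (a * s) Df + fscale a g)"
        unfolding u p_scale[symmetric] fs.scale_right_distrib fs.scale_scale ..
      moreover have "\<dots> \<in> S"
        by (rule SI) (simp_all only: fs.subspace_scale[OF Tfin_subspace] u(1,2) comp_scale fs.scale_zero_right)
      ultimately show ?thesis by (simp only:)
    qed
  qed
  moreover have "ew ws (p Df) \<in> S" if ws: "list_all R ws" for ws
  proof (cases "ws = []")
    case True
    have "p (fscale 1 Df + 0) \<in> S"
      by (rule SI[OF fs.subspace_0[OF Tfin_subspace] comp_zero])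
    then show ?thesis unfolding True ew_Nil fs.scale_one add_0_right .
  next
    case False
    then obtain d where d: "e < d" "ew ws (p Df) \<in> H d"
      using ew_H[OF H_I[OF Df], of R ws] R ws by blast
    then obtain g where g: "g \<in> Tfin" "homog d g" "ew ws (p Df) = p g"
      unfolding H_def by blast
    have "comp d' g = 0" if "d' \<le> e" for d'
      using comp_homog[OF g(2), of d'] that d(1) by (simp only: if_False less_le_not_le) auto
    from SI[OF g(1) this, of 0] show ?thesis
      unfolding g(3) fs.scale_zero_left add_0_left .
  qed
  ultimately have "wspan R (p Df) \<subseteq> S"
    unfolding wspan_def by (intro fs.span_minimal) blast+
  then show ?thesis using v unfolding S_def by blast
qed

text \<open>A representing tensor is determined only up to relations; these are graded, so the
  leading term can be read off component by component.\<close>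

lemma leading_comp:
  assumes Df: "Df \<in> Tfin" "homog e Df" and R: "\<And>h k. R (h, k) \<Longrightarrow> k < h"
    and f: "f \<in> Tfin" "p f \<in> wspan R (p Df)"
  shows "\<exists>s. comp e f - fscale s Df \<in> Lrel c" "d < e \<Longrightarrow> comp d f \<in> Lrel c"
proof -
  obtain s g where g: "g \<in> Tfin" "\<And>d. d \<le> e \<Longrightarrow> comp d g = 0" "p f = p (fscale s Df + g)"
    using wspan_leading[OF Df R f(2)] by blast
  have "f - (fscale s Df + g) \<in> Lrel c"
    using g(3) p_eq_iff[OF f(1) fs.subspace_add[OF Tfin_subspace fs.subspace_scale[OF Tfin_subspace Df(1)] g(1)]]
    by blast
  then have *: "comp d f - (fscale s (comp d Df) + comp d g) \<in> Lrel c" for d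
    using Lrel_comp[of "f - (fscale s Df + g)" c d] unfolding comp_diff comp_add comp_scale by blast
  show "\<exists>s. comp e f - fscale s Df \<in> Lrel c"
    using *[of e] g(2)[of e] comp_homog[OF Df(2), of e]
    by (intro exI[of _ s]) (simp only: simp_thms if_True add_0_right order_refl)
  show "comp d f \<in> Lrel c" if "d < e"
  proof -
    have "comp d g = 0" using g(2) that by simp
    moreover have "comp d Df = 0" using comp_homog[OF Df(2), of d] that by (simp only: less_imp_neq if_False)
    ultimately show ?thesis using *[of d] by (simp only: fs.scale_zero_right add_0_left diff_zero)
  qed
qed

lemma p_in_V0: "f \<in> Tfin \<Longrightarrow> p f \<in> V0"
proof -
  assume "f \<in> Tfin"
  have cl: "fs.subspace V0 \<and> (\<forall>v\<in>V0. \<forall>x. Ap x v \<in> V0)"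
    using stable_iff_A[OF pr_V0] V0_stable by blast
  have "p (wd []) \<in> V0" using ew_in_V0[of "[]"] by simp
  then have "foldr Ap w (p (wd [])) \<in> V0" for w
  proof (induction w)
    case Nil
    then show ?case unfolding foldr.simps id_apply .
  next
    case (Cons x w)
    then show ?case using cl unfolding foldr.simps o_apply by blast
  qed
  then have "fs.span {foldr Ap w (p (wd [])) | w. True} \<subseteq> V0"
    using cl by (intro fs.span_minimal) blast+
  then show ?thesis using p_in_span[OF \<open>f \<in> Tfin\<close>] by blast
qed

text \<open>If a word moved an element of \<open>M\<close> to a vector with nonzero vacuum
  component, gradedness would put the vacuum into \<open>M\<close>, and \<open>M\<close> would be
  everything.\<close>

lemma proper_subset_Rad:
  assumes "submod c M" "graded M" "M \<noteq> Tfin"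
  shows "M \<subseteq> Rad c"
proof
  fix f assume f: "f \<in> M"
  have M: "M \<subseteq> Tfin" "Lrel c \<subseteq> M" "fs.subspace M" "\<And>f x. f \<in> M \<Longrightarrow> act x f \<in> M"
    using assms(1) by (auto simp: submod_iff)
  have "comp 0 (foldr act u f) \<in> Lrel c" for u
  proof -
    define g where "g = foldr act u f"
    have g: "g \<in> M" unfolding g_def by (rule foldr_act_closed[OF M(4) f])
    have R: "create (h, k) \<Longrightarrow> k < h" for h k by (simp add: create_def)
    obtain s where s: "comp 0 g - fscale s (wd []) \<in> Lrel c"
      using leading_comp(1)[where R = create and Df = "wd []" and e = 0 and f = g] R M(1) g
        p_in_V0[of g] homog_wd[of "[]"] unfolding V0_def by (auto simp only: wd_Tfin wwt_Nil)
    show ?thesis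
    proof (cases "s = 0")
      case True
      then show ?thesis using s unfolding g_def fs.scale_zero_left diff_zero by (simp only: fs.scale_zero_left diff_zero)
    next
      case False
      have "comp 0 g \<in> M" "comp 0 g - fscale s (wd []) \<in> M"
        using s M(2) assms(2) g unfolding graded_def by blast+
      then have "comp 0 g - (comp 0 g - fscale s (wd [])) \<in> M" by (rule fs.subspace_diff[OF M(3)])
      then have "fscale s (wd []) \<in> M" by (simp only: diff_diff_eq2 add_diff_cancel_left')
      then have "fscale (1 / s) (fscale s (wd [])) \<in> M" by (rule fs.subspace_scale[OF M(3)])
      moreover have "1 / s * s = 1" using False by simp
      ultimately have "wd [] \<in> M" by (simp only: fs.scale_scale fs.scale_one)
      then show ?thesis using submod_eq_Tfin assms(1,3) by blast
    qed
  qed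
  then show "f \<in> Rad c" using M(1) f unfolding Rad_def by blast
qed

text \<open>The radical is itself graded, and it is proper as it misses the vacuum; so it is the
  largest member of the union.\<close>

lemma SI_eq_Rad:
  assumes "wd [] \<notin> Lrel c"
  shows "SI c = Rad c"
proof -
  have "Rad c \<noteq> Tfin" using vac_not_Rad[OF assms] wd_Tfin by blast
  then show ?thesis unfolding SI_def using Rad_submod Rad_graded proper_subset_Rad by blast
qed

end

section \<open>Nonvanishing of the generator and the ideal it generates\<close>

locale vacmod_nat = vacmod "of_nat n" p for n :: nat and p
begin

abbreviation ev :: "tens \<Rightarrow> nat multiset \<Rightarrow> complex" where
  "ev \<equiv> fock.eval_tens n"

text \<open>On the Fock space the matrix units are given a priori; on a vector of the vacuum module
  they are interpolated by elements of the algebra, and a single interpolating element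
  can be chosen for both.\<close>
lemma E_transfer:
  assumes f: "f \<in> Tfin"
  obtains f' where "f' \<in> Tfin" "p f' = E h k (p f)" "ev f' = Ef n h k (ev f)"
proof -
  define m j r s v w where "m = ix h - ix k" and "j = ix k" and "r = odd h" and "s = odd k"
    and "v = p f" and "w = ev f"
  have w: "w \<in> fock.LF n" unfolding w_def by (rule fock.eval_LF)
  have fin: "finite (abs ` fock.esupp n m r s w)" by (intro finite_imageI fock.LF_D w)
  define N where "N = Max (insert \<bar>j\<bar> (insert (bound v m) (abs ` fock.esupp n m r s w)))"
  have N: "x \<le> N" if "x \<in> insert \<bar>j\<bar> (insert (bound v m) (abs ` fock.esupp n m r s w))" for x
    unfolding N_def using fin that by (intro Max_ge) auto
  have j: "\<bar>j\<bar> \<le> N" and b: "bound v m \<le> N" using N by blast+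
  have supp: "fock.esupp n m r s w \<subseteq> {-N..N}"
  proof
    fix i assume "i \<in> fock.esupp n m r s w"
    then have "\<bar>i\<bar> \<le> N" by (intro N) blast
    then show "i \<in> {-N..N}" by auto
  qed
  define P where "P = lag j N"
  define f' where "f' = fscale (-1) (\<Sum>q\<in>fsupp P. fscale (fcoef P q) (act (J (unit r s) q m) f))"
  have T: "fscale (fcoef P q) (act (J (unit r s) q m) f) \<in> Tfin" for q
    by (intro fs.subspace_scale[OF Tfin_subspace] act_Tfin f)
  have "f' \<in> Tfin"
    unfolding f'_def by (intro fs.subspace_scale[OF Tfin_subspace] fs.subspace_sum[OF Tfin_subspace] T)
  moreover have "p f' = E h k (p f)"
  proof -
    have Ap: "p (act (J (unit r s) q m) f) = Ap (J (unit r s) q m) v" for q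
      unfolding v_def by (rule Ap_p[OF f, symmetric])
    have "p f' = fscale (-1) (\<Sum>q\<in>fsupp P. fscale (fcoef P q) (Ap (J (unit r s) q m) v))"
      unfolding f'_def p_scale p_sum Ap ..
    then have "p f' = B m P (unit r s) v"
      unfolding B_def fs.scale_minus_left fs.scale_one .
    then show ?thesis using E_lag[of v h k N] b unfolding m_def P_def j_def r_def s_def v_def by (simp only:)
  qed
  moreover have "ev f' = Ef n h k (ev f)"
  proof -
    have rc: "erow (unit r s) = r" "ecol (unit r s) = s" by (cases r; cases s; simp)+
    have W: "ev (act (J (unit r s) q m) f) = - fock.bsum n m (\<lambda>x. ff x q) r s w" for q
      unfolding w_def fock.eval_act[OF f] fock.W_def gb.case rc ..
    have "ev f' = fscale (-1) (\<Sum>q\<in>fsupp P. fscale (fcoef P q) (- fock.bsum n m (\<lambda>x. ff x q) r s w))"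
      unfolding f'_def fock.eval_scale fock.eval_sum[OF T] W ..
    also have "\<dots> = (\<Sum>q\<in>fsupp P. fscale (fcoef P q) (fock.bsum n m (\<lambda>x. ff x q) r s w))"
      unfolding fs.scale_minus_right sum_negf fs.scale_minus_left fs.scale_one minus_minus ..
    also have "\<dots> = fock.bsum n m P r s w"
      by (rule fock.bsum_newton) (simp add: P_def)
    also have "\<dots> = (\<Sum>i\<in>{-N..N}. fscale (P (of_int i)) (fock.eop n m r s i w))"
      by (rule fock.bsum_superset[OF finite_atLeastAtMost_int supp])
    also have "\<dots> = (\<Sum>i\<in>{-N..N}. if i = j then fock.eop n m r s j w else 0)"
    proof (intro sum.cong refl)
      fix i assume "i \<in> {-N..N}"
      then have "P (of_int i) = (if i = j then 1 else 0)" unfolding P_def by (intro lag_eq) auto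
      then show "fscale (P (of_int i)) (fock.eop n m r s i w) = (if i = j then fock.eop n m r s j w else 0)"
        by (cases "i = j") (simp_all only: simp_thms if_True if_False fs.scale_one fs.scale_zero_left)
    qed
    also have "\<dots> = fock.eop n m r s j w"
      unfolding sum.delta[OF finite_atLeastAtMost_int] using j by (simp only: atLeastAtMost_iff abs_le_iff if_True minus_le_iff simp_thms)
    also have "\<dots> = Ef n h k w"
    proof -
      have "of_bool r - 2 * (j + m) = h" "of_bool s - 2 * j = k"
        unfolding m_def j_def r_def s_def ix_def by (cases "odd h"; cases "odd k"; auto elim!: oddE evenE)+
      then show ?thesis unfolding fock.eop_def by (simp only:)
    qed
    finally show ?thesis unfolding w_def .
  qed
  ultimately show thesis by (rule that)
qed

text \<open>One tensor represents the vector in the vacuum module and evaluates to its Fock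
  counterpart. The latter is nonzero, so the tensor is not a relation.\<close>

lemma Zv_nonzero: "Zv r \<noteq> 0"
proof -
  have "\<exists>f\<in>Tfin. p f = Zv r \<and> ev f = fock.Zv n r"
  proof (induction r)
    case 0
    have "ev (wd []) = fvac" by (simp only: fock.eval_wd fock.wact_def foldr.simps id_apply)
    then show ?case unfolding Zv_def fock.Zv_def funpow.simps id_apply using wd_Tfin by blast
  next
    case (Suc r)
    then obtain f where f: "f \<in> Tfin" "p f = Zv r" "ev f = fock.Zv n r" by blast
    obtain f' where "f' \<in> Tfin" "p f' = E 2 0 (p f)" "ev f' = Ef n 2 0 (ev f)"
      by (rule E_transfer[OF f(1)])
    then show ?case unfolding f Zv_def fock.Zv_def funpow.simps o_apply by blast
  qed
  then obtain f where f: "f \<in> Tfin" "p f = Zv r" "ev f = fock.Zv n r" by blast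
  have "f \<notin> Lrel (of_nat n)"
    using fock.eval_Lrel[of f n] fock_Zv_nonzero[of n r] unfolding f(3) by blast
  then show ?thesis unfolding f(2)[symmetric] p_eq_0_iff[OF f(1)] .
qed

lemma vac_not_Lrel: "wd [] \<notin> Lrel (of_nat n)"
proof -
  have "Zv 0 = p (wd [])" unfolding Zv_def funpow.simps id_apply ..
  then show ?thesis using Zv_nonzero[of 0] p_eq_0_iff[OF wd_Tfin] by (simp only: simp_thms)
qed

lemma Dv_nonzero: "Dv n \<noteq> 0"
proof
  assume "Dv n = 0"
  then have "Zv (Suc n) = E 1 0 0" using E10_Dv[of n] by (simp only:)
  then show False using Zv_nonzero[of "Suc n"] E_zero[of 1 0] by (simp only: simp_thms)
qed

definition GD :: "tens set" where
  "GD = {f \<in> Tfin. p f \<in> wspan (\<lambda>(h, k). k < h) (Dv n)}"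

lemma GD_submod: "submod (of_nat n) GD"
  unfolding submod_iff
proof (intro conjI ballI allI)
  let ?D = "wspan (\<lambda>(h, k). k < h) (Dv n)"
  have "stable ?D \<longleftrightarrow> fs.subspace ?D \<and> (\<forall>v\<in>?D. \<forall>x. Ap x v \<in> ?D)"
    by (rule stable_iff_A) (rule pr_wspan[OF pr_Dv])
  then have D: "fs.subspace ?D" "\<And>v x. v \<in> ?D \<Longrightarrow> Ap x v \<in> ?D"
    using Dv_stable[OF refl] by blast+
  show "GD \<subseteq> Tfin" unfolding GD_def by blast
  show "Lrel (of_nat n) \<subseteq> GD"
    unfolding GD_def using Lrel_Tfin p_Lrel fs.subspace_0[OF D(1)] by fastforce
  show "fs.subspace GD"
    unfolding GD_def
  proof (rule fs.subspaceI; unfold mem_Collect_eq)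
    show "0 \<in> Tfin \<and> p 0 \<in> ?D"
      unfolding p_zero using fs.subspace_0[OF D(1)] fs.subspace_0[OF Tfin_subspace] by blast
    show "f + g \<in> Tfin \<and> p (f + g) \<in> ?D" if "f \<in> Tfin \<and> p f \<in> ?D" "g \<in> Tfin \<and> p g \<in> ?D" for f g
      unfolding p_add using that fs.subspace_add[OF D(1)] fs.subspace_add[OF Tfin_subspace] by blast
    show "fscale a f \<in> Tfin \<and> p (fscale a f) \<in> ?D" if "f \<in> Tfin \<and> p f \<in> ?D" for a f
      unfolding p_scale using that fs.subspace_scale[OF D(1)] fs.subspace_scale[OF Tfin_subspace] by blast
  qed
  fix f x assume "f \<in> GD"
  then have f: "f \<in> Tfin" "p f \<in> ?D" unfolding GD_def by blast+
  then show "act x f \<in> GD" unfolding GD_def using D(2)[OF f(2), of x] act_Tfin Ap_p by simp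
qed

lemma generator:
  obtains Dp where "Dp \<in> Tfin" "homog (2 * int n + 1) Dp" "p Dp = Dv n"
  using Dv_H[of n] unfolding H_def by fastforce

context
  fixes Dp assumes Dp: "Dp \<in> Tfin" "homog (2 * int n + 1) Dp" "p Dp = Dv n"
begin

lemma Dp_GD: "Dp \<in> GD"
  unfolding GD_def mem_Collect_eq Dp(3) using wspan_base[of _ "[]" "Dv n"] Dp(1) by simp

lemma GD_comp:
  assumes "f \<in> GD"
  shows "\<exists>s. comp (2 * int n + 1) f - fscale s Dp \<in> Lrel (of_nat n)"
    and "d < 2 * int n + 1 \<Longrightarrow> comp d f \<in> Lrel (of_nat n)"
  using leading_comp[OF Dp(1,2), of "\<lambda>(h, k). k < h" f] assms
  unfolding GD_def Dp(3) by blast+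

text \<open>Weights in \<open>GD\<close> start at \<open>2 n + 1\<close>, modulo relations, so no
  word leads back to weight 0.\<close>

lemma GD_Rad: "GD \<subseteq> Rad (of_nat n)"
proof
  fix f assume f: "f \<in> GD"
  then have "foldr act u f \<in> GD" for u
    using GD_submod foldr_act_closed[of GD] unfolding submod_iff by blast
  then have "comp 0 (foldr act u f) \<in> Lrel (of_nat n)" for u
    by (rule GD_comp(2)) simp
  then show "f \<in> Rad (of_nat n)" using f unfolding Rad_def GD_def by blast
qed

lemma p_mem_iff:
  assumes "submod (of_nat n) M" "f \<in> Tfin"
  shows "p f \<in> M \<longleftrightarrow> f \<in> M"
proof
  have M: "fs.subspace M" "p f - f \<in> M"
    using assms(1) p_diff_Lrel[OF assms(2)] unfolding submod_iff by blast+
  show "f \<in> M" if "p f \<in> M" using fs.subspace_diff[OF M(1) that M(2)] by (simp only: diff_diff_eq2 add_diff_cancel_left')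
  show "p f \<in> M" if "f \<in> M" using fs.subspace_add[OF M(1) M(2) that] by (simp only: diff_add_cancel)
qed

lemma p_mem: "submod (of_nat n) M \<Longrightarrow> f \<in> M \<Longrightarrow> p f \<in> M"
  using p_mem_iff[of M f] unfolding submod_iff by blast

text \<open>The vectors of \<open>M\<close> fixed by \<open>p\<close> model the quotient of
  \<open>M\<close> by the relations; they are what the results on stable subspaces apply to.\<close>

lemma fixed_stable:
  assumes "submod (of_nat n) M"
  shows "stable {v \<in> M. p v = v}"
proof -
  have M: "M \<subseteq> Tfin" "Lrel (of_nat n) \<subseteq> M" "fs.subspace M" "\<And>f x. f \<in> M \<Longrightarrow> act x f \<in> M"
    using assms unfolding submod_iff by blast+
  have "stable {v \<in> M. p v = v} \<longleftrightarrow> fs.subspace {v \<in> M. p v = v} \<and> (\<forall>v\<in>{v \<in> M. p v = v}. \<forall>x. Ap x v \<in> {v \<in> M. p v = v})"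
    by (rule stable_iff_A) blast
  moreover have "fs.subspace {v \<in> M. p v = v}"
  proof (rule fs.subspaceI; unfold mem_Collect_eq)
    show "0 \<in> M \<and> p 0 = 0" using p_zero fs.subspace_0[OF M(3)] by blast
    show "f + g \<in> M \<and> p (f + g) = f + g" if "f \<in> M \<and> p f = f" "g \<in> M \<and> p g = g" for f g
      using that fs.subspace_add[OF M(3)] unfolding p_add by metis
    show "fscale a f \<in> M \<and> p (fscale a f) = fscale a f" if "f \<in> M \<and> p f = f" for a f
      using that fs.subspace_scale[OF M(3)] unfolding p_scale by metis
  qed
  moreover have "Ap x v \<in> {v \<in> M. p v = v}" if v: "v \<in> {v \<in> M. p v = v}" for x v
  proof -
    have "act x (p v) \<in> M" using v M(4) by auto
    then show ?thesis using p_idem p_mem[OF assms] by blast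
  qed
  ultimately show ?thesis by blast
qed

text \<open>\<open>M\<close> is intersected with the radical because
  \<open>proper_stable_subset_ideal\<close> asks for \<open>I \<subseteq> Rd\<close>;
  \<open>E 1 0\<close> then provides the power vector in \<open>I\<close>.\<close>

lemma Rad_subset:
  assumes M: "submod (of_nat n) M" "Dp \<in> M"
  shows "Rad (of_nat n) \<subseteq> M"
proof
  fix f assume f: "f \<in> Rad (of_nat n)"
  let ?I = "{v \<in> M \<inter> Rad (of_nat n). p v = v}" and ?R = "{v \<in> Rad (of_nat n). p v = v}"
  have sub: "submod (of_nat n) (M \<inter> Rad (of_nat n))"
    using M(1) Rad_submod[of "of_nat n"] fs.subspace_inter[of M "Rad (of_nat n)"] unfolding submod_iff by blast
  have I: "stable ?I" by (rule fixed_stable[OF sub])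
  have R: "stable ?R" by (rule fixed_stable[OF Rad_submod])
  have "Dp \<in> M \<inter> Rad (of_nat n)" using M(2) Dp_GD GD_Rad by blast
  then have "Dv n \<in> ?I" using p_mem[OF sub] pr_Dv Dp(3) by fastforce
  then have Z: "Zv (Suc n) \<in> ?I" unfolding E10_Dv[symmetric] by (rule stableD[OF I])
  have "p (wd []) \<notin> ?R" using p_mem_iff[OF Rad_submod wd_Tfin] vac_not_Rad[OF vac_not_Lrel] by blast
  moreover have fT: "f \<in> Tfin" using f unfolding Rad_def by blast
  moreover have "p f \<in> ?R" using p_mem[OF Rad_submod f] p_idem by blast
  ultimately have "p f \<in> ?I"
    using proper_stable_subset_ideal[OF refl I Z _ R _ p_in_V0[OF fT]] by blast
  then show "f \<in> M" using p_mem_iff[OF M(1) fT] by blast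
qed

lemma Rad_eq_GD: "Rad (of_nat n) = GD"
  using GD_Rad Rad_subset[OF GD_submod Dp_GD] by blast

lemma gen_sub_eq_Rad: "gen_sub (of_nat n) Dp = Rad (of_nat n)"
  using Rad_subset Rad_submod Dp_GD GD_Rad unfolding gen_sub_def by blast

lemma Dp_not_Lrel: "Dp \<notin> Lrel (of_nat n)"
  using Dv_nonzero p_Lrel[of Dp] Dp(3) by (simp only: simp_thms) blast

lemma GD_homog_Lrel:
  assumes "f \<in> GD" "homog d f" "d < 2 * int n + 1"
  shows "f \<in> Lrel (of_nat n)"
  using GD_comp(2)[OF assms(1,3)] unfolding comp_homog[OF assms(2)] if_P[OF refl] .

text \<open>The image stays in \<open>GD\<close> but falls below its minimal weight.\<close>

lemma act_Dp_Lrel: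
  assumes "gwt x < 0"
  shows "act x Dp \<in> Lrel (of_nat n)"
proof (rule GD_homog_Lrel[OF _ homog_act[OF Dp(2)]])
  show "act x Dp \<in> GD" using GD_submod Dp_GD unfolding submod_iff by blast
qed (use assms in simp)

text \<open>All modes in the definition of a singular vector have negative weight: the mode number
  is at least 1 for \<open>E0\<close>, \<open>E1\<close> and \<open>Em\<close>, and at least 0 for
  \<open>Ep\<close>, whose half unit has the opposite sign to that of \<open>Em\<close>.\<close>

lemma Dp_singular: "singular (of_nat n) Dp"
  unfolding singular_def
  by (intro conjI exI[of _ "2 * int n + 1"] Dp(2) ballI allI impI act_Dp_Lrel) auto

end

end

theorem mainTheorem4:
  fixes n :: nat
  assumes "n \<ge> 1"
  shows "\<exists>Dp \<in> SI (of_nat n).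
           homog (2 * int n + 1) Dp \<and> Dp \<notin> Lrel (of_nat n)
         \<and> (\<forall>f \<in> SI (of_nat n). \<forall>d. homog d f \<and> f \<notin> Lrel (of_nat n) \<longrightarrow> 2 * int n + 1 \<le> d)
         \<and> (\<forall>f \<in> SI (of_nat n). homog (2 * int n + 1) f \<longrightarrow>
               (\<exists>s::complex. (\<lambda>w. f w - s * Dp w) \<in> Lrel (of_nat n)))
         \<and> singular (of_nat n) Dp
         \<and> gen_sub (of_nat n) Dp = SI (of_nat n)"
proof -
  have "Lrel (of_nat n) \<subseteq> Tfin" using Lrel_Tfin by blast
  then obtain p where "vacmod (of_nat n) p"
    by (rule linear_projection[OF Lrel_subspace Tfin_subspace]) (rule that, rule vacmod.intro)
  then interpret vacmod_nat n p by (rule vacmod_nat.intro)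
  obtain Dp where Dp: "Dp \<in> Tfin" "homog (2 * int n + 1) Dp" "p Dp = Dv n" by (rule generator)
  \<comment> \<open>With the maximal submodule identified with \<open>GD\<close>, minimality and
    uniqueness are statements about leading terms in \<open>GD\<close>.\<close>
  have SI: "SI (of_nat n) = GD" using SI_eq_Rad[OF vac_not_Lrel] Rad_eq_GD[OF Dp] by simp
  show ?thesis
    unfolding SI
  proof (intro bexI conjI ballI allI impI)
    show "homog (2 * int n + 1) Dp" by (rule Dp(2))
    show "Dp \<notin> Lrel (of_nat n)" by (rule Dp_not_Lrel[OF Dp])
    show "2 * int n + 1 \<le> d" if "f \<in> GD" "homog d f \<and> f \<notin> Lrel (of_nat n)" for f d
      using GD_homog_Lrel[OF Dp that(1)] that(2) by force
    show "\<exists>s. (\<lambda>w. f w - s * Dp w) \<in> Lrel (of_nat n)" if "f \<in> GD" "homog (2 * int n + 1) f" for f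
    proof -
      have "(\<lambda>w. f w - s * Dp w) = f - fscale s Dp" for s by (rule ext) simp
      then show ?thesis using GD_comp(1)[OF Dp that(1)] comp_homog[OF that(2)] by (simp only: if_True simp_thms)
    qed
    show "singular (of_nat n) Dp" by (rule Dp_singular[OF Dp])
    show "gen_sub (of_nat n) Dp = GD" using gen_sub_eq_Rad[OF Dp] Rad_eq_GD[OF Dp] by simp
    show "Dp \<in> GD" by (rule Dp_GD[OF Dp])
  qed
qed

end
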